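(* Let $p\in[1,\infty]$, $\eta=\min(\alpha-1,\beta,\gamma)$ and fix two constants $C_{\rm i},T>0$. Let $v=(v_n)_{n\in\mathbb Z}$ be a localized solution of the stationary discrete $p$-Schrödinger equation, of site-centered type ($i=1$) or bond-centered type ($i=2$), as described in the context. There exist $\varepsilon_T,C_T>0$ such that for all $\varepsilon\in(0,\varepsilon_T]$ and for all $X^0\in\ell_p^2$ satisfying $$\|X^0-(\sqrt2\,\varepsilon\,v,\,0)^T\|_p\le C_{\rm i}\,\varepsilon^{1+\eta},$$ the solution $X(t)\in\ell_p^2$ of $\dot X=JX+G(X)$ with $X(0)=X^0$ is defined at least for $t\in[0,T\varepsilon^{1-\alpha}]$ and satisfies $$\|X(t)-X^\varepsilon_{\rm b}(t)\|_p\le C_T\,\varepsilon^{1+\eta}\quad\text{for all }t\in[0,T\varepsilon^{1-\alpha}],$$ where $$X^\varepsilon_{\rm b}(t)=\sqrt2\,\varepsilon\,\big(v\cos(\Omega t),\,-v\sin(\Omega t)\big)^T,\qquad\Omega=1+\omega_0\,\varepsilon^{\alpha-1}.$$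
   Context: **Lattice model.** Fix $\alpha>1$, real $(k_-,k_+)\ne(0,0)$ and $\beta,\gamma>0$. Let $V\in C^2(\mathbb R,\mathbb R)$, $V=V_\alpha+W$, where $V_\alpha(r)=\frac{k_-}{1+\alpha}|r|^{\alpha+1}$ for $r\le0$, $V_\alpha(r)=\frac{k_+}{1+\alpha}r^{\alpha+1}$ for $r\ge0$, and $W'(0)=0$, $W''(r)=O(|r|^{\alpha-1+\beta})$ as $r\to0$. Let $\phi\in C^2(\mathbb R,\mathbb R)$ with $\phi'(0)=0$, $\phi''(x)=O(|x|^{\alpha-1+\gamma})$ as $x\to0$. For sequences, $(\delta^+x)_n=x_{n+1}-x_n$, $(\delta^-x)_n=x_n-x_{n-1}$, and scalar functions act componentwise. Set $F(x)=\delta^+V'(\delta^-x)-\phi'(x)$. The lattice $\ddot x_n+x_n=F(x)_n$, $n\in\mathbb Z$, is written for $X=(x,\dot x)^T\in\ell_p^2=\ell_p(\mathbb Z,\mathbb R)^2$ as $\dot X=JX+G(X)$, with $J=\begin{pmatrix}0&\mathrm{Id}\\-\mathrm{Id}&0\end{pmatrix}$ and $G(X_1,X_2)=(0,F(X_1))^T$. Norms on $\ell_p^2$: for $X=(x,y)^T$, $\|X\|_p=\big(\sum_n(x_n^2+y_n^2)^{p/2}\big)^{1/p}$ if $p<\infty$, and $\|X\|_\infty=\sup_n(x_n^2+y_n^2)^{1/2}$. Also $$\omega_0=(k_-+k_+)\,2^{\frac{\alpha-3}{2}}\,\frac{\alpha\,\Gamma(\alpha/2)}{\sqrt\pi\,(\alpha+1)\,\Gamma((\alpha+1)/2)}.$$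 **Localized stationary solutions.** The stationary equation for real sequences is $v_n=-(\Delta_{\alpha+1}v)_n$, $n\in\mathbb Z$, where $(\Delta_{\alpha+1}v)_n=(v_{n+1}-v_n)|v_{n+1}-v_n|^{\alpha-1}-(v_n-v_{n-1})|v_n-v_{n-1}|^{\alpha-1}$. The solutions $v=v^i$ considered ($i=1,2$) satisfy: $\lim_{n\to\pm\infty}v_n=0$; $(-1)^nv_n>0$ and $|v_n|>|v_{n-1}|$ for all $n\le0$; $v_n=v_{-n}$ for all $n$ (type $i=1$) or $v_n=-v_{-n+1}$ for all $n$ (type $i=2$); and for every $q\in(0,1)$ there is $n_0\in\mathbb N$ with $|v_n|\le q^{1+\alpha^{n-n_0}}$ for all $n\ge n_0$ (in particular $v\in\ell_p$ for all $p\in[1,\infty]$). Existence of such solutions of both types is a known theorem. *)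

theory Defs
  imports "HOL-Analysis.Analysis" "HOL-Library.Landau_Symbols"
begin

definition C2 :: "(real \<Rightarrow> real) \<Rightarrow> bool" where
  "C2 f \<longleftrightarrow>
     (\<forall>x. f field_differentiable at x) \<and>
     (\<forall>x. deriv f field_differentiable at x) \<and>
     continuous_on UNIV (deriv (deriv f))"

text \<open>
  Sequence spaces over the integers. The phase space \<open>\<ell>\<^sub>p\<^sup>2\<close> is represented as the space of
  \<open>p\<close>-summable sequences \<open>X :: int \<Rightarrow> real \<times> real\<close>, with \<open>X n = (x n, y n)\<close>. The norm of
  \<^typ>\<open>real \<times> real\<close> is the Euclidean one, so that \<open>lp_norm\<close> below is the norm
  \<open>(\<Sum>n. (x\<^sub>n\<^sup>2 + y\<^sub>n\<^sup>2)\<^bsup>p/2\<^esup>)\<^bsup>1/p\<^esup>\<close>, respectively \<open>sup\<^sub>n (x\<^sub>n\<^sup>2 + y\<^sub>n\<^sup>2)\<^bsup>1/2\<^esup>\<close>. Its value is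
  meaningful only on \<open>lp p\<close>, and \<open>1 \<le> p \<le> \<infinity>\<close> is intended.
\<close>

definition lp :: "ennreal \<Rightarrow> (int \<Rightarrow> 'a::real_normed_vector) set" where
  "lp p = {X. if p = \<infinity> then bdd_above (range (\<lambda>n. norm (X n)))
              else (\<lambda>n. norm (X n) powr enn2real p) summable_on UNIV}"

definition lp_norm :: "ennreal \<Rightarrow> (int \<Rightarrow> 'a::real_normed_vector) \<Rightarrow> real" where
  "lp_norm p X = (if p = \<infinity> then (SUP n. norm (X n))
                  else (\<Sum>\<^sub>\<infinity>n. norm (X n) powr enn2real p) powr (1 / enn2real p))"

text \<open>
  The derivative of a curve is taken in the norm of \<open>lp p\<close>, not componentwise; it is one-sided
  at the end points when \<open>I\<close> is a compact interval. All membership requirements are explicit,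
  since \<open>lp_norm\<close> has junk values outside \<open>lp p\<close>.
\<close>

definition has_lp_derivative ::
  "ennreal \<Rightarrow> (real \<Rightarrow> int \<Rightarrow> 'a::real_normed_vector) \<Rightarrow> (int \<Rightarrow> 'a) \<Rightarrow> real \<Rightarrow> real set \<Rightarrow> bool" where
  "has_lp_derivative p X D t I \<longleftrightarrow>
     (\<forall>s\<in>I. X s \<in> lp p) \<and> D \<in> lp p \<and>
     ((\<lambda>s. lp_norm p (\<lambda>n. (X s n - X t n) /\<^sub>R (s - t) - D n)) \<longlongrightarrow> 0) (at t within I)"

definition lp_solution ::
  "ennreal \<Rightarrow> ((int \<Rightarrow> 'a) \<Rightarrow> int \<Rightarrow> 'a) \<Rightarrow> (int \<Rightarrow> 'a) \<Rightarrow> real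
     \<Rightarrow> (real \<Rightarrow> int \<Rightarrow> 'a::real_normed_vector) \<Rightarrow> bool" where
  "lp_solution p f X0 S X \<longleftrightarrow>
     X 0 = X0 \<and> (\<forall>t\<in>{0..S}. has_lp_derivative p X (f (X t)) t {0..S})"

definition V_hom :: "real \<Rightarrow> real \<Rightarrow> real \<Rightarrow> real \<Rightarrow> real" where
  "V_hom \<alpha> k_minus k_plus r =
     (if r \<le> 0 then k_minus / (1 + \<alpha>) * \<bar>r\<bar> powr (\<alpha> + 1)
      else k_plus / (1 + \<alpha>) * r powr (\<alpha> + 1))"

definition delta_plus :: "(int \<Rightarrow> real) \<Rightarrow> int \<Rightarrow> real" where
  "delta_plus x n = x (n + 1) - x n"

definition delta_minus :: "(int \<Rightarrow> real) \<Rightarrow> int \<Rightarrow> real" where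
  "delta_minus x n = x n - x (n - 1)"

definition lattice_F :: "(real \<Rightarrow> real) \<Rightarrow> (real \<Rightarrow> real) \<Rightarrow> (int \<Rightarrow> real) \<Rightarrow> int \<Rightarrow> real" where
  "lattice_F V \<phi> x n = delta_plus (deriv V \<circ> delta_minus x) n - deriv \<phi> (x n)"

definition lattice_J :: "(int \<Rightarrow> real \<times> real) \<Rightarrow> int \<Rightarrow> real \<times> real" where
  "lattice_J X n = (snd (X n), - fst (X n))"

definition lattice_G ::
  "(real \<Rightarrow> real) \<Rightarrow> (real \<Rightarrow> real) \<Rightarrow> (int \<Rightarrow> real \<times> real) \<Rightarrow> int \<Rightarrow> real \<times> real" where
  "lattice_G V \<phi> X n = (0, lattice_F V \<phi> (fst \<circ> X) n)"

definition omega0 :: "real \<Rightarrow> real \<Rightarrow> real \<Rightarrow> real" where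
  "omega0 \<alpha> k_minus k_plus =
     (k_minus + k_plus) * 2 powr ((\<alpha> - 3) / 2) *
     (\<alpha> * Gamma (\<alpha> / 2) / (sqrt pi * (\<alpha> + 1) * Gamma ((\<alpha> + 1) / 2)))"

text \<open>The discrete \<open>(\<alpha> + 1)\<close>-Laplacian \<open>\<Delta>\<^bsub>\<alpha>+1\<^esub>\<close>.\<close>

definition discrete_laplacian :: "real \<Rightarrow> (int \<Rightarrow> real) \<Rightarrow> int \<Rightarrow> real" where
  "discrete_laplacian \<alpha> v n =
     (v (n + 1) - v n) * \<bar>v (n + 1) - v n\<bar> powr (\<alpha> - 1)
     - (v n - v (n - 1)) * \<bar>v n - v (n - 1)\<bar> powr (\<alpha> - 1)"

definition site_centered :: "(int \<Rightarrow> real) \<Rightarrow> bool" where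
  "site_centered v \<longleftrightarrow> (\<forall>n. v n = v (- n))"

definition bond_centered :: "(int \<Rightarrow> real) \<Rightarrow> bool" where
  "bond_centered v \<longleftrightarrow> (\<forall>n. v n = - v (- n + 1))"

definition localized_stationary :: "real \<Rightarrow> (int \<Rightarrow> real) \<Rightarrow> bool" where
  "localized_stationary \<alpha> v \<longleftrightarrow>
     (\<forall>n. v n = - discrete_laplacian \<alpha> v n) \<and>
     (v \<longlongrightarrow> 0) at_top \<and> (v \<longlongrightarrow> 0) at_bot \<and>
     (\<forall>n\<le>0. (-1) powi n * v n > 0 \<and> \<bar>v n\<bar> > \<bar>v (n - 1)\<bar>) \<and>
     (site_centered v \<or> bond_centered v) \<and>
     (\<forall>q\<in>{0<..<1}. \<exists>n0::nat. \<forall>n\<ge>n0. \<bar>v (int n)\<bar> \<le> q powr (1 + \<alpha> ^ (n - n0)))"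

definition breather :: "real \<Rightarrow> real \<Rightarrow> (int \<Rightarrow> real) \<Rightarrow> real \<Rightarrow> int \<Rightarrow> real \<times> real" where
  "breather \<epsilon> \<Omega> v t n =
     (sqrt 2 * \<epsilon>) *\<^sub>R (v n * cos (\<Omega> * t), - (v n * sin (\<Omega> * t)))"

end

theory Submission
  imports Defs
begin

text \<open>
  Passing to the frame that rotates with the breather's own frequency \<open>\<Omega>\<close> turns the breather into the
  constant \<open>\<surd>2 \<epsilon> (v, 0)\<close>; let \<open>E\<close> be the difference between the rotated solution and this constant.
  Three terms drive \<open>E\<close>. The detuning \<open>\<Omega> - 1\<close> and the Lipschitz constant of the force on a ball of radius
  \<open>O(\<epsilon>)\<close> are both \<open>O(\<epsilon>\<^bsup>\<alpha>-1\<^esup>)\<close>, so over a time \<open>T \<epsilon>\<^bsup>1-\<alpha>\<^esup>\<close> they amplify \<open>E\<close> only by a constant factor.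
  The parts of \<open>V\<close> and \<open>\<phi>\<close> of higher order contribute \<open>O(\<epsilon>\<^bsup>\<alpha>+min(\<beta>,\<gamma>)\<^esup>)\<close> per unit of time, which integrates to
  \<open>O(\<epsilon>\<^bsup>1+min(\<beta>,\<gamma>)\<^esup>)\<close>. What remains is the homogeneous force on the breather minus the detuning of the
  breather: it has size \<open>\<epsilon>\<^sup>\<alpha>\<close>, which would integrate to an inadmissible \<open>O(\<epsilon>)\<close>, but it is a periodic function of the
  phase \<open>\<Omega> t\<close> with mean zero. That its mean vanishes is exactly the stationary equation together with the
  value of \<open>\<omega>\<^sub>0\<close>, which is computed with a Beta integral. It therefore has a bounded antiderivative, and
  subtracting it from \<open>E\<close> costs only \<open>O(\<epsilon>\<^sup>\<alpha>)\<close>, hence \<open>O(\<epsilon>\<^bsup>1+\<eta>\<^esup>)\<close> as \<open>\<eta> \<le> \<alpha> - 1\<close>. This is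
  \<open>breather_error_estimate\<close>.

  All \<open>p \<in> [1, \<infinity>]\<close> are treated at once by never integrating an \<open>\<ell>\<^sub>p\<close> norm. The forces couple nearest neighbours
  only, so every estimate is an inequality between scalar functions at each site, closed up by the operator
  \<open>nbr_sum\<close> that adds up the values at a site and its two neighbours. Iterating such an inequality bounds the
  solution, site by site and uniformly in time, by a sequence obtained from the data through the exponential series of \<open>nbr_sum\<close>
  (\<open>lattice_gronwall\<close>). Since \<open>nbr_sum\<close> has norm at most \<open>3\<close> on each \<open>\<ell>\<^sub>p\<close>, this dominating sequence lies in \<open>\<ell>\<^sub>p\<close>.
  The same domination shows that the solution of the initial value problem, constructed in \<open>\<ell>\<^sub>\<infinity>\<close> by Picard
  iteration, stays in \<open>\<ell>\<^sub>p\<close>, is differentiable there and is unique.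

  No continuation argument is needed. The forces are cut off outside a ball of radius proportional to \<open>\<epsilon>\<close>, which
  makes them globally Lipschitz with the small constant above and the solution global. The error estimate
  then shows that this solution never reaches the cut-off region, so it solves the original equation.
\<close>

section \<open>Sequence spaces\<close>

text \<open>
  Membership and a norm bound in one predicate: together they are equivalent to bounds on finite partial sums
  (on single terms if \<open>p = \<infinity>\<close>), so the rules below need no separate summability arguments.
\<close>

definition lp_bound :: "ennreal \<Rightarrow> (int \<Rightarrow> 'a::real_normed_vector) \<Rightarrow> real \<Rightarrow> bool" where
  "lp_bound p X C \<longleftrightarrow> X \<in> lp p \<and> lp_norm p X \<le> C"

lemma lp_bound_infinity_iff: "lp_bound top X C \<longleftrightarrow> (\<forall>n. norm (X n) \<le> C)"
proof
  assume "lp_bound top X C"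
  then have "bdd_above (range (\<lambda>n. norm (X n)))" "(SUP n. norm (X n)) \<le> C"
    by (auto simp: lp_bound_def lp_def lp_norm_def)
  then show "\<forall>n. norm (X n) \<le> C"
    by (meson UNIV_I cSUP_upper order_trans)
next
  assume *: "\<forall>n. norm (X n) \<le> C"
  then have "bdd_above (range (\<lambda>n. norm (X n)))" by (intro bdd_aboveI2[where M=C]) auto
  moreover have "(SUP n. norm (X n)) \<le> C" using * by (intro cSUP_least) auto
  ultimately show "lp_bound top X C" by (auto simp: lp_bound_def lp_def lp_norm_def)
qed

lemma enn2real_ge_1: "1 \<le> p \<Longrightarrow> p \<noteq> \<infinity> \<Longrightarrow> 1 \<le> enn2real p"
  by (metis enn2real_1 enn2real_mono ennreal_less_top infinity_ennreal_def top.not_eq_extremum)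

lemma lp_bound_finite_iff:
  assumes "1 \<le> p" "p \<noteq> \<infinity>" "0 \<le> C"
  shows "lp_bound p X C \<longleftrightarrow>
    (\<forall>A. finite A \<longrightarrow> (\<Sum>n\<in>A. norm (X n) powr enn2real p) \<le> C powr enn2real p)"
proof -
  let ?r = "enn2real p" and ?f = "\<lambda>n. norm (X n) powr enn2real p"
  have r: "?r \<ge> 1" using assms enn2real_ge_1 by blast
  have root: "I powr (1 / ?r) \<le> C \<longleftrightarrow> I \<le> C powr ?r" if "I \<ge> 0" for I :: real
  proof -
    have "I powr (1 / ?r) \<le> C \<longleftrightarrow> (I powr (1 / ?r)) powr ?r \<le> C powr ?r"
      using r assms(3) by (smt (verit) powr_ge_zero powr_less_mono2 powr_mono2)
    also have "(I powr (1 / ?r)) powr ?r = I" using r that by (simp add: powr_powr)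
    finally show ?thesis .
  qed
  show ?thesis
  proof
    assume "lp_bound p X C"
    then have s: "?f summable_on UNIV" and "infsum ?f UNIV powr (1 / ?r) \<le> C"
      using assms by (auto simp: lp_bound_def lp_def lp_norm_def)
    then have "infsum ?f UNIV \<le> C powr ?r" using root by (simp add: infsum_nonneg)
    then show "\<forall>A. finite A \<longrightarrow> sum ?f A \<le> C powr ?r"
      using finite_sum_le_infsum[OF s] by (meson order_trans powr_ge_zero subset_UNIV)
  next
    assume *: "\<forall>A. finite A \<longrightarrow> sum ?f A \<le> C powr ?r"
    have s: "?f summable_on UNIV"
      by (rule nonneg_bdd_above_summable_on) (use * in \<open>auto intro!: bdd_aboveI2\<close>)
    have "infsum ?f UNIV \<le> C powr ?r" by (rule infsum_le_finite_sums[OF s]) (use * in auto)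
    then show "lp_bound p X C"
      using s assms root by (auto simp: lp_bound_def lp_def lp_norm_def infsum_nonneg)
  qed
qed

lemma lp_norm_nonneg: "X \<in> lp p \<Longrightarrow> 0 \<le> lp_norm p X"
proof (cases "p = \<infinity>")
  case True
  assume "X \<in> lp p"
  then have "bdd_above (range (\<lambda>n. norm (X n)))" using True by (simp add: lp_def)
  then have "norm (X 0) \<le> (SUP n. norm (X n))" by (intro cSUP_upper) auto
  then show ?thesis using True by (auto simp: lp_norm_def intro: order_trans[OF norm_ge_zero])
qed (simp add: lp_norm_def)

lemma lp_bound_norm: "X \<in> lp p \<Longrightarrow> lp_bound p X (lp_norm p X)"
  by (simp add: lp_bound_def)

lemma lp_bound_nonneg: "lp_bound p X C \<Longrightarrow> 0 \<le> C"
  using lp_norm_nonneg by (fastforce simp: lp_bound_def)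

lemma lp_bound_mono:
  assumes p: "1 \<le> p" and Y: "lp_bound p Y C" and le: "\<And>n. norm (X n) \<le> norm (Y n)"
  shows "lp_bound p X C"
proof (cases "p = \<infinity>")
  case True
  then show ?thesis using Y le by (auto simp: lp_bound_infinity_iff intro: order_trans)
next
  case False
  have r: "enn2real p \<ge> 1" using enn2real_ge_1[OF p False] .
  have C: "0 \<le> C" using lp_bound_nonneg[OF Y] .
  have "(\<Sum>n\<in>A. norm (X n) powr enn2real p) \<le> C powr enn2real p" if "finite A" for A
  proof -
    have "(\<Sum>n\<in>A. norm (X n) powr enn2real p) \<le> (\<Sum>n\<in>A. norm (Y n) powr enn2real p)"
      using r by (intro sum_mono powr_mono2 le) auto
    also have "\<dots> \<le> C powr enn2real p"
      using Y that by (simp add: lp_bound_finite_iff[OF p False C])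
    finally show ?thesis .
  qed
  then show ?thesis by (simp add: lp_bound_finite_iff[OF p False C])
qed

lemma lp_bound_weaken: "lp_bound p X C \<Longrightarrow> C \<le> D \<Longrightarrow> lp_bound p X D"
  by (auto simp: lp_bound_def)

lemma lp_bound_pointwise:
  assumes p: "1 \<le> p" and X: "lp_bound p X C"
  shows "norm (X n) \<le> C"
proof (cases "p = \<infinity>")
  case True
  then show ?thesis using X by (auto simp: lp_bound_infinity_iff)
next
  case False
  have r: "enn2real p \<ge> 1" using enn2real_ge_1[OF p False] .
  have C: "0 \<le> C" using lp_bound_nonneg[OF X] .
  have "(\<Sum>n\<in>{n}. norm (X n) powr enn2real p) \<le> C powr enn2real p"
    using X unfolding lp_bound_finite_iff[OF p False C] by blast
  then show ?thesis using r C
    by simp (smt (verit) norm_ge_zero powr_less_mono2)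
qed

lemma lp_bound_zero:
  assumes "1 \<le> p" "0 \<le> C" shows "lp_bound p (\<lambda>n. 0) C"
  using assms by (cases "p = \<infinity>") (auto simp: lp_bound_infinity_iff lp_bound_finite_iff)

lemma lp_bound_scaleR:
  assumes p: "1 \<le> p" and X: "lp_bound p X C"
  shows "lp_bound p (\<lambda>n. c *\<^sub>R X n) (\<bar>c\<bar> * C)"
proof (cases "p = \<infinity>")
  case True
  then show ?thesis using X by (auto simp: lp_bound_infinity_iff mult_left_mono)
next
  case False
  have C: "0 \<le> C" using lp_bound_nonneg[OF X] .
  then have cC: "0 \<le> \<bar>c\<bar> * C" by simp
  have "(\<Sum>n\<in>A. norm (c *\<^sub>R X n) powr enn2real p) \<le> (\<bar>c\<bar> * C) powr enn2real p" if "finite A" for A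
  proof -
    have "(\<Sum>n\<in>A. norm (c *\<^sub>R X n) powr enn2real p)
        = \<bar>c\<bar> powr enn2real p * (\<Sum>n\<in>A. norm (X n) powr enn2real p)"
      by (simp add: powr_mult sum_distrib_left)
    also have "\<dots> \<le> \<bar>c\<bar> powr enn2real p * C powr enn2real p"
      using X that by (simp add: lp_bound_finite_iff[OF p False C] mult_left_mono)
    finally show ?thesis using C by (simp add: powr_mult)
  qed
  then show ?thesis by (simp add: lp_bound_finite_iff[OF p False cC])
qed

lemma lp_bound_shift:
  assumes p: "1 \<le> p" and X: "lp_bound p X C"
  shows "lp_bound p (\<lambda>n. X (n + k)) C"
proof (cases "p = \<infinity>")
  case True
  then show ?thesis using X by (auto simp: lp_bound_infinity_iff)
next
  case False
  have C: "0 \<le> C" using lp_bound_nonneg[OF X] .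
  have "(\<Sum>n\<in>A. norm (X (n + k)) powr enn2real p) \<le> C powr enn2real p" if "finite A" for A
  proof -
    have "(\<Sum>n\<in>A. norm (X (n + k)) powr enn2real p) = (\<Sum>n\<in>(\<lambda>n. n + k) ` A. norm (X n) powr enn2real p)"
      by (subst sum.reindex) auto
    then show ?thesis using X that by (simp add: lp_bound_finite_iff[OF p False C])
  qed
  then show ?thesis by (simp add: lp_bound_finite_iff[OF p False C])
qed

text \<open>
  The Fatou property: bounds on single terms and on finite partial sums pass to pointwise limits.
\<close>

lemma lp_bound_limit:
  assumes p: "1 \<le> p" and Xk: "\<And>k. lp_bound p (X k) C" and lim: "\<And>n. (\<lambda>k::nat. X k n) \<longlonglongrightarrow> Y n"
  shows "lp_bound p Y C"
proof (cases "p = \<infinity>")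
  case True
  have "norm (Y n) \<le> C" for n
    using Xk True by (intro LIMSEQ_le_const2[OF tendsto_norm[OF lim]]) (auto simp: lp_bound_infinity_iff)
  then show ?thesis using True by (simp add: lp_bound_infinity_iff)
next
  case False
  have r: "enn2real p \<ge> 1" using enn2real_ge_1[OF p False] .
  have C: "0 \<le> C" using lp_bound_nonneg[OF Xk] .
  have "(\<Sum>n\<in>A. norm (Y n) powr enn2real p) \<le> C powr enn2real p" if "finite A" for A
  proof (rule LIMSEQ_le_const2)
    show "(\<lambda>k. \<Sum>n\<in>A. norm (X k n) powr enn2real p) \<longlonglongrightarrow> (\<Sum>n\<in>A. norm (Y n) powr enn2real p)"
      using r by (intro tendsto_sum tendsto_powr' tendsto_norm lim tendsto_const) auto
  qed (use Xk that in \<open>auto simp: lp_bound_finite_iff[OF p False C]\<close>)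
  then show ?thesis by (simp add: lp_bound_finite_iff[OF p False C])
qed

lemma powr_convex_combination:
  fixes x y l r :: real
  assumes "1 \<le> r" "0 \<le> x" "0 \<le> y" "0 < l" "l < 1"
  shows "(l * x + (1 - l) * y) powr r \<le> l * x powr r + (1 - l) * y powr r"
proof -
  have end_point: "(m * z) powr r \<le> m * z powr r" if "0 < m" "m < 1" "0 \<le> z" for m z :: real
  proof -
    have "(m * z) powr r = m powr r * z powr r" using that by (simp add: powr_mult)
    also have "m powr r \<le> m powr 1" using that assms by (intro powr_mono') auto
    finally show ?thesis using that by (simp add: mult_right_mono)
  qed
  show ?thesis
  proof (cases "x = 0 \<or> y = 0")
    case True
    then show ?thesis using end_point[of l x] end_point[of "1 - l" y] assms by auto
  next
    case False
    have "convex_on {0<..} (\<lambda>x::real. x powr r)" using powr_convex assms by blast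
    from convex_onD[OF this, of "1 - l" x y] show ?thesis using False assms by simp
  qed
qed

text \<open>
  Minkowski's inequality. With weights \<open>l = C / (C + D)\<close> and \<open>1 - l\<close> the sum \<open>X + Y\<close> is \<open>C + D\<close> times a convex
  combination of the normalised sequences \<open>X / C\<close> and \<open>Y / D\<close>, and \<open>x \<mapsto> x\<^sup>r\<close> is convex.
\<close>

lemma lp_bound_add:
  assumes p: "1 \<le> p" and X: "lp_bound p X C" and Y: "lp_bound p Y D"
  shows "lp_bound p (\<lambda>n. X n + Y n) (C + D)"
proof (cases "p = \<infinity>")
  case True
  then show ?thesis using X Y by (auto simp: lp_bound_infinity_iff intro: norm_triangle_le add_mono)
next
  case False
  let ?r = "enn2real p"
  have r: "?r \<ge> 1" using enn2real_ge_1[OF p False] .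
  have C: "0 \<le> C" using lp_bound_nonneg[OF X] .
  have D: "0 \<le> D" using lp_bound_nonneg[OF Y] .
  show ?thesis
  proof (cases "C = 0 \<or> D = 0")
    case True
    have "X n = 0" if "C = 0" for n using lp_bound_pointwise[OF p X, of n] that by simp
    moreover have "Y n = 0" if "D = 0" for n using lp_bound_pointwise[OF p Y, of n] that by simp
    ultimately show ?thesis using True X Y by auto
  next
    case nz: False
    define l where "l = C / (C + D)"
    have l: "0 < l" "l < 1" "1 - l = D / (C + D)" using nz C D by (auto simp: l_def field_simps)
    have CD: "0 \<le> C + D" using C D by simp
    have "(\<Sum>n\<in>A. norm (X n + Y n) powr ?r) \<le> (C + D) powr ?r" if A: "finite A" for A
    proof -
      have pointwise: "norm (X n + Y n) powr ?r \<le>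
        (C + D) powr ?r * (l * (norm (X n) powr ?r / C powr ?r) + (1 - l) * (norm (Y n) powr ?r / D powr ?r))" for n
      proof -
        have "norm (X n + Y n) powr ?r \<le> (norm (X n) + norm (Y n)) powr ?r"
          using r by (intro powr_mono2 norm_triangle_ineq) auto
        also have "norm (X n) + norm (Y n) = (C + D) * (l * (norm (X n) / C) + (1 - l) * (norm (Y n) / D))"
        proof -
          have "C + D \<noteq> 0" using nz C D by auto
          have "(C + D) * (l * (norm (X n) / C)) = norm (X n)"
            using nz \<open>C + D \<noteq> 0\<close> by (simp add: l_def)
          moreover have "(C + D) * ((1 - l) * (norm (Y n) / D)) = norm (Y n)"
            using nz \<open>C + D \<noteq> 0\<close> by (simp add: l(3))
          ultimately show ?thesis by (simp only: distrib_left)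
        qed
        also have "(\<dots>) powr ?r = (C + D) powr ?r * (l * (norm (X n) / C) + (1 - l) * (norm (Y n) / D)) powr ?r"
          using CD C D l by (simp add: powr_mult)
        also have "\<dots> \<le> (C + D) powr ?r * (l * (norm (X n) / C) powr ?r + (1 - l) * (norm (Y n) / D) powr ?r)"
          using powr_convex_combination[OF r _ _ l(1,2), of "norm (X n) / C" "norm (Y n) / D"] C D
          by (intro mult_left_mono) auto
        finally show ?thesis using C D by (simp add: powr_divide)
      qed
      have "(\<Sum>n\<in>A. norm (X n + Y n) powr ?r) \<le> (\<Sum>n\<in>A. (C + D) powr ?r *
          (l * (norm (X n) powr ?r / C powr ?r) + (1 - l) * (norm (Y n) powr ?r / D powr ?r)))"
        by (intro sum_mono pointwise)
      also have "\<dots> = (C + D) powr ?r * (l * ((\<Sum>n\<in>A. norm (X n) powr ?r) / C powr ?r)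
          + (1 - l) * ((\<Sum>n\<in>A. norm (Y n) powr ?r) / D powr ?r))"
        by (simp add: sum_distrib_left[symmetric] sum_divide_distrib[symmetric] sum.distrib)
      also have "\<dots> \<le> (C + D) powr ?r * (l * 1 + (1 - l) * 1)"
        using X Y A nz l by (intro mult_left_mono add_mono)
          (auto simp: lp_bound_finite_iff[OF p False C] lp_bound_finite_iff[OF p False D])
      finally show ?thesis by simp
    qed
    then show ?thesis by (simp add: lp_bound_finite_iff[OF p False CD])
  qed
qed

text \<open>
  \<open>\<ell>\<^sub>1 \<subseteq> \<ell>\<^sub>p\<close>: all terms are at most the total \<open>I\<close>, so \<open>|x|\<^sup>r \<le> I\<^bsup>r-1\<^esup> |x|\<close>.
\<close>

lemma abs_summable_imp_lp:
  assumes p: "1 \<le> p" and v: "(\<lambda>n. norm (v n)) summable_on UNIV"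
  shows "v \<in> lp p"
proof -
  define I where "I = (\<Sum>\<^sub>\<infinity>n. norm (v n))"
  have fin: "(\<Sum>n\<in>A. norm (v n)) \<le> I" if "finite A" for A
    unfolding I_def using finite_sum_le_infsum[OF v that] by simp
  have I: "I \<ge> 0" unfolding I_def by (simp add: infsum_nonneg)
  have pt: "norm (v n) \<le> I" for n using fin[of "{n}"] by simp
  have "lp_bound p v I"
  proof (cases "p = \<infinity>")
    case True
    then show ?thesis using pt by (simp add: lp_bound_infinity_iff)
  next
    case False
    let ?r = "enn2real p"
    have r: "?r \<ge> 1" using enn2real_ge_1[OF p False] .
    have split: "x powr ?r = x * x powr (?r - 1)" if "x \<ge> 0" for x :: real
      using that powr_mult_base[of x "?r - 1"] by simp
    have "(\<Sum>n\<in>A. norm (v n) powr ?r) \<le> I powr ?r" if A: "finite A" for A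
    proof -
      have "(\<Sum>n\<in>A. norm (v n) powr ?r) \<le> (\<Sum>n\<in>A. norm (v n) * I powr (?r - 1))"
        using r pt by (intro sum_mono) (auto simp: split intro!: mult_left_mono powr_mono2)
      also have "\<dots> = (\<Sum>n\<in>A. norm (v n)) * I powr (?r - 1)" by (simp add: sum_distrib_right)
      also have "\<dots> \<le> I * I powr (?r - 1)" using fin[OF A] by (intro mult_right_mono) auto
      finally show ?thesis using I by (simp add: split)
    qed
    then show ?thesis by (simp add: lp_bound_finite_iff[OF p False I])
  qed
  then show ?thesis by (simp add: lp_bound_def)
qed

section \<open>Nearest-neighbour sums and a Gronwall inequality on the lattice\<close>

definition nbr_sum :: "(int \<Rightarrow> real) \<Rightarrow> int \<Rightarrow> real" where
  "nbr_sum a n = a (n - 1) + a n + a (n + 1)"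

lemma nbr_sum_mono: "(\<And>n. a n \<le> b n) \<Longrightarrow> nbr_sum a n \<le> nbr_sum b n"
  by (simp add: nbr_sum_def add_mono)

lemma nbr_sum_nonneg: "(\<And>n. 0 \<le> a n) \<Longrightarrow> 0 \<le> nbr_sum a n"
  by (simp add: nbr_sum_def)

lemma nbr_sum_funpow_nonneg: "(\<And>n. 0 \<le> a n) \<Longrightarrow> 0 \<le> (nbr_sum ^^ k) a n"
  by (induction k arbitrary: n) (auto intro: nbr_sum_nonneg)

lemma nbr_sum_sum: "nbr_sum (\<lambda>n. \<Sum>i\<in>A. f i * g i n) n = (\<Sum>i\<in>A. f i * nbr_sum (g i) n)"
  by (simp add: nbr_sum_def sum.distrib distrib_left)

lemma lp_bound_nbr_sum:
  assumes p: "1 \<le> p" and a: "lp_bound p a C"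
  shows "lp_bound p (nbr_sum a) (3 * C)"
proof -
  have "lp_bound p (\<lambda>n. a (n + (-1)) + a n + a (n + 1)) (C + C + C)"
    by (intro lp_bound_add lp_bound_shift p a)
  moreover have "(\<lambda>n. a (n + (-1)) + a n + a (n + 1)) = nbr_sum a"
    by (auto simp: nbr_sum_def)
  ultimately show ?thesis by simp
qed

lemma lp_bound_nbr_sum_funpow:
  assumes p: "1 \<le> p" and a: "lp_bound p a C"
  shows "lp_bound p ((nbr_sum ^^ k) a) (3 ^ k * C)"
proof (induction k)
  case (Suc k)
  from lp_bound_nbr_sum[OF p this] show ?case by (simp add: mult.assoc)
qed (use a in simp)

text \<open>
  Partial sums of the series \<open>exp (s nbr_sum) a\<close>.
\<close>

definition nbr_exp :: "real \<Rightarrow> (int \<Rightarrow> real) \<Rightarrow> nat \<Rightarrow> int \<Rightarrow> real" where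
  "nbr_exp s a k n = (\<Sum>i<k. s ^ i / fact i * (nbr_sum ^^ i) a n)"

lemma lp_bound_nbr_exp:
  assumes p: "1 \<le> p" and a: "lp_bound p a C" and s: "0 \<le> s"
  shows "lp_bound p (nbr_exp s a k) (exp (3 * s) * C)"
proof -
  have C: "0 \<le> C" using lp_bound_nonneg[OF a] .
  have "lp_bound p (nbr_exp s a k) (\<Sum>i<k. (3 * s) ^ i / fact i * C)"
  proof (induction k)
    case 0
    show ?case using lp_bound_zero[OF p, of 0] by (simp add: nbr_exp_def[abs_def])
  next
    case (Suc k)
    have "lp_bound p (\<lambda>n. (s ^ k / fact k) *\<^sub>R (nbr_sum ^^ k) a n) (\<bar>s ^ k / fact k\<bar> * (3 ^ k * C))"
      by (intro lp_bound_scaleR lp_bound_nbr_sum_funpow p a)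
    from lp_bound_add[OF p Suc this] show ?case
      using s by (simp add: nbr_exp_def[abs_def] power_mult_distrib mult_ac)
  qed
  moreover have "(\<Sum>i<k. (3 * s) ^ i / fact i * C) \<le> exp (3 * s) * C"
  proof -
    have "(\<Sum>i<k. (3 * s) ^ i / fact i) \<le> (\<Sum>i. (3 * s) ^ i / fact i)"
      using s summable_exp[of "3 * s"] by (intro sum_le_suminf) (auto simp: field_simps)
    also have "\<dots> = exp (3 * s)" by (simp add: exp_def field_simps)
    finally show ?thesis using C unfolding sum_distrib_right[symmetric] by (rule mult_right_mono)
  qed
  ultimately show ?thesis by (rule lp_bound_weaken)
qed

text \<open>
  Each insertion of the current bound for \<open>u\<close> into the bound for \<open>Z'\<close>, followed by integration in time, adds one term of
  the exponential series. The a priori bound \<open>M\<close> starts the iteration and survives only in the remainder, whose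
  factor \<open>3\<^sup>k\<close> is the effect of \<open>nbr_sum\<close> on constants. The integration is done by the mean value inequality, comparing
  \<open>Z\<close> with an explicit polynomial \<open>\<phi>\<close> in time.
\<close>

lemma lattice_gronwall_iterate:
  fixes Z Z' :: "real \<Rightarrow> int \<Rightarrow> 'a::real_normed_vector" and u :: "real \<Rightarrow> int \<Rightarrow> real"
  assumes deriv: "\<And>t n. t \<in> {0..S} \<Longrightarrow> ((\<lambda>t. Z t n) has_vector_derivative Z' t n) (at t within {0..S})"
    and Z': "\<And>t n. t \<in> {0..S} \<Longrightarrow> norm (Z' t n) \<le> \<kappa> * nbr_sum (u t) n + c n"
    and u: "\<And>t n. t \<in> {0..S} \<Longrightarrow> u t n \<le> a n + norm (Z t n - Z 0 n)"
    and M: "\<And>t n. t \<in> {0..S} \<Longrightarrow> u t n \<le> M"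
    and nn: "0 \<le> \<kappa>" "\<And>n. 0 \<le> a n" "\<And>n. 0 \<le> c n"
    and t: "t \<in> {0..S}"
  shows "u t n \<le> nbr_exp (\<kappa> * t) (\<lambda>n. a n + S * c n) k n + M * (3 * \<kappa> * t) ^ k / fact k"
  using t
proof (induction k arbitrary: t n)
  case 0
  then show ?case using M by (simp add: nbr_exp_def)
next
  case (Suc k)
  define b where "b = (\<lambda>n. a n + S * c n)"
  define \<phi> where "\<phi> s = (\<Sum>i<k. \<kappa> ^ Suc i * s ^ Suc i / fact (Suc i) * nbr_sum ((nbr_sum ^^ i) b) n)
      + M * (3 * \<kappa> * s) ^ Suc k / fact (Suc k) + c n * s" for s
  define \<phi>' where "\<phi>' s = (\<Sum>i<k. \<kappa> ^ Suc i * s ^ i / fact i * nbr_sum ((nbr_sum ^^ i) b) n)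
      + M * (3 * \<kappa>) * (3 * \<kappa> * s) ^ k / fact k + c n" for s
  have S: "0 \<le> S" using Suc.prems by auto
  have fact: "m * fact (Suc i) \<noteq> (0::real)" if "m > 0" for m i using that by simp
  have dphi: "(\<phi> has_vector_derivative \<phi>' s) (at s)" for s
    unfolding \<phi>_def \<phi>'_def has_real_derivative_iff_has_vector_derivative[symmetric]
    by (auto intro!: derivative_eq_intros sum.cong simp del: power_Suc)
       (auto simp: field_simps)
  have "norm (Z t n - Z 0 n) \<le> \<phi> t - \<phi> 0"
  proof (cases "t = 0")
    case False
    then have t: "0 < t" "t \<le> S" using Suc.prems by auto
    show ?thesis
    proof (rule differentiable_bound_general[OF t(1)])
      show "continuous_on {0..t} (\<lambda>t. Z t n)"
      proof (rule continuous_on_subset)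
        show "continuous_on {0..S} (\<lambda>t. Z t n)"
          by (rule continuous_on_vector_derivative) (rule deriv)
      qed (use t in auto)
      show "continuous_on {0..t} \<phi>"
        by (rule continuous_on_vector_derivative, rule has_vector_derivative_at_within, rule dphi)
    next
      fix s assume s: "0 < s" "s < t"
      show "((\<lambda>t. Z t n) has_vector_derivative Z' s n) (at s)"
        using deriv[of s n] s t by (simp add: at_within_Icc_at)
      show "(\<phi> has_vector_derivative \<phi>' s) (at s)" by (rule dphi)
      have "norm (Z' s n) \<le> \<kappa> * nbr_sum (u s) n + c n" using s t by (intro Z') auto
      also have "nbr_sum (u s) n \<le> nbr_sum (\<lambda>n. nbr_exp (\<kappa> * s) b k n + M * (3 * \<kappa> * s) ^ k / fact k) n"
        using s t Suc.IH unfolding b_def by (intro nbr_sum_mono) auto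
      also have "\<dots> = nbr_sum (nbr_exp (\<kappa> * s) b k) n + 3 * (M * (3 * \<kappa> * s) ^ k / fact k)"
        by (simp add: nbr_sum_def)
      also have "nbr_sum (nbr_exp (\<kappa> * s) b k) n = (\<Sum>i<k. (\<kappa> * s) ^ i / fact i * nbr_sum ((nbr_sum ^^ i) b) n)"
        unfolding nbr_exp_def[abs_def] by (rule nbr_sum_sum)
      also have "\<kappa> * (\<dots> + 3 * (M * (3 * \<kappa> * s) ^ k / fact k)) + c n = \<phi>' s"
        unfolding \<phi>'_def by (simp add: sum_distrib_left distrib_left power_mult_distrib mult_ac)
      finally show "norm (Z' s n) \<le> \<phi>' s" using nn(1) by (simp add: mult_left_mono)
    qed
  qed simp
  moreover have "\<phi> 0 = 0" by (simp add: \<phi>_def)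
  ultimately have "u t n \<le> a n + \<phi> t" using u[OF Suc.prems, of n] by simp
  also have "\<phi> t \<le> (\<Sum>i<k. (\<kappa> * t) ^ Suc i / fact (Suc i) * (nbr_sum ^^ Suc i) b n)
      + M * (3 * \<kappa> * t) ^ Suc k / fact (Suc k) + S * c n"
    using nn(3)[of n] Suc.prems mult_left_mono[of t S "c n"]
    by (simp add: \<phi>_def power_mult_distrib mult_ac del: fact_Suc)
  also have "a n + \<dots> = nbr_exp (\<kappa> * t) b (Suc k) n + M * (3 * \<kappa> * t) ^ Suc k / fact (Suc k)"
    unfolding nbr_exp_def by (subst sum.lessThan_Suc_shift) (simp add: b_def del: fact_Suc)
  finally show ?case by (simp add: b_def)
qed

text \<open>
  The remainder of the iteration tends to zero, and the partial sums of the series increase to a limit that is in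
  \<open>\<ell>\<^sub>p\<close> by the Fatou property. The dominating sequence \<open>A\<close> does not depend on time, which is what makes it usable
  for differentiability in \<open>\<ell>\<^sub>p\<close>.
\<close>

theorem lattice_gronwall:
  fixes Z Z' :: "real \<Rightarrow> int \<Rightarrow> 'a::real_normed_vector" and u :: "real \<Rightarrow> int \<Rightarrow> real"
  assumes p: "1 \<le> p"
    and deriv: "\<And>t n. t \<in> {0..S} \<Longrightarrow> ((\<lambda>t. Z t n) has_vector_derivative Z' t n) (at t within {0..S})"
    and Z': "\<And>t n. t \<in> {0..S} \<Longrightarrow> norm (Z' t n) \<le> \<kappa> * nbr_sum (u t) n + c n"
    and u: "\<And>t n. t \<in> {0..S} \<Longrightarrow> u t n \<le> a n + norm (Z t n - Z 0 n)"
    and M: "\<And>t n. t \<in> {0..S} \<Longrightarrow> u t n \<le> M"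
    and nn: "0 \<le> \<kappa>" "\<And>n. 0 \<le> a n" "\<And>n. 0 \<le> c n"
    and S: "0 \<le> S"
    and N: "lp_bound p (\<lambda>n. a n + S * c n) N"
  obtains A where "lp_bound p A (exp (3 * \<kappa> * S) * N)" "\<And>t n. t \<in> {0..S} \<Longrightarrow> u t n \<le> A n"
proof -
  define b where "b = (\<lambda>n. a n + S * c n)"
  define A where "A n = (SUP k. nbr_exp (\<kappa> * S) b k n)" for n
  have b0: "0 \<le> b n" for n using nn S by (simp add: b_def)
  have Ak: "lp_bound p (nbr_exp (\<kappa> * S) b k) (exp (3 * \<kappa> * S) * N)" for k
    using lp_bound_nbr_exp[OF p N, of "\<kappa> * S" k] nn S by (simp add: b_def mult.assoc)
  have inc: "incseq (\<lambda>k. nbr_exp s b k n)" if "0 \<le> s" for s n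
    using that by (intro incseq_SucI) (simp add: nbr_exp_def nbr_sum_funpow_nonneg b0)
  have bdd: "bdd_above (range (\<lambda>k. nbr_exp (\<kappa> * S) b k n))" for n
    using lp_bound_pointwise[OF p Ak, of _ n] by (intro bdd_aboveI2) (auto simp: abs_le_iff)
  have lim: "(\<lambda>k. nbr_exp (\<kappa> * S) b k n) \<longlonglongrightarrow> A n" for n
    unfolding A_def using nn S by (intro LIMSEQ_incseq_SUP bdd inc) auto
  have "lp_bound p A (exp (3 * \<kappa> * S) * N)" by (rule lp_bound_limit[OF p Ak lim])
  moreover have "u t n \<le> A n" if t: "t \<in> {0..S}" for t n
  proof (rule LIMSEQ_le_const)
    have "(\<lambda>k. (3 * \<kappa> * t) ^ k / fact k) \<longlonglongrightarrow> 0"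
      using summable_LIMSEQ_zero[OF summable_exp[of "3 * \<kappa> * t"]] by (simp add: field_simps)
    from tendsto_add[OF lim[of n] tendsto_mult_left[OF this, of M]]
    show "(\<lambda>k. nbr_exp (\<kappa> * S) b k n + M * ((3 * \<kappa> * t) ^ k / fact k)) \<longlonglongrightarrow> A n" by simp
    have "u t n \<le> nbr_exp (\<kappa> * S) b k n + M * ((3 * \<kappa> * t) ^ k / fact k)" for k
    proof -
      have "u t n \<le> nbr_exp (\<kappa> * t) b k n + M * (3 * \<kappa> * t) ^ k / fact k"
        unfolding b_def by (rule lattice_gronwall_iterate[OF deriv Z' u M nn t])
      also have "nbr_exp (\<kappa> * t) b k n \<le> nbr_exp (\<kappa> * S) b k n"
        unfolding nbr_exp_def using nn(1) t
        by (intro sum_mono mult_right_mono divide_right_mono power_mono mult_left_mono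
              nbr_sum_funpow_nonneg b0) auto
      finally show ?thesis by simp
    qed
    then show "\<exists>N. \<forall>k\<ge>N. u t n \<le> nbr_exp (\<kappa> * S) b k n + M * ((3 * \<kappa> * t) ^ k / fact k)" by blast
  qed
  ultimately show ?thesis using that by blast
qed

section \<open>Differential equations with nearest-neighbour coupling\<close>

text \<open>
  The integral operator is a contraction for the norm \<open>sup e\<^bsup>-\<mu>t\<^esup> |u(t)|\<close> once \<open>\<mu> \<ge> 2L\<close>, on the whole of
  \<open>[0, S]\<close>. The weight is absorbed into the unknown \<open>w(t) = e\<^bsup>-\<mu>t\<^esup> u(t)\<close>, and time is clamped to \<open>[0, S]\<close>, so that
  Banach's theorem applies in the type of bounded continuous functions on the line.
\<close>

theorem picard_lindeloef_global:
  fixes f :: "'a::banach \<Rightarrow> 'a"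
  assumes lip: "\<And>x y. norm (f x - f y) \<le> L * norm (x - y)" and S: "0 \<le> S"
  obtains u where "u 0 = x0" "\<And>t. t \<in> {0..S} \<Longrightarrow> (u has_vector_derivative f (u t)) (at t within {0..S})"
proof -
  define \<mu> where "\<mu> = 2 * \<bar>L\<bar> + 1"
  have \<mu>: "0 < \<mu>" "L \<le> \<mu> / 2" by (auto simp: \<mu>_def)
  \<comment> \<open>clamping extends the integral operator from \<open>[0, S]\<close> to the whole line\<close>
  define cl where "cl t = max 0 (min S t)" for t
  have cl: "cl t \<in> {0..S}" for t using S by (auto simp: cl_def)
  have cl_id: "t \<in> {0..S} \<Longrightarrow> cl t = t" for t by (auto simp: cl_def)
  have fcont: "continuous_on UNIV f"
  proof (rule lipschitz_on_continuous_on[OF lipschitz_onI])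
    show "dist (f x) (f y) \<le> \<bar>L\<bar> * dist x y" for x y
      using lip[of x y] mult_right_mono[OF abs_ge_self[of L] norm_ge_zero[of "x - y"]]
      by (simp add: dist_norm)
  qed simp
  define g where "g w s = f (exp (\<mu> * s) *\<^sub>R apply_bcontfun w s)" for w :: "real \<Rightarrow>\<^sub>C 'a" and s
  have gcont: "continuous_on A (g w)" for A w
    unfolding g_def by (intro continuous_on_compose2[OF fcont] continuous_intros) auto
  then have gint: "g w integrable_on {a..b}" for w a b by (intro integrable_continuous_real)
  define \<Phi> where "\<Phi> w t = exp (- \<mu> * cl t) *\<^sub>R (x0 + integral {0..cl t} (g w))" for w t
  have \<Phi>: "\<Phi> w \<in> bcontfun" for w
  proof -
    define \<psi> where "\<psi> \<tau> = exp (- \<mu> * \<tau>) *\<^sub>R (x0 + integral {0..\<tau>} (g w))" for \<tau>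
    have c: "continuous_on {0..S} \<psi>"
      unfolding \<psi>_def by (intro continuous_intros indefinite_integral_continuous_1 gint)
    have "continuous_on UNIV (\<Phi> w)"
      unfolding \<Phi>_def \<psi>_def[symmetric]
      by (rule continuous_on_compose2[OF c]) (use cl in \<open>auto simp: cl_def intro!: continuous_intros\<close>)
    moreover have "bounded (range (\<Phi> w))"
      by (rule bounded_subset[OF compact_imp_bounded[OF compact_continuous_image[OF c]]])
        (use cl in \<open>auto simp: \<Phi>_def \<psi>_def\<close>)
    ultimately show ?thesis by (simp add: bcontfun_def)
  qed
  have contr: "dist (Bcontfun (\<Phi> w)) (Bcontfun (\<Phi> w')) \<le> 1 / 2 * dist w w'" for w w'
  proof (rule dist_bound)
    fix t
    define \<tau> where "\<tau> = cl t"
    have \<tau>: "0 \<le> \<tau>" using cl[of t] by (simp add: \<tau>_def)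
    let ?d = "dist w w'"
    have ftc: "((\<lambda>s. \<mu> / 2 * ?d * exp (\<mu> * s)) has_integral
        (1 / 2 * ?d * exp (\<mu> * \<tau>) - 1 / 2 * ?d * exp (\<mu> * 0))) {0..\<tau>}"
      using \<tau> by (intro fundamental_theorem_of_calculus)
        (auto simp: has_real_derivative_iff_has_vector_derivative[symmetric] intro!: derivative_eq_intros)
    have "norm (integral {0..\<tau>} (\<lambda>s. g w s - g w' s)) \<le> integral {0..\<tau>} (\<lambda>s. \<mu> / 2 * ?d * exp (\<mu> * s))"
    proof (rule integral_norm_bound_integral)
      show "(\<lambda>s. g w s - g w' s) integrable_on {0..\<tau>}" by (intro integrable_diff gint)
      show "(\<lambda>s. \<mu> / 2 * ?d * exp (\<mu> * s)) integrable_on {0..\<tau>}" using ftc by blast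
      fix s
      have "norm (g w s - g w' s) \<le> L * norm (exp (\<mu> * s) *\<^sub>R (w s - w' s))"
        unfolding g_def scaleR_diff_right by (rule lip)
      also have "\<dots> = L * (exp (\<mu> * s) * dist (w s) (w' s))" by (simp add: dist_norm)
      also have "\<dots> \<le> \<mu> / 2 * (exp (\<mu> * s) * ?d)"
        using \<mu> by (intro mult_mono dist_bounded) auto
      finally show "norm (g w s - g w' s) \<le> \<mu> / 2 * ?d * exp (\<mu> * s)" by (simp add: mult_ac)
    qed
    also have "\<dots> \<le> 1 / 2 * ?d * exp (\<mu> * \<tau>)" unfolding integral_unique[OF ftc] by simp
    finally have "norm (integral {0..\<tau>} (g w) - integral {0..\<tau>} (g w')) \<le> 1 / 2 * ?d * exp (\<mu> * \<tau>)"
      by (simp add: integral_diff gint)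
    then have "exp (- \<mu> * \<tau>) * norm (integral {0..\<tau>} (g w) - integral {0..\<tau>} (g w'))
        \<le> exp (- \<mu> * \<tau>) * (1 / 2 * ?d * exp (\<mu> * \<tau>))" by (intro mult_left_mono) auto
    also have "\<dots> = 1 / 2 * ?d" by (simp add: exp_minus field_simps)
    finally show "dist (apply_bcontfun (Bcontfun (\<Phi> w)) t) (apply_bcontfun (Bcontfun (\<Phi> w')) t) \<le> 1 / 2 * ?d"
      by (simp add: Bcontfun_inverse[OF \<Phi>] \<Phi>_def dist_norm scaleR_diff_right[symmetric] \<tau>_def)
  qed
  have "\<exists>!w. Bcontfun (\<Phi> w) = w" by (rule banach_fix_type[of "1/2"]) (use contr in auto)
  then obtain w where w: "Bcontfun (\<Phi> w) = w" by blast
  have fix_pt: "apply_bcontfun w = \<Phi> w" using Bcontfun_inverse[OF \<Phi>[of w]] w by simp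
  define u where "u t = exp (\<mu> * t) *\<^sub>R apply_bcontfun w t" for t
  have gu: "g w = (\<lambda>s. f (u s))" by (simp add: g_def u_def fun_eq_iff)
  have u: "u t = x0 + integral {0..t} (g w)" if "t \<in> {0..S}" for t
    unfolding u_def fix_pt \<Phi>_def cl_id[OF that] by (simp add: exp_minus)
  show ?thesis
  proof
    show "u 0 = x0" using u[of 0] S by simp
    fix t assume t: "t \<in> {0..S}"
    have "((\<lambda>t. x0 + integral {0..t} (g w)) has_vector_derivative f (u t)) (at t within {0..S})"
      using integral_has_vector_derivative[OF gcont t, of w]
      by (auto simp: gu intro!: derivative_eq_intros)
    then show "(u has_vector_derivative f (u t)) (at t within {0..S})"
      by (rule has_vector_derivative_transform[OF t, rotated]) (use u in auto)
  qed
qed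

text \<open>
  Lipschitz continuity site by site, where only the site itself and its two neighbours have influence. Unlike a Lipschitz bound in
  one norm, it yields bounds in all \<open>\<ell>\<^sub>p\<close> simultaneously.
\<close>

definition nbr_lipschitz :: "real \<Rightarrow> ((int \<Rightarrow> 'a::real_normed_vector) \<Rightarrow> int \<Rightarrow> 'a) \<Rightarrow> bool" where
  "nbr_lipschitz L f \<longleftrightarrow> 0 \<le> L \<and> f (\<lambda>_. 0) = (\<lambda>_. 0) \<and>
     (\<forall>u w n. norm (f u n - f w n) \<le> L * nbr_sum (\<lambda>j. norm (u j - w j)) n)"

lemma nbr_lipschitz_norm:
  assumes "nbr_lipschitz L f"
  shows "norm (f u n) \<le> L * nbr_sum (\<lambda>j. norm (u j)) n"
proof -
  have "norm (f u n - f (\<lambda>_. 0) n) \<le> L * nbr_sum (\<lambda>j. norm (u j - 0)) n" "f (\<lambda>_. 0) n = 0"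
    using assms unfolding nbr_lipschitz_def by (blast, simp)
  then show ?thesis by simp
qed

lemma lp_bound_nbr_lipschitz:
  assumes p: "1 \<le> p" and f: "nbr_lipschitz L f" and X: "lp_bound p X C"
  shows "lp_bound p (f X) (L * (3 * C))"
proof -
  have L: "0 \<le> L" using f by (simp add: nbr_lipschitz_def)
  have "lp_bound p (\<lambda>j. norm (X j)) C" by (rule lp_bound_mono[OF p X]) simp
  then have "lp_bound p (\<lambda>n. L *\<^sub>R nbr_sum (\<lambda>j. norm (X j)) n) (\<bar>L\<bar> * (3 * C))"
    by (rule lp_bound_scaleR[OF p lp_bound_nbr_sum[OF p]])
  then have "lp_bound p (f X) (\<bar>L\<bar> * (3 * C))"
  proof (rule lp_bound_mono[OF p])
    show "norm (f X n) \<le> norm (L *\<^sub>R nbr_sum (\<lambda>j. norm (X j)) n)" for n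
      using nbr_lipschitz_norm[OF f, of X n] by simp
  qed
  then show ?thesis using L by simp
qed

lemma vector_derivative_bound:
  fixes f :: "real \<Rightarrow> 'a::real_normed_vector"
  assumes der: "\<And>x. x \<in> I \<Longrightarrow> (f has_vector_derivative f' x) (at x within I)" and I: "convex I"
    and bd: "\<And>x. x \<in> I \<Longrightarrow> norm (f' x) \<le> B" and xy: "x \<in> I" "y \<in> I"
  shows "norm (f x - f y) \<le> B * \<bar>x - y\<bar>"
  unfolding real_norm_def[symmetric]
proof (rule differentiable_bound[OF I _ _ xy])
  show "(f has_derivative (\<lambda>h. h *\<^sub>R f' z)) (at z within I)" if "z \<in> I" for z
    using der[OF that] by (simp add: has_vector_derivative_def)
  show "onorm (\<lambda>h. h *\<^sub>R f' z) \<le> B" if "z \<in> I" for z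
    using mult_right_mono[OF bd[OF that] abs_ge_zero] by (intro onorm_le) (simp add: mult.commute)
qed

lemma has_vector_derivative_quotient_iff:
  fixes f :: "real \<Rightarrow> 'a::real_normed_vector"
  shows "(f has_vector_derivative D) (at t within I) \<longleftrightarrow>
    ((\<lambda>s. (f s - f t) /\<^sub>R (s - t) - D) \<longlongrightarrow> 0) (at t within I)"
proof -
  have "norm (f s - f t - (s - t) *\<^sub>R D) / norm (s - t) = norm ((f s - f t) /\<^sub>R (s - t) - D)"
    if "s \<noteq> t" for s
  proof -
    have "(f s - f t) /\<^sub>R (s - t) - D = (f s - f t - (s - t) *\<^sub>R D) /\<^sub>R (s - t)"
      using that by (simp add: scaleR_diff_right)
    then show ?thesis by (simp add: divide_inverse_commute)
  qed
  then have "((\<lambda>s. norm (f s - f t - (s - t) *\<^sub>R D) / norm (s - t)) \<longlongrightarrow> 0) (at t within I)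
      \<longleftrightarrow> ((\<lambda>s. norm ((f s - f t) /\<^sub>R (s - t) - D)) \<longlongrightarrow> 0) (at t within I)"
    by (intro tendsto_cong) (auto simp: eventually_at_filter)
  then show ?thesis
    by (simp add: has_vector_derivative_def has_derivative_iff_norm bounded_linear_scaleR_left
        tendsto_norm_zero_iff)
qed

lemma lp_difference_quotient:
  assumes "1 \<le> p" "X s \<in> lp p" "X t \<in> lp p" "D \<in> lp p"
  shows "(\<lambda>n. (X s n - X t n) /\<^sub>R (s - t) - D n) \<in> lp p"
proof -
  have "lp_bound p (\<lambda>n. inverse (s - t) *\<^sub>R (X s n + (-1) *\<^sub>R X t n) + (-1) *\<^sub>R D n)
      (\<bar>inverse (s - t)\<bar> * (lp_norm p (X s) + \<bar>-1\<bar> * lp_norm p (X t)) + \<bar>-1\<bar> * lp_norm p D)"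
    by (intro lp_bound_add lp_bound_scaleR lp_bound_norm assms)
  then show ?thesis by (simp add: lp_bound_def)
qed

lemma has_lp_derivative_component:
  assumes p: "1 \<le> p" and X: "has_lp_derivative p X D t I" and t: "t \<in> I"
  shows "((\<lambda>t. X t n) has_vector_derivative D n) (at t within I)"
  unfolding has_vector_derivative_quotient_iff
proof (rule Lim_null_comparison)
  let ?q = "\<lambda>s n. (X s n - X t n) /\<^sub>R (s - t) - D n"
  show "((\<lambda>s. lp_norm p (?q s)) \<longlongrightarrow> 0) (at t within I)" using X by (simp add: has_lp_derivative_def)
  have "norm (?q s n) \<le> lp_norm p (?q s)" if "s \<in> I" for s
    using X t that by (intro lp_bound_pointwise[OF p] lp_bound_norm lp_difference_quotient[OF p])
      (auto simp: has_lp_derivative_def)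
  then show "\<forall>\<^sub>F s in at t within I. norm (?q s n) \<le> lp_norm p (?q s)"
    by (auto simp: eventually_at_filter)
qed

lemma lp_solution_component:
  assumes "1 \<le> p" "lp_solution p f X0 S X" "t \<in> {0..S}"
  shows "((\<lambda>t. X t n) has_vector_derivative f (X t) n) (at t within {0..S})"
  using assms by (intro has_lp_derivative_component[of p]) (auto simp: lp_solution_def)

text \<open>
  Differentiability at a point bounds the solution near that point; compactness of \<open>[0, S]\<close> does the rest.
\<close>

lemma lp_solution_bounded:
  assumes p: "1 \<le> p" and X: "lp_solution p f X0 S X"
  obtains M where "\<And>t n. t \<in> {0..S} \<Longrightarrow> norm (X t n) \<le> M"
proof -
  have loc: "\<exists>d>0. \<exists>M. \<forall>s\<in>{0..S} \<inter> ball t d. \<forall>n. norm (X s n) \<le> M" if t: "t \<in> {0..S}" for t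
  proof -
    let ?D = "f (X t)" and ?q = "\<lambda>s n. (X s n - X t n) /\<^sub>R (s - t) - f (X t) n"
    have der: "has_lp_derivative p X ?D t {0..S}" using X t by (simp add: lp_solution_def)
    then have mem: "X s \<in> lp p" "?D \<in> lp p" if "s \<in> {0..S}" for s
      using that by (auto simp: has_lp_derivative_def)
    have "((\<lambda>s. lp_norm p (?q s)) \<longlongrightarrow> 0) (at t within {0..S})" using der by (simp add: has_lp_derivative_def)
    then have "\<forall>\<^sub>F s in at t within {0..S}. lp_norm p (?q s) < 1" by (rule order_tendstoD) simp
    then obtain d where d: "d > 0" "\<And>s. s \<in> {0..S} \<Longrightarrow> s \<noteq> t \<Longrightarrow> dist s t < d \<Longrightarrow> lp_norm p (?q s) < 1"
      by (auto simp: eventually_at)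
    have "norm (X s n) \<le> lp_norm p (X t) + d * (1 + lp_norm p ?D)" if s: "s \<in> {0..S}" "dist s t < d" for s n
    proof -
      have Xt: "norm (X t n) \<le> lp_norm p (X t)"
        using mem(1)[OF t] by (intro lp_bound_pointwise[OF p] lp_bound_norm)
      have D: "norm (?D n) \<le> lp_norm p ?D" using mem(2)[OF t] by (intro lp_bound_pointwise[OF p] lp_bound_norm)
      have D0: "0 \<le> lp_norm p ?D" using mem(2)[OF t] by (rule lp_norm_nonneg)
      show ?thesis
      proof (cases "s = t")
        case True
        then show ?thesis using Xt D0 d(1) by (simp add: add_increasing2)
      next
        case False
        have "norm (?q s n) \<le> lp_norm p (?q s)"
          using mem[OF s(1)] mem[OF t] by (intro lp_bound_pointwise[OF p] lp_bound_norm lp_difference_quotient[OF p])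
        then have q: "norm (?q s n) \<le> 1" using d(2)[OF s(1) False s(2)] by simp
        have "X s n = X t n + (s - t) *\<^sub>R (?q s n + ?D n)" using False by simp
        then have "norm (X s n) \<le> norm (X t n) + \<bar>s - t\<bar> * norm (?q s n + ?D n)"
          by (metis norm_scaleR norm_triangle_ineq)
        also have "\<dots> \<le> lp_norm p (X t) + d * (1 + lp_norm p ?D)"
          using Xt q D D0 s(2) d(1) by (intro add_mono mult_mono norm_triangle_le) (auto simp: dist_real_def)
        finally show ?thesis .
      qed
    qed
    then show ?thesis
      using d(1) by (intro exI[of _ d] conjI exI[of _ "lp_norm p (X t) + d * (1 + lp_norm p ?D)"])
        (auto simp: dist_commute)
  qed
  then obtain d M where dM: "\<And>t. t \<in> {0..S} \<Longrightarrow> d t > 0"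
      "\<And>t s n. t \<in> {0..S} \<Longrightarrow> s \<in> {0..S} \<inter> ball t (d t) \<Longrightarrow> norm (X s n) \<le> M t"
    by metis
  obtain F where F: "F \<subseteq> {0..S}" "finite F" "{0..S} \<subseteq> (\<Union>t\<in>F. ball t (d t))"
    by (rule compactE_image[of "{0..S}" "{0..S}" "\<lambda>t. ball t (d t)"]) (use dM(1) in auto)
  show ?thesis
  proof
    fix t n assume t: "t \<in> {0..S}"
    then obtain s where s: "s \<in> F" "t \<in> ball s (d s)" using F by blast
    then have "norm (X t n) \<le> M s" using dM(2) t F by blast
    also have "M s \<le> (\<Sum>s\<in>F. \<bar>M s\<bar>)" using s F by (meson abs_ge_self abs_ge_zero member_le_sum order_trans)
    finally show "norm (X t n) \<le> (\<Sum>s\<in>F. \<bar>M s\<bar>)" .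
  qed
qed

text \<open>
  The difference of two solutions satisfies the lattice Gronwall inequality with zero data.
\<close>

theorem lp_solution_unique:
  assumes p: "1 \<le> p" and f: "nbr_lipschitz L f"
    and X: "lp_solution p f X0 S X" and Y: "lp_solution p f X0 S Y" and t: "t \<in> {0..S}"
  shows "X t = Y t"
proof -
  obtain M where M: "\<And>t n. t \<in> {0..S} \<Longrightarrow> norm (X t n) \<le> M" using lp_solution_bounded[OF p X] by blast
  obtain M' where M': "\<And>t n. t \<in> {0..S} \<Longrightarrow> norm (Y t n) \<le> M'" using lp_solution_bounded[OF p Y] by blast
  have L: "0 \<le> L" using f by (simp add: nbr_lipschitz_def)
  obtain A where A: "lp_bound p A (exp (3 * L * S) * 0)" "\<And>t n. t \<in> {0..S} \<Longrightarrow> norm (X t n - Y t n) \<le> A n"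
  proof (rule lattice_gronwall[of p S "\<lambda>t n. X t n - Y t n" "\<lambda>t n. f (X t) n - f (Y t) n" L
        "\<lambda>t n. norm (X t n - Y t n)" "\<lambda>_. 0" "\<lambda>_. 0" "M + M'" 0])
    show "((\<lambda>t. X t n - Y t n) has_vector_derivative f (X t) n - f (Y t) n) (at t within {0..S})"
      if "t \<in> {0..S}" for t n
      by (intro has_vector_derivative_diff lp_solution_component[OF p X that] lp_solution_component[OF p Y that])
    show "norm (f (X t) n - f (Y t) n) \<le> L * nbr_sum (\<lambda>n. norm (X t n - Y t n)) n + 0" for t n
      using f by (simp add: nbr_lipschitz_def)
    show "norm (X t n - Y t n) \<le> M + M'" if "t \<in> {0..S}" for t n
      using M[OF that, of n] M'[OF that, of n] norm_triangle_ineq4[of "X t n" "Y t n"] by linarith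
    show "norm (X t n - Y t n) \<le> 0 + norm (X t n - Y t n - (X 0 n - Y 0 n))" for t n
      using X Y by (simp add: lp_solution_def)
  qed (use p L t lp_bound_zero[OF p, of 0] in auto)
  have "norm (X t n - Y t n) \<le> 0" for n
    using lp_bound_pointwise[OF p A(1), of n] A(2)[OF t, of n] by simp
  then show ?thesis by (simp add: fun_eq_iff)
qed

text \<open>
  The integers carry their discrete metric, so that the bounded sequences become a Banach space of bounded continuous
  functions.
\<close>

instantiation int :: metric_space
begin

definition dist_int :: "int \<Rightarrow> int \<Rightarrow> real" where
  "dist_int m n = of_int \<bar>m - n\<bar>"

definition uniformity_int :: "(int \<times> int) filter" where
  "uniformity_int = (INF e\<in>{0<..}. principal {(x, y). dist x y < e})"

instance
proof
  show "uniformity = (INF e\<in>{0<..}. principal {(x, y :: int). dist x y < e})"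
    by (rule uniformity_int_def)
  show "open U \<longleftrightarrow> (\<forall>x\<in>U. \<forall>\<^sub>F (x', y) in uniformity. x' = x \<longrightarrow> y \<in> U)" for U :: "int set"
  proof -
    have "\<forall>\<^sub>F (x', y) in uniformity. x' = x \<longrightarrow> y \<in> U" if x: "x \<in> U" for x
      unfolding uniformity_int_def
    proof (rule eventually_INF1[of 1])
      have "x = y" if "dist x y < 1" for y using that unfolding dist_int_def by linarith
      then show "\<forall>\<^sub>F (x', y) in principal {(x, y). dist x y < 1}. x' = x \<longrightarrow> y \<in> U"
        using x by (auto simp: eventually_principal)
    qed simp
    then show ?thesis by (auto simp: open_discrete)
  qed
  show "dist x y = 0 \<longleftrightarrow> x = y" for x y :: int by (simp add: dist_int_def)
  show "dist x y \<le> dist x z + dist y z" for x y z :: int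
    unfolding dist_int_def of_int_add[symmetric] of_int_le_iff by linarith
qed

end

instance bcontfun :: (metric_space, banach) banach ..

text \<open>
  The equation is solved in \<open>\<ell>\<^sub>\<infinity>\<close>. The lattice Gronwall inequality then dominates \<open>|X(t)|\<close> for all times
  by one sequence \<open>A \<in> \<ell>\<^sub>p\<close>. The increments of the field along the solution are consequently dominated by a multiple of
  \<open>|s - t| nbr_sum (nbr_sum A)\<close>, which upgrades differentiability at each site to differentiability in the norm of \<open>\<ell>\<^sub>p\<close>.
\<close>

theorem lp_solution_exists:
  fixes f :: "(int \<Rightarrow> 'a::banach) \<Rightarrow> int \<Rightarrow> 'a"
  assumes p: "1 \<le> p" and f: "nbr_lipschitz L f" and X0: "X0 \<in> lp p" and S: "0 \<le> S"
  obtains X where "lp_solution p f X0 S X"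
proof -
  have L: "0 \<le> L" using f by (simp add: nbr_lipschitz_def)
  have flip: "norm (f u n - f w n) \<le> L * nbr_sum (\<lambda>j. norm (u j - w j)) n" for u w n
    using f by (simp add: nbr_lipschitz_def)
  have X0b: "X0 \<in> bcontfun"
    using lp_bound_pointwise[OF p lp_bound_norm[OF X0]] by (intro bcontfun_normI) auto
  have nbr3: "nbr_sum (\<lambda>j. norm (apply_bcontfun u j - apply_bcontfun w j)) n \<le> 3 * norm (u - w)"
    for u w :: "int \<Rightarrow>\<^sub>C 'a" and n
    using norm_bounded[of "u - w"] by (simp add: nbr_sum_def) (smt (verit, best))
  define f' where "f' u = Bcontfun (f (apply_bcontfun u))" for u :: "int \<Rightarrow>\<^sub>C 'a"
  have f': "apply_bcontfun (f' u) = f (apply_bcontfun u)" for u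
  proof -
    have "norm (f (apply_bcontfun u) n) \<le> L * (3 * norm u)" for n
      using nbr_lipschitz_norm[OF f, of "apply_bcontfun u" n] nbr3[of u 0 n] L
      by (simp, meson mult_left_mono order_trans)
    then have "f (apply_bcontfun u) \<in> bcontfun" by (intro bcontfun_normI) auto
    then show ?thesis by (simp add: f'_def Bcontfun_inverse)
  qed
  have "norm (f' u - f' w) \<le> (3 * L) * norm (u - w)" for u w
  proof (rule norm_bound)
    fix n
    have "norm (f (apply_bcontfun u) n - f (apply_bcontfun w) n) \<le> L * (3 * norm (u - w))"
      using flip[of "apply_bcontfun u" n "apply_bcontfun w"] nbr3[of u w n] L by (meson mult_left_mono order_trans)
    then show "norm (apply_bcontfun (f' u - f' w) n) \<le> 3 * L * norm (u - w)" by (simp add: f' mult_ac)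
  qed
  then obtain U where U0: "U 0 = Bcontfun X0"
    and U: "\<And>t. t \<in> {0..S} \<Longrightarrow> (U has_vector_derivative f' (U t)) (at t within {0..S})"
    using picard_lindeloef_global[of f' "3 * L" S] S by blast
  define X where "X t = apply_bcontfun (U t)" for t
  have X_0: "X 0 = X0" by (simp add: X_def U0 Bcontfun_inverse[OF X0b])
  have bl: "bounded_linear (\<lambda>u. apply_bcontfun u n)" for n :: int
    by (rule bounded_linear_intro[where K=1]) (auto simp: norm_bounded)
  have der: "((\<lambda>t. X t n) has_vector_derivative f (X t) n) (at t within {0..S})" if "t \<in> {0..S}" for t n
    using bounded_linear.has_vector_derivative[OF bl U[OF that], of n] by (simp add: X_def f')
  have "continuous_on {0..S} U" by (rule continuous_on_vector_derivative) (rule U)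
  then have "bounded (U ` {0..S})" by (intro compact_imp_bounded compact_continuous_image) auto
  then obtain M where "\<forall>x\<in>U ` {0..S}. norm x \<le> M" unfolding bounded_iff by blast
  then have M: "\<And>t. t \<in> {0..S} \<Longrightarrow> norm (U t) \<le> M" by blast
  have "lp_bound p (\<lambda>n. norm (X0 n)) (lp_norm p X0)"
    by (rule lp_bound_mono[OF p lp_bound_norm[OF X0]]) simp
  then have Na: "lp_bound p (\<lambda>n. norm (X0 n) + S * 0) (lp_norm p X0)" by simp
  obtain A where A: "lp_bound p A (exp (3 * L * S) * lp_norm p X0)"
    and XA: "\<And>t n. t \<in> {0..S} \<Longrightarrow> norm (X t n) \<le> A n"
  proof (rule lattice_gronwall[OF p der _ _ _ L _ _ S Na, where u="\<lambda>t n. norm (X t n)" and M=M])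
    show "norm (f (X t) n) \<le> L * nbr_sum (\<lambda>n. norm (X t n)) n + 0" for t n
      using nbr_lipschitz_norm[OF f] by simp
    show "norm (X t n) \<le> norm (X0 n) + norm (X t n - X 0 n)" for t n
      using norm_triangle_ineq[of "X0 n" "X t n - X0 n"] by (simp add: X_0)
    show "norm (X t n) \<le> M" if "t \<in> {0..S}" for t n
      using M[OF that] norm_bounded[of "U t" n] by (simp add: X_def)
  qed auto
  have A0: "0 \<le> A n" for n using XA[of 0 n] S by (auto intro: order_trans[OF norm_ge_zero])
  have Xlp: "X t \<in> lp p" if "t \<in> {0..S}" for t
    using lp_bound_mono[OF p A, of "X t"] XA[OF that] A0 by (simp add: lp_bound_def)
  define C where "C = (L * L) * (3 * (3 * (exp (3 * L * S) * lp_norm p X0)))"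
  have quot: "lp_bound p (\<lambda>n. (X s n - X t n) /\<^sub>R (s - t) - f (X t) n) (\<bar>s - t\<bar> * C)"
    if s: "s \<in> {0..S}" and t: "t \<in> {0..S}" and ne: "s \<noteq> t" for s t
  proof -
    define I where "I = {min s t..max s t}"
    have I: "I \<subseteq> {0..S}" "s \<in> I" "t \<in> I" "convex I" using s t by (auto simp: I_def)
    have I_dist: "\<bar>r - t\<bar> \<le> \<bar>s - t\<bar>" if "r \<in> I" for r using that by (auto simp: I_def)
    have step: "norm (X r n - X t n) \<le> L * nbr_sum A n * \<bar>s - t\<bar>" if r: "r \<in> I" for r n
    proof -
      have "norm (f (X q) n) \<le> L * nbr_sum A n" if "q \<in> I" for q
        using nbr_lipschitz_norm[OF f, of "X q" n] nbr_sum_mono[of "\<lambda>j. norm (X q j)" A n] XA[of q] that I L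
        by (meson mult_left_mono order_trans subsetD)
      then have "norm (X r n - X t n) \<le> L * nbr_sum A n * \<bar>r - t\<bar>"
        using r I by (intro vector_derivative_bound[where I=I and f'="\<lambda>q. f (X q) n"])
          (auto intro: has_vector_derivative_within_subset[OF der])
      also have "\<dots> \<le> L * nbr_sum A n * \<bar>s - t\<bar>"
        using I_dist[OF r] L A0 by (intro mult_left_mono) (auto simp: nbr_sum_nonneg)
      finally show ?thesis .
    qed
    have "norm ((X s n - X t n) /\<^sub>R (s - t) - f (X t) n) \<le> \<bar>s - t\<bar> * (L * L * nbr_sum (nbr_sum A) n)" for n
    proof -
      let ?B = "\<bar>s - t\<bar> * (L * L * nbr_sum (nbr_sum A) n)"
      have "norm (f (X r) n - f (X t) n) \<le> ?B" if r: "r \<in> I" for r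
      proof -
        have "norm (f (X r) n - f (X t) n) \<le> L * nbr_sum (\<lambda>j. norm (X r j - X t j)) n" by (rule flip)
        also have "\<dots> \<le> L * nbr_sum (\<lambda>j. L * nbr_sum A j * \<bar>s - t\<bar>) n"
          using L step[OF r] by (intro mult_left_mono nbr_sum_mono)
        also have "\<dots> = ?B" by (simp add: nbr_sum_def algebra_simps)
        finally show ?thesis .
      qed
      \<comment> \<open>mean value inequality for \<open>r \<mapsto> X(r) - r f(X(t))\<close>, whose derivative is small near \<open>t\<close>\<close>
      then have "norm ((X s n - s *\<^sub>R f (X t) n) - (X t n - t *\<^sub>R f (X t) n)) \<le> ?B * \<bar>s - t\<bar>"
        using I by (intro vector_derivative_bound[where I=I and f'="\<lambda>r. f (X r) n - f (X t) n"])
          (auto intro!: derivative_eq_intros has_vector_derivative_within_subset[OF der])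
      moreover have "(X s n - s *\<^sub>R f (X t) n) - (X t n - t *\<^sub>R f (X t) n)
          = (s - t) *\<^sub>R ((X s n - X t n) /\<^sub>R (s - t) - f (X t) n)"
        using ne unfolding scaleR_diff_right[of _ "(X s n - X t n) /\<^sub>R (s - t)"]
        by (simp add: scaleR_diff_left)
      ultimately show ?thesis using ne by (simp add: mult.commute)
    qed
    moreover have "lp_bound p (\<lambda>n. \<bar>s - t\<bar> *\<^sub>R (L * L) *\<^sub>R nbr_sum (nbr_sum A) n)
        (\<bar>\<bar>s - t\<bar>\<bar> * (\<bar>L * L\<bar> * (3 * (3 * (exp (3 * L * S) * lp_norm p X0)))))"
      by (rule lp_bound_scaleR[OF p lp_bound_scaleR[OF p lp_bound_nbr_sum[OF p lp_bound_nbr_sum[OF p A]]]])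
    ultimately have "lp_bound p (\<lambda>n. (X s n - X t n) /\<^sub>R (s - t) - f (X t) n)
        (\<bar>\<bar>s - t\<bar>\<bar> * (\<bar>L * L\<bar> * (3 * (3 * (exp (3 * L * S) * lp_norm p X0)))))"
      by (elim lp_bound_mono[OF p]) (simp add: nbr_sum_nonneg A0 L)
    then show ?thesis by (simp add: C_def)
  qed
  have "has_lp_derivative p X (f (X t)) t {0..S}" if t: "t \<in> {0..S}" for t
    unfolding has_lp_derivative_def
  proof (intro conjI ballI)
    show "X s \<in> lp p" if "s \<in> {0..S}" for s using Xlp that .
    show "f (X t) \<in> lp p"
      using lp_bound_nbr_lipschitz[OF p f lp_bound_norm[OF Xlp[OF t]]] by (simp add: lp_bound_def)
    show "((\<lambda>s. lp_norm p (\<lambda>n. (X s n - X t n) /\<^sub>R (s - t) - f (X t) n)) \<longlongrightarrow> 0) (at t within {0..S})"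
    proof (rule Lim_null_comparison)
      show "((\<lambda>s. \<bar>s - t\<bar> * C) \<longlongrightarrow> 0) (at t within {0..S})" by (auto intro!: tendsto_eq_intros)
      have "norm (lp_norm p (\<lambda>n. (X s n - X t n) /\<^sub>R (s - t) - f (X t) n)) \<le> \<bar>s - t\<bar> * C"
        if "s \<in> {0..S}" "s \<noteq> t" for s
        using quot[OF that(1) t that(2)] lp_norm_nonneg by (force simp: lp_bound_def)
      then show "\<forall>\<^sub>F s in at t within {0..S}. norm (lp_norm p (\<lambda>n. (X s n - X t n) /\<^sub>R (s - t) - f (X t) n))
          \<le> \<bar>s - t\<bar> * C" by (auto simp: eventually_at_filter)
    qed
  qed
  then have "lp_solution p f X0 S X" using X_0 by (simp add: lp_solution_def)
  then show ?thesis by (rule that)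
qed

lemma lp_solution_cong:
  assumes "lp_solution p f X0 S X" "\<And>t. t \<in> {0..S} \<Longrightarrow> f (X t) = g (X t)"
  shows "lp_solution p g X0 S X"
  using assms by (simp add: lp_solution_def)

lemma lp_solution_restrict:
  assumes X: "lp_solution p f X0 S X" and S: "S' \<le> S"
  shows "lp_solution p f X0 S' X"
proof -
  have sub: "{0..S'} \<subseteq> {0..S}" using S by auto
  show ?thesis
    unfolding lp_solution_def has_lp_derivative_def
  proof (intro conjI ballI)
    show "X 0 = X0" using X by (simp add: lp_solution_def)
    fix t assume "t \<in> {0..S'}"
    then have d: "has_lp_derivative p X (f (X t)) t {0..S}" using X sub by (auto simp: lp_solution_def)
    show "X s \<in> lp p" if "s \<in> {0..S'}" for s using d that sub by (auto simp: has_lp_derivative_def)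
    show "f (X t) \<in> lp p" using d by (simp add: has_lp_derivative_def)
    show "((\<lambda>s. lp_norm p (\<lambda>n. (X s n - X t n) /\<^sub>R (s - t) - f (X t) n)) \<longlongrightarrow> 0) (at t within {0..S'})"
      using d tendsto_within_subset[OF _ sub] by (auto simp: has_lp_derivative_def)
  qed
qed

section \<open>The interaction potential and functions with a small second derivative\<close>

lemma abs_powr_le_linear:
  fixes x m a :: real
  assumes "\<bar>x\<bar> \<le> m" "1 \<le> a"
  shows "\<bar>x\<bar> powr a \<le> m powr (a - 1) * \<bar>x\<bar>"
proof -
  have "\<bar>x\<bar> powr a = \<bar>x\<bar> powr (a - 1) * \<bar>x\<bar>"
    using powr_mult_base[of "\<bar>x\<bar>" "a - 1"] by (simp add: mult.commute)
  also have "\<dots> \<le> m powr (a - 1) * \<bar>x\<bar>" using assms by (intro mult_right_mono powr_mono2) auto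
  finally show ?thesis .
qed

lemma powr_le_of_le_root:
  fixes x a \<epsilon> :: real
  assumes "0 < \<epsilon>" "0 < a" "0 < x" "\<epsilon> \<le> x powr (1 / a)"
  shows "\<epsilon> powr a \<le> x"
proof -
  have "\<epsilon> powr a \<le> (x powr (1 / a)) powr a" using assms by (intro powr_mono2) auto
  then show ?thesis using assms by (simp add: powr_powr)
qed

lemma has_real_derivative_abs_powr:
  fixes a r :: real
  assumes a: "1 < a"
  shows "((\<lambda>r. \<bar>r\<bar> powr a) has_real_derivative a * sgn r * \<bar>r\<bar> powr (a - 1)) (at r)"
proof -
  consider "r > 0" | "r < 0" | "r = 0" by linarith
  then show ?thesis
  proof cases
    case 1
    have "((\<lambda>r. r powr a) has_real_derivative a * sgn r * \<bar>r\<bar> powr (a - 1)) (at r)"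
      using 1 by (auto intro!: derivative_eq_intros)
    then show ?thesis
      by (rule has_field_derivative_transform_within_open[of _ _ _ "{0<..}"]) (use 1 in auto)
  next
    case 2
    have "((\<lambda>r. (- r) powr a) has_real_derivative a * sgn r * \<bar>r\<bar> powr (a - 1)) (at r)"
      using 2 by (auto intro!: derivative_eq_intros)
    then show ?thesis
      by (rule has_field_derivative_transform_within_open[of _ _ _ "{..<0}"]) (use 2 in auto)
  next
    case 3
    have lim: "((\<lambda>h::real. \<bar>h\<bar> powr (a - 1)) \<longlongrightarrow> 0) (at 0)"
      using a by (auto intro!: tendsto_eq_intros)
    have "norm ((\<bar>0 + h\<bar> powr a - \<bar>0\<bar> powr a) / h) \<le> \<bar>h\<bar> powr (a - 1)" for h :: real
      using powr_diff[of "\<bar>h\<bar>" a 1] by (cases "h = 0") (auto simp: abs_divide)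
    then have "((\<lambda>h. (\<bar>0 + h\<bar> powr a - \<bar>0\<bar> powr a) / h) \<longlongrightarrow> 0) (at (0::real))"
      by (intro Lim_null_comparison[OF _ lim] always_eventually allI)
    then show ?thesis using 3 by (simp add: DERIV_def)
  qed
qed

lemma has_real_derivative_mult_abs_powr:
  fixes a r :: real
  assumes a: "0 < a"
  shows "((\<lambda>r. r * \<bar>r\<bar> powr a) has_real_derivative (a + 1) * \<bar>r\<bar> powr a) (at r)"
proof -
  consider "r > 0" | "r < 0" | "r = 0" by linarith
  then show ?thesis
  proof cases
    case 1
    have "((\<lambda>r. r powr (a + 1)) has_real_derivative (a + 1) * \<bar>r\<bar> powr a) (at r)"
      using 1 by (auto intro!: derivative_eq_intros)
    then show ?thesis
      by (rule has_field_derivative_transform_within_open[of _ _ _ "{0<..}"])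
        (use 1 in \<open>auto simp: powr_add\<close>)
  next
    case 2
    have "((\<lambda>r. - ((- r) powr (a + 1))) has_real_derivative (a + 1) * \<bar>r\<bar> powr a) (at r)"
      using 2 by (auto intro!: derivative_eq_intros)
    then show ?thesis
      by (rule has_field_derivative_transform_within_open[of _ _ _ "{..<0}"])
        (use 2 in \<open>auto simp: powr_add\<close>)
  next
    case 3
    have lim: "((\<lambda>h::real. \<bar>h\<bar> powr a) \<longlongrightarrow> 0) (at 0)"
      using a by (auto intro!: tendsto_eq_intros)
    have "norm (((0 + h) * \<bar>0 + h\<bar> powr a - 0 * \<bar>0\<bar> powr a) / h) \<le> \<bar>h\<bar> powr a" for h :: real
      by (cases "h = 0") (auto simp: abs_mult)
    then have "((\<lambda>h. ((0 + h) * \<bar>0 + h\<bar> powr a - 0 * \<bar>0\<bar> powr a) / h) \<longlongrightarrow> 0) (at (0::real))"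
      by (intro Lim_null_comparison[OF _ lim] always_eventually allI)
    then show ?thesis using 3 a by (simp add: DERIV_def)
  qed
qed

lemma mult_abs_powr_eq_sgn: "r * \<bar>r\<bar> powr (a - 1) = sgn r * \<bar>r\<bar> powr a" for a r :: real
  using powr_mult_base[of "\<bar>r\<bar>" "a - 1"] by (cases "r = 0") (auto simp: abs_if sgn_if)

text \<open>
  The derivative of \<open>V_hom\<close>, written as the sum of its even and odd parts in \<open>r\<close>. Only the odd part has a first
  harmonic when \<open>r\<close> oscillates like a cosine.
\<close>

definition hom_force :: "real \<Rightarrow> real \<Rightarrow> real \<Rightarrow> real \<Rightarrow> real" where
  "hom_force \<alpha> k_minus k_plus r =
     (k_plus - k_minus) / 2 * \<bar>r\<bar> powr \<alpha> + (k_plus + k_minus) / 2 * (r * \<bar>r\<bar> powr (\<alpha> - 1))"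

lemma V_hom_has_derivative:
  assumes "0 < \<alpha>"
  shows "(V_hom \<alpha> k_minus k_plus has_real_derivative hom_force \<alpha> k_minus k_plus r) (at r)"
proof -
  have "V_hom \<alpha> k_minus k_plus = (\<lambda>r. ((k_plus + k_minus) / 2 * \<bar>r\<bar> powr (\<alpha> + 1)
      + (k_plus - k_minus) / 2 * (r * \<bar>r\<bar> powr \<alpha>)) / (1 + \<alpha>))"
  proof
    fix r
    have "(k_plus + k_minus) / 2 * \<bar>r\<bar> powr (\<alpha> + 1) + (k_plus - k_minus) / 2 * (r * \<bar>r\<bar> powr \<alpha>)
        = (if r \<le> 0 then k_minus else k_plus) * \<bar>r\<bar> powr (\<alpha> + 1)"
      by (cases "r = 0") (auto simp: powr_add abs_if field_simps)
    then show "V_hom \<alpha> k_minus k_plus r = ((k_plus + k_minus) / 2 * \<bar>r\<bar> powr (\<alpha> + 1)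
        + (k_plus - k_minus) / 2 * (r * \<bar>r\<bar> powr \<alpha>)) / (1 + \<alpha>)"
      by (auto simp: V_hom_def)
  qed
  moreover have "((\<lambda>r. ((k_plus + k_minus) / 2 * \<bar>r\<bar> powr (\<alpha> + 1)
      + (k_plus - k_minus) / 2 * (r * \<bar>r\<bar> powr \<alpha>)) / (1 + \<alpha>)) has_real_derivative
      ((k_plus + k_minus) / 2 * ((\<alpha> + 1) * sgn r * \<bar>r\<bar> powr (\<alpha> + 1 - 1))
      + (k_plus - k_minus) / 2 * ((\<alpha> + 1) * \<bar>r\<bar> powr \<alpha>)) / (1 + \<alpha>)) (at r)"
    using assms by (intro DERIV_cdivide DERIV_add DERIV_cmult has_real_derivative_abs_powr
        has_real_derivative_mult_abs_powr) auto
  moreover have "((k_plus + k_minus) / 2 * ((\<alpha> + 1) * sgn r * \<bar>r\<bar> powr (\<alpha> + 1 - 1))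
      + (k_plus - k_minus) / 2 * ((\<alpha> + 1) * \<bar>r\<bar> powr \<alpha>)) / (1 + \<alpha>) = hom_force \<alpha> k_minus k_plus r"
  proof -
    have "1 + \<alpha> \<noteq> 0" using assms by simp
    then show ?thesis unfolding hom_force_def mult_abs_powr_eq_sgn by (simp add: divide_simps) algebra
  qed
  ultimately show ?thesis by simp
qed

lemma hom_force_has_derivative:
  assumes "1 < \<alpha>"
  shows "(hom_force \<alpha> k_minus k_plus has_real_derivative
    ((k_plus - k_minus) / 2 * (\<alpha> * sgn r) + (k_plus + k_minus) / 2 * \<alpha>) * \<bar>r\<bar> powr (\<alpha> - 1)) (at r)"
proof -
  have "((\<lambda>r. (k_plus - k_minus) / 2 * \<bar>r\<bar> powr \<alpha> + (k_plus + k_minus) / 2 * (r * \<bar>r\<bar> powr (\<alpha> - 1)))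
    has_real_derivative (k_plus - k_minus) / 2 * (\<alpha> * sgn r * \<bar>r\<bar> powr (\<alpha> - 1))
      + (k_plus + k_minus) / 2 * ((\<alpha> - 1 + 1) * \<bar>r\<bar> powr (\<alpha> - 1))) (at r)"
    using assms by (intro DERIV_add DERIV_cmult has_real_derivative_abs_powr
        has_real_derivative_mult_abs_powr) auto
  then show ?thesis unfolding hom_force_def[abs_def] by (simp add: algebra_simps)
qed

text \<open>
  A bound in the sense of \<open>O\<close> at \<open>0\<close> says nothing about the value of the derivative at \<open>0\<close> itself; the mean value
  theorem on either side of \<open>0\<close> avoids it.
\<close>

lemma lipschitz_of_derivative_off_zero:
  fixes g g' :: "real \<Rightarrow> real"
  assumes der: "\<And>r. (g has_real_derivative g' r) (at r)"
    and bd: "\<And>r. r \<noteq> 0 \<Longrightarrow> \<bar>r\<bar> \<le> \<rho> \<Longrightarrow> \<bar>g' r\<bar> \<le> B" and "\<bar>x\<bar> \<le> \<rho>" "\<bar>y\<bar> \<le> \<rho>"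
  shows "\<bar>g x - g y\<bar> \<le> B * \<bar>x - y\<bar>"
proof -
  have one_sided: "\<bar>g b - g a\<bar> \<le> B * (b - a)" if ab: "a \<le> b" "0 \<le> a \<or> b \<le> 0" "\<bar>a\<bar> \<le> \<rho>" "\<bar>b\<bar> \<le> \<rho>" for a b
  proof (cases "a = b")
    case False
    then have "\<exists>z. a < z \<and> z < b \<and> g b - g a = (b - a) * g' z" using ab der by (intro MVT2) auto
    then obtain z where z: "a < z" "z < b" "g b - g a = (b - a) * g' z" by blast
    then have "\<bar>g' z\<bar> \<le> B" using ab by (intro bd) auto
    then have "(b - a) * \<bar>g' z\<bar> \<le> (b - a) * B" using ab(1) by (intro mult_left_mono) auto
    then show ?thesis using z ab(1) by (simp add: abs_mult mult.commute)
  qed simp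
  have ordered: "\<bar>g b - g a\<bar> \<le> B * (b - a)" if ab: "a \<le> b" "\<bar>a\<bar> \<le> \<rho>" "\<bar>b\<bar> \<le> \<rho>" for a b
  proof (cases "0 \<le> a \<or> b \<le> 0")
    case False
    then have "\<bar>g 0 - g a\<bar> \<le> B * (0 - a)" "\<bar>g b - g 0\<bar> \<le> B * (b - 0)"
      using ab one_sided[of a 0] one_sided[of 0 b] by auto
    moreover have "B * (b - a) = B * (0 - a) + B * (b - 0)" by (simp add: algebra_simps)
    ultimately show ?thesis by linarith
  qed (use ab one_sided in auto)
  show ?thesis
  proof (cases "x \<le> y")
    case True
    then show ?thesis using ordered[of x y] assms by (simp add: abs_minus_commute)
  next
    case False
    then show ?thesis using ordered[of y x] assms by simp
  qed
qed

lemma bigo_derivative_bounds: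
  fixes g g' :: "real \<Rightarrow> real"
  assumes der: "\<And>r. (g has_real_derivative g' r) (at r)" and g0: "g 0 = 0"
    and O: "g' \<in> O[at 0](\<lambda>r. \<bar>r\<bar> powr b)" and b: "0 < b"
  obtains C \<rho> where "0 < C" "0 < \<rho>" "\<rho> \<le> 1"
    "\<And>r. r \<noteq> 0 \<Longrightarrow> \<bar>r\<bar> \<le> \<rho> \<Longrightarrow> \<bar>g' r\<bar> \<le> C * \<bar>r\<bar> powr b"
    "\<And>r. \<bar>r\<bar> \<le> \<rho> \<Longrightarrow> \<bar>g r\<bar> \<le> C * \<bar>r\<bar> powr (b + 1)"
proof -
  obtain C where C: "C > 0" "\<forall>\<^sub>F r in at 0. norm (g' r) \<le> C * norm (\<bar>r\<bar> powr b)"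
    using landau_o.bigE[OF O] by blast
  then obtain d where d: "d > 0" "\<And>r. r \<noteq> 0 \<Longrightarrow> \<bar>r\<bar> < d \<Longrightarrow> \<bar>g' r\<bar> \<le> C * \<bar>r\<bar> powr b"
    by (auto simp: eventually_at)
  show ?thesis
  proof
    show "0 < C" by fact
    show "0 < min 1 (d / 2)" "min 1 (d / 2) \<le> 1" using d(1) by auto
    show g': "\<bar>g' r\<bar> \<le> C * \<bar>r\<bar> powr b" if "r \<noteq> 0" "\<bar>r\<bar> \<le> min 1 (d / 2)" for r
      using d that by auto
    show "\<bar>g r\<bar> \<le> C * \<bar>r\<bar> powr (b + 1)" if r: "\<bar>r\<bar> \<le> min 1 (d / 2)" for r
    proof -
      have "\<bar>g r - g 0\<bar> \<le> (C * \<bar>r\<bar> powr b) * \<bar>r - 0\<bar>"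
      proof (rule lipschitz_of_derivative_off_zero[OF der, of "\<bar>r\<bar>"])
        fix s assume s: "s \<noteq> 0" "\<bar>s\<bar> \<le> \<bar>r\<bar>"
        then have "\<bar>g' s\<bar> \<le> C * \<bar>s\<bar> powr b" using r by (intro g') auto
        also have "\<dots> \<le> C * \<bar>r\<bar> powr b" using s b C by (intro mult_left_mono powr_mono2) auto
        finally show "\<bar>g' s\<bar> \<le> C * \<bar>r\<bar> powr b" .
      qed auto
      then show ?thesis using g0 by (simp add: powr_add mult.assoc)
    qed
  qed
qed

text \<open>
  The projection of the line onto \<open>[-\<rho>, \<rho>]\<close>. Composing a force with it makes the force globally Lipschitz.
\<close>

definition clip :: "real \<Rightarrow> real \<Rightarrow> real" where
  "clip \<rho> r = max (- \<rho>) (min \<rho> r)"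

lemma clip_lipschitz: "\<bar>clip \<rho> x - clip \<rho> y\<bar> \<le> \<bar>x - y\<bar>"
  by (auto simp: clip_def)

lemma abs_clip_le: "0 \<le> \<rho> \<Longrightarrow> \<bar>clip \<rho> r\<bar> \<le> \<rho>"
  by (auto simp: clip_def)

lemma clip_eq: "\<bar>r\<bar> \<le> \<rho> \<Longrightarrow> clip \<rho> r = r"
  by (auto simp: clip_def)

section \<open>Periodic functions of mean zero\<close>

lemma periodic_bounded:
  fixes H :: "real \<Rightarrow> real"
  assumes cont: "continuous_on UNIV H" and T: "0 < T" and per: "\<And>x. H (x + T) = H x"
  obtains B where "\<And>x. \<bar>H x\<bar> \<le> B"
proof -
  have per_nat: "H (x + real n * T) = H x" for x n
  proof (induction n)
    case (Suc n)
    have "H (x + real (Suc n) * T) = H ((x + real n * T) + T)" by (simp add: algebra_simps)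
    then show ?case using per Suc by simp
  qed simp
  have per_int: "H (x + of_int k * T) = H x" for x k
  proof (cases "k \<ge> 0")
    case True
    then show ?thesis using per_nat[of x "nat k"] by simp
  next
    case False
    then show ?thesis using per_nat[of "x + of_int k * T" "nat (- k)"] by simp
  qed
  have "bounded (H ` {0..T})"
    by (intro compact_imp_bounded compact_continuous_image continuous_on_subset[OF cont]) auto
  then obtain B where "\<forall>y\<in>H ` {0..T}. norm y \<le> B" unfolding bounded_iff by blast
  then have B: "\<And>x. x \<in> {0..T} \<Longrightarrow> \<bar>H x\<bar> \<le> B" by simp
  show ?thesis
  proof
    fix x
    have "of_int \<lfloor>x / T\<rfloor> \<le> x / T" "x / T < of_int \<lfloor>x / T\<rfloor> + 1" by linarith+
    then have "of_int \<lfloor>x / T\<rfloor> * T \<le> x" "x < (of_int \<lfloor>x / T\<rfloor> + 1) * T"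
      using T by (simp_all only: pos_le_divide_eq pos_divide_less_eq)
    then have "x + of_int (- \<lfloor>x / T\<rfloor>) * T \<in> {0..T}" by (auto simp: algebra_simps)
    then show "\<bar>H x\<bar> \<le> B" using B per_int[of x "- \<lfloor>x / T\<rfloor>"] by metis
  qed
qed

lemma antiderivative_exists:
  fixes g :: "real \<Rightarrow> real"
  assumes "continuous_on UNIV g"
  obtains H where "\<And>x. (H has_real_derivative g x) (at x)"
proof -
  have "\<exists>H. \<forall>x. - \<infinity> < ereal x \<longrightarrow> ereal x < \<infinity> \<longrightarrow> (H has_vector_derivative g x) (at x)"
    using assms by (intro einterval_antiderivative) (auto simp: continuous_on_eq_continuous_at)
  then show ?thesis using that by (auto simp: has_real_derivative_iff_has_vector_derivative)
qed

text \<open>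
  A function that changes sign under a shift by \<open>T\<close> has mean zero over the period \<open>2T\<close>, so its
  antiderivative is periodic.
\<close>

lemma bounded_antiderivative_antiperiodic:
  fixes g :: "real \<Rightarrow> real"
  assumes cont: "continuous_on UNIV g" and T: "0 < T" and anti: "\<And>x. g (x + T) = - g x"
  obtains H B where "\<And>x. (H has_real_derivative g x) (at x)" "\<And>x. \<bar>H x\<bar> \<le> B"
proof -
  obtain H where H: "\<And>x. (H has_real_derivative g x) (at x)" using antiderivative_exists[OF cont] by blast
  have d: "((\<lambda>x. H (x + T) + H x) has_real_derivative 0) (at x)" for x
  proof -
    have "((\<lambda>x. H (x + T)) has_real_derivative g (x + T)) (at x)"
      by (rule DERIV_shift[THEN iffD1, OF H])
    from DERIV_add[OF this H[of x]] show ?thesis by (simp add: anti)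
  qed
  have const: "H (x + T) + H x = H (y + T) + H y" for x y
    by (rule DERIV_isconst_all[OF allI[OF d]])
  have per: "H (x + 2 * T) = H x" for x
  proof -
    have "x + 2 * T = x + T + T" by simp
    moreover have "H (x + T + T) = H x" using const[of x "x + T"] by linarith
    ultimately show ?thesis by (simp only:)
  qed
  have H_cont: "continuous_on UNIV H" by (rule DERIV_continuous_on) (rule has_field_derivative_at_within, rule H)
  obtain B where "\<And>x. \<bar>H x\<bar> \<le> B" by (rule periodic_bounded[OF H_cont _ per]) (use T in auto)
  then show ?thesis by (rule that[OF H])
qed

text \<open>
  The substitution \<open>y = cos\<^sup>2 t\<close> in the Beta integral. The integrand on the Beta side is unbounded at \<open>y = 1\<close>, so
  the change of variables is the one for absolutely integrable functions on the open interval.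
\<close>

lemma has_integral_cos_powr:
  assumes a: "0 < a"
  shows "((\<lambda>t. cos t powr a) has_integral Beta ((a + 1) / 2) (1 / 2) / 2) {0..pi / 2}"
proof -
  define f where "f t = t powr ((a + 1) / 2 - 1) * (1 - t) powr (1 / 2 - 1)" for t :: real
  define S where "S = {0<..<pi / 2}"
  have cs: "0 < cos t" "0 < sin t" if "t \<in> S" for t
    using that by (auto simp: S_def intro: cos_gt_zero sin_gt_zero)
  have image: "(\<lambda>t. (cos t)\<^sup>2) ` S = {0<..<1}"
  proof (intro equalityI subsetI)
    fix y assume "y \<in> (\<lambda>t. (cos t)\<^sup>2) ` S"
    then obtain t where t: "t \<in> S" "y = (cos t)\<^sup>2" by blast
    then show "y \<in> {0<..<1}" using cs[OF t(1)] zero_less_power[of "sin t" 2] by (simp add: sin_squared_eq)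
  next
    fix y :: real assume y: "y \<in> {0<..<1}"
    then have s: "0 < sqrt y" "sqrt y < 1" by auto
    have "0 < arccos (sqrt y)" using arccos_less_arccos[of "sqrt y" 1] s by simp
    moreover have "arccos (sqrt y) < pi / 2" using arccos_less_arccos[of 0 "sqrt y"] s by simp
    moreover have "cos (arccos (sqrt y)) = sqrt y" using s by (intro cos_arccos) linarith+
    ultimately have "arccos (sqrt y) \<in> S" "(cos (arccos (sqrt y)))\<^sup>2 = y"
      using y by (auto simp: S_def)
    then show "y \<in> (\<lambda>t. (cos t)\<^sup>2) ` S" by (intro image_eqI[of _ _ "arccos (sqrt y)"]) simp_all
  qed
  have f_int: "(f has_integral Beta ((a + 1) / 2) (1 / 2)) {0<..<1}"
    using has_integral_Beta_real[of "(a + 1) / 2" "1 / 2"] a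
    unfolding f_def by (simp add: has_integral_Icc_iff_Ioo)
  then have "f absolutely_integrable_on {0<..<1}"
    by (intro nonnegative_absolutely_integrable_1) (auto simp: f_def)
  with f_int have f_abs: "f absolutely_integrable_on ((\<lambda>t. (cos t)\<^sup>2) ` S)
      \<and> integral ((\<lambda>t. (cos t)\<^sup>2) ` S) f = Beta ((a + 1) / 2) (1 / 2)"
    unfolding image by (simp add: integral_unique)
  have inj: "inj_on (\<lambda>t. (cos t)\<^sup>2) S"
  proof (rule inj_onI)
    fix x y assume xy: "x \<in> S" "y \<in> S" "(cos x)\<^sup>2 = (cos y)\<^sup>2"
    have "cos x = cos y"
      using xy(3) by (rule power2_eq_imp_eq) (use cs[OF xy(1)] cs[OF xy(2)] in linarith)+
    moreover have "0 \<le> x" "x \<le> pi" "0 \<le> y" "y \<le> pi" using xy(1,2) by (auto simp: S_def)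
    ultimately show "x = y" by (simp add: cos_inj_pi)
  qed
  have der: "((\<lambda>t. (cos t)\<^sup>2) has_real_derivative - 2 * cos t * sin t) (at t within S)" for t
  proof -
    have "((\<lambda>t. (cos t)\<^sup>2) has_real_derivative of_nat 2 * (- sin t * cos t ^ (2 - Suc 0))) (at t)"
      by (rule DERIV_power[OF DERIV_cos])
    from has_field_derivative_at_within[OF this] show ?thesis by (simp add: mult_ac)
  qed
  have "S \<in> sets lebesgue" by (simp add: S_def)
  from has_absolute_integral_change_of_variables_1'[of S "\<lambda>t. (cos t)\<^sup>2" "\<lambda>t. - 2 * cos t * sin t",
      OF this der inj, THEN iffD2, OF f_abs]
  have "(\<lambda>t. \<bar>- 2 * cos t * sin t\<bar> * f ((cos t)\<^sup>2)) integrable_on S"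
    "integral S (\<lambda>t. \<bar>- 2 * cos t * sin t\<bar> * f ((cos t)\<^sup>2)) = Beta ((a + 1) / 2) (1 / 2)"
    by (simp_all only: set_lebesgue_integral_eq_integral(1))
  then have sub: "((\<lambda>t. \<bar>- 2 * cos t * sin t\<bar> * f ((cos t)\<^sup>2)) has_integral Beta ((a + 1) / 2) (1 / 2)) S"
    using integrable_integral by metis
  have "\<bar>- 2 * cos t * sin t\<bar> * f ((cos t)\<^sup>2) = 2 * cos t powr a" if "t \<in> S" for t
  proof -
    have "(1 - (cos t)\<^sup>2) powr (1 / 2 - 1) = ((sin t) powr 2) powr (- 1 / 2)"
      using cs[OF that] by (simp add: sin_squared_eq[symmetric])
    also have "\<dots> = inverse (sin t)" using cs[OF that] by (subst powr_powr) (simp add: powr_minus)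
    finally have "(1 - (cos t)\<^sup>2) powr (1 / 2 - 1) = inverse (sin t)" .
    moreover have "((cos t)\<^sup>2) powr ((a + 1) / 2 - 1) = cos t powr (a - 1)"
    proof -
      have "2 * ((a + 1) / 2 - 1) = a - 1" by (simp add: field_simps)
      moreover have "((cos t)\<^sup>2) powr ((a + 1) / 2 - 1) = (cos t powr 2) powr ((a + 1) / 2 - 1)"
        using cs[OF that] by simp
      ultimately show ?thesis by (simp only: powr_powr)
    qed
    ultimately have "f ((cos t)\<^sup>2) = cos t powr (a - 1) * inverse (sin t)" by (simp only: f_def)
    then have "\<bar>- 2 * cos t * sin t\<bar> * f ((cos t)\<^sup>2)
        = 2 * (cos t * cos t powr (a - 1)) * (sin t * inverse (sin t))"
      using cs[OF that] by (simp add: abs_mult mult_ac)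
    then show ?thesis using cs[OF that] powr_mult_base[of "cos t" "a - 1"] by simp
  qed
  then have "((\<lambda>t. 2 * cos t powr a) has_integral Beta ((a + 1) / 2) (1 / 2)) S"
    by (rule has_integral_eq[OF _ sub])
  from has_integral_divide[OF this, of 2]
  show ?thesis by (simp add: S_def has_integral_Icc_iff_Ioo)
qed

text \<open>
  The mean value of \<open>|cos|\<^bsup>\<alpha>+1\<^esup>\<close>, in the form in which it enters \<open>\<omega>\<^sub>0\<close>.
\<close>

definition cos_mean :: "real \<Rightarrow> real" where
  "cos_mean \<alpha> = \<alpha> * Gamma (\<alpha> / 2) / (sqrt pi * (\<alpha> + 1) * Gamma ((\<alpha> + 1) / 2))"

lemma Beta_eq_cos_mean:
  assumes "0 < \<alpha>"
  shows "Beta ((\<alpha> + 1 + 1) / 2) (1 / 2) / 2 = pi / 2 * cos_mean \<alpha>"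
proof -
  have pos: "x \<notin> \<int>\<^sub>\<le>\<^sub>0" if "0 < x" for x :: real using that by (auto elim!: nonpos_Ints_cases)
  have "Gamma ((\<alpha> + 1 + 1) / 2) = \<alpha> / 2 * Gamma (\<alpha> / 2)"
    using assms Gamma_plus1[of "\<alpha> / 2"] pos by (simp add: add_divide_distrib add.commute)
  moreover have "Gamma ((\<alpha> + 1 + 1) / 2 + 1 / 2) = (\<alpha> + 1) / 2 * Gamma ((\<alpha> + 1) / 2)"
    using assms Gamma_plus1[of "(\<alpha> + 1) / 2"] pos by (simp add: add_divide_distrib add.commute)
  ultimately have B: "Beta ((\<alpha> + 1 + 1) / 2) (1 / 2)
      = \<alpha> / 2 * Gamma (\<alpha> / 2) * sqrt pi / ((\<alpha> + 1) / 2 * Gamma ((\<alpha> + 1) / 2))"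
    by (simp only: Beta_def Gamma_one_half_real)
  have cancel: "(\<alpha> / 2 * g * q / ((\<alpha> + 1) / 2 * G)) / 2 = q * q / 2 * (\<alpha> * g / (q * (\<alpha> + 1) * G))"
    if "q \<noteq> 0" "0 < G" for g q G :: real
  proof -
    have "\<alpha> + 1 \<noteq> 0" using assms by simp
    then show ?thesis using that by (simp add: divide_simps)
  qed
  have "0 < Gamma ((\<alpha> + 1) / 2)" by (rule Gamma_real_pos) (use assms in simp)
  from cancel[OF _ this, of "sqrt pi"] show ?thesis unfolding cos_mean_def B by simp
qed

text \<open>
  The Beta integral shows that the antiderivative takes the same value at \<open>0\<close> and \<open>\<pi>/2\<close>; the reflection
  \<open>x \<mapsto> \<pi> - x\<close> then gives the same value at \<open>\<pi>\<close>, and the integrand has period \<open>\<pi>\<close>.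
\<close>

lemma bounded_antiderivative_cos_powr_minus_mean:
  assumes \<alpha>: "0 < \<alpha>"
  obtains H B where "\<And>x. (H has_real_derivative \<bar>cos x\<bar> powr (\<alpha> + 1) - cos_mean \<alpha>) (at x)" "\<And>x. \<bar>H x\<bar> \<le> B"
proof -
  let ?g = "\<lambda>x. \<bar>cos x\<bar> powr (\<alpha> + 1) - cos_mean \<alpha>"
  have cont: "continuous_on UNIV ?g" using \<alpha> by (intro continuous_on_diff continuous_on_powr' continuous_intros) auto
  obtain H where H: "\<And>x. (H has_real_derivative ?g x) (at x)" using antiderivative_exists[OF cont] by blast
  have ftc: "(?g has_integral H (pi / 2) - H 0) {0..pi / 2}"
    using H by (intro fundamental_theorem_of_calculus)
      (auto simp: has_real_derivative_iff_has_vector_derivative[symmetric] intro: has_field_derivative_at_within)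
  have zero: "(?g has_integral pi / 2 * cos_mean \<alpha> - cos_mean \<alpha> * (pi / 2)) {0..pi / 2}"
  proof (rule has_integral_diff)
    have "((\<lambda>t. cos t powr (\<alpha> + 1)) has_integral pi / 2 * cos_mean \<alpha>) {0..pi / 2}"
      using has_integral_cos_powr[of "\<alpha> + 1"] Beta_eq_cos_mean[OF \<alpha>] \<alpha> by simp
    then show "((\<lambda>t. \<bar>cos t\<bar> powr (\<alpha> + 1)) has_integral pi / 2 * cos_mean \<alpha>) {0..pi / 2}"
      by (rule has_integral_eq[rotated]) (auto simp: cos_ge_zero)
    show "((\<lambda>t. cos_mean \<alpha>) has_integral cos_mean \<alpha> * (pi / 2)) {0..pi / 2}"
      using has_integral_const_real[of "cos_mean \<alpha>" 0 "pi / 2"] by (simp add: mult.commute)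
  qed
  have quarter: "H (pi / 2) = H 0" using has_integral_unique[OF ftc zero] by simp
  have refl_d: "((\<lambda>x. H x + H (pi - x)) has_real_derivative 0) (at x)" for x
  proof -
    have "((\<lambda>x. pi - x) has_real_derivative - 1) (at x)" by (auto intro!: derivative_eq_intros)
    from DERIV_add[OF H[of x] DERIV_chain'[OF this H]] show ?thesis by simp
  qed
  have "H 0 + H (pi - 0) = H (pi / 2) + H (pi - pi / 2)"
    by (rule DERIV_isconst_all[OF allI[OF refl_d]])
  then have half: "H pi = H 0" using quarter by simp
  have shift_d: "((\<lambda>x. H (x + pi) - H x) has_real_derivative 0) (at x)" for x
  proof -
    have "((\<lambda>x. H (x + pi)) has_real_derivative ?g (x + pi)) (at x)"
      by (rule DERIV_shift[THEN iffD1, OF H])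
    from DERIV_diff[OF this H[of x]] show ?thesis by simp
  qed
  have "H (x + pi) - H x = H (0 + pi) - H 0" for x
    by (rule DERIV_isconst_all[OF allI[OF shift_d]])
  then have per: "H (x + pi) = H x" for x using half by simp
  have H_cont: "continuous_on UNIV H" by (rule DERIV_continuous_on) (rule has_field_derivative_at_within, rule H)
  obtain B where "\<And>x. \<bar>H x\<bar> \<le> B" by (rule periodic_bounded[OF H_cont _ per]) auto
  then show ?thesis by (rule that[OF H])
qed

text \<open>
  The four scalar functions of the phase that occur when the homogeneous force on the breather is seen in the rotating
  frame. The first and third come from the even part of the force, the second and fourth from its odd part.
\<close>

lemma correctors_exist:
  assumes \<alpha>: "1 < \<alpha>"
  obtains H1 H2 H3 H4 B where
    "\<And>x. (H1 has_real_derivative \<bar>cos x\<bar> powr \<alpha> * sin x) (at x)"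
    "\<And>x. (H2 has_real_derivative cos x * \<bar>cos x\<bar> powr (\<alpha> - 1) * sin x) (at x)"
    "\<And>x. (H3 has_real_derivative \<bar>cos x\<bar> powr \<alpha> * cos x) (at x)"
    "\<And>x. (H4 has_real_derivative \<bar>cos x\<bar> powr (\<alpha> + 1) - cos_mean \<alpha>) (at x)"
    "\<And>x. \<bar>H1 x\<bar> \<le> B" "\<And>x. \<bar>H2 x\<bar> \<le> B" "\<And>x. \<bar>H3 x\<bar> \<le> B" "\<And>x. \<bar>H4 x\<bar> \<le> B"
proof -
  have cont: "continuous_on UNIV (\<lambda>x::real. \<bar>cos x\<bar> powr \<alpha>)"
    using \<alpha> by (intro continuous_on_powr' continuous_intros) auto
  obtain H1 B1 where H1: "\<And>x. (H1 has_real_derivative \<bar>cos x\<bar> powr \<alpha> * sin x) (at x)" "\<And>x. \<bar>H1 x\<bar> \<le> B1"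
    by (rule bounded_antiderivative_antiperiodic[of "\<lambda>x. \<bar>cos x\<bar> powr \<alpha> * sin x" pi])
      (auto intro!: continuous_on_mult cont continuous_intros)
  obtain H3 B3 where H3: "\<And>x. (H3 has_real_derivative \<bar>cos x\<bar> powr \<alpha> * cos x) (at x)" "\<And>x. \<bar>H3 x\<bar> \<le> B3"
    by (rule bounded_antiderivative_antiperiodic[of "\<lambda>x. \<bar>cos x\<bar> powr \<alpha> * cos x" pi])
      (auto intro!: continuous_on_mult cont continuous_intros)
  obtain H4 B4 where H4: "\<And>x. (H4 has_real_derivative \<bar>cos x\<bar> powr (\<alpha> + 1) - cos_mean \<alpha>) (at x)" "\<And>x. \<bar>H4 x\<bar> \<le> B4"
    using bounded_antiderivative_cos_powr_minus_mean[of \<alpha>] \<alpha> by auto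
  define H2 where "H2 x = - (\<bar>cos x\<bar> powr (\<alpha> + 1)) / (\<alpha> + 1)" for x :: real
  have H2: "(H2 has_real_derivative cos x * \<bar>cos x\<bar> powr (\<alpha> - 1) * sin x) (at x)" for x
  proof -
    have "((\<lambda>r. \<bar>r\<bar> powr (\<alpha> + 1)) has_real_derivative (\<alpha> + 1) * sgn (cos x) * \<bar>cos x\<bar> powr (\<alpha> + 1 - 1)) (at (cos x))"
      using \<alpha> by (intro has_real_derivative_abs_powr) simp
    from DERIV_cdivide[OF DERIV_minus[OF DERIV_chain2[OF this DERIV_cos]], of "\<alpha> + 1"]
    show ?thesis using \<alpha> by (simp add: H2_def[abs_def] mult_abs_powr_eq_sgn mult.assoc)
  qed
  have H2_bound: "\<bar>H2 x\<bar> \<le> 1" for x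
  proof -
    have "\<bar>cos x\<bar> powr (\<alpha> + 1) \<le> 1" using \<alpha> powr_mono2[of "\<alpha> + 1" "\<bar>cos x\<bar>" 1] by simp
    then show ?thesis using \<alpha> by (simp add: H2_def divide_simps)
  qed
  define B where "B = max (max B1 1) (max B3 B4)"
  show ?thesis
  proof (rule that[OF H1(1) H2 H3(1) H4(1)])
    show "\<bar>H1 x\<bar> \<le> B" "\<bar>H2 x\<bar> \<le> B" "\<bar>H3 x\<bar> \<le> B" "\<bar>H4 x\<bar> \<le> B" for x
      using H1(2)[of x] H2_bound[of x] H3(2)[of x] H4(2)[of x] by (auto simp: B_def)
  qed
qed

section \<open>The lattice field\<close>

text \<open>
  The superexponential decay with \<open>q = 1/2\<close> is geometric by Bernoulli's inequality
  \<open>\<alpha>\<^sup>k \<ge> 1 + k (\<alpha> - 1)\<close>, and the symmetry of \<open>v\<close> transfers it to the other end of the lattice.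
\<close>

lemma localized_stationary_abs_summable:
  assumes \<alpha>: "1 < \<alpha>" and v: "localized_stationary \<alpha> v"
  shows "(\<lambda>n. \<bar>v n\<bar>) summable_on UNIV"
proof -
  have "\<forall>q\<in>{0<..<1}. \<exists>n0::nat. \<forall>n\<ge>n0. \<bar>v (int n)\<bar> \<le> q powr (1 + \<alpha> ^ (n - n0))"
    using v unfolding localized_stationary_def by blast
  moreover have "(1/2 :: real) \<in> {0<..<1}" by simp
  ultimately obtain n0 :: nat where n0: "\<And>n. n \<ge> n0 \<Longrightarrow> \<bar>v (int n)\<bar> \<le> (1/2) powr (1 + \<alpha> ^ (n - n0))"
    by blast
  define r :: real where "r = (1/2) powr (\<alpha> - 1)"
  have r: "0 < r" "r < 1" using \<alpha> powr_less_mono'[of "1/2" 0 "\<alpha> - 1"] by (auto simp: r_def)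
  have tail: "\<bar>v (int (k + n0))\<bar> \<le> r ^ k" for k
  proof -
    have bern: "1 + real k * (\<alpha> - 1) \<le> \<alpha> ^ k" using Bernoulli_inequality[of "\<alpha> - 1" k] \<alpha> by simp
    have "\<bar>v (int (k + n0))\<bar> \<le> (1/2) powr (1 + \<alpha> ^ k)" using n0[of "k + n0"] by simp
    also have "\<dots> \<le> (1/2) powr ((\<alpha> - 1) * real k)" using bern by (intro powr_mono') (auto simp: mult.commute)
    also have "\<dots> = r ^ k" by (simp add: r_def powr_powr[symmetric] powr_realpow)
    finally show ?thesis .
  qed
  have "summable (\<lambda>k. \<bar>v (int (k + n0))\<bar>)"
    by (rule summable_comparison_test'[OF summable_geometric[of r]]) (use r tail in auto)
  then have s: "summable (\<lambda>k. \<bar>v (int k)\<bar>)" by (subst (asm) summable_iff_shift)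
  then have nat_side: "(\<lambda>k. \<bar>v (int k)\<bar>) summable_on UNIV"
    by (intro norm_summable_imp_summable_on) simp
  have neg_side: "(\<lambda>k. \<bar>v (- int k)\<bar>) summable_on UNIV"
  proof -
    consider "\<forall>n. v n = v (- n)" | "\<forall>n. v n = - v (- n + 1)"
      using v unfolding localized_stationary_def site_centered_def bond_centered_def by blast
    then have "summable (\<lambda>k. \<bar>v (- int k)\<bar>)"
    proof cases
      case 1
      have "v (- int k) = v (int k)" for k using spec[OF 1, of "- int k"] by simp
      then show ?thesis using s by simp
    next
      case 2
      have "v (- int k) = - v (int (k + 1))" for k using spec[OF 2, of "- int k"] by (simp add: add.commute)
      then have "(\<lambda>k. \<bar>v (- int k)\<bar>) = (\<lambda>k. \<bar>v (int (k + 1))\<bar>)" by simp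
      then show ?thesis using summable_iff_shift[of "\<lambda>k. \<bar>v (int k)\<bar>" 1] s by simp
    qed
    then show ?thesis by (intro norm_summable_imp_summable_on) simp
  qed
  have "(\<lambda>n. \<bar>v n\<bar>) summable_on range int"
    using nat_side by (subst summable_on_reindex) (auto simp: o_def)
  moreover have "(\<lambda>n. \<bar>v n\<bar>) summable_on range (\<lambda>k. - int k)"
    using neg_side by (subst summable_on_reindex) (auto simp: o_def inj_on_def)
  ultimately have "(\<lambda>n. \<bar>v n\<bar>) summable_on (range int \<union> range (\<lambda>k. - int k))"
    by (rule summable_on_union)
  moreover have "range int \<union> range (\<lambda>k. - int k) = UNIV"
  proof -
    have "n \<in> range int \<union> range (\<lambda>k. - int k)" for n
      by (cases n rule: int_cases2) auto
    then show ?thesis by blast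
  qed
  ultimately show ?thesis by simp
qed

definition lattice_force :: "(real \<Rightarrow> real) \<Rightarrow> (real \<Rightarrow> real) \<Rightarrow> (int \<Rightarrow> real) \<Rightarrow> int \<Rightarrow> real" where
  "lattice_force U \<psi> x n = U (x (n + 1) - x n) - U (x n - x (n - 1)) - \<psi> (x n)"

text \<open>
  The right-hand side \<open>J + G\<close> for arbitrary force functions \<open>U\<close> and \<open>\<psi>\<close>, so that the original and the
  clipped forces are treated alike.
\<close>

definition lattice_field ::
  "(real \<Rightarrow> real) \<Rightarrow> (real \<Rightarrow> real) \<Rightarrow> (int \<Rightarrow> real \<times> real) \<Rightarrow> int \<Rightarrow> real \<times> real" where
  "lattice_field U \<psi> X n = (snd (X n), - fst (X n) + lattice_force U \<psi> (fst \<circ> X) n)"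

lemma lattice_field_eq:
  "(\<lambda>X n. lattice_J X n + lattice_G V \<phi> X n) = lattice_field (deriv V) (deriv \<phi>)"
  by (auto simp: fun_eq_iff lattice_J_def lattice_G_def lattice_field_def lattice_F_def
      lattice_force_def delta_plus_def delta_minus_def)

lemma lattice_force_lipschitz:
  assumes U: "\<And>a b. \<bar>U a - U b\<bar> \<le> L * \<bar>a - b\<bar>" and \<psi>: "\<And>a b. \<bar>\<psi> a - \<psi> b\<bar> \<le> L * \<bar>a - b\<bar>"
    and L: "0 \<le> L" and d: "\<And>n. \<bar>x n - y n\<bar> \<le> d n"
  shows "\<bar>lattice_force U \<psi> x n - lattice_force U \<psi> y n\<bar> \<le> 3 * L * nbr_sum d n"
proof -
  have U': "\<bar>U (x (m + 1) - x m) - U (y (m + 1) - y m)\<bar> \<le> L * (d (m + 1) + d m)" for m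
  proof -
    have "\<bar>(x (m + 1) - x m) - (y (m + 1) - y m)\<bar> \<le> d (m + 1) + d m"
      using d[of m] d[of "m + 1"] by linarith
    from order_trans[OF U mult_left_mono[OF this L]] show ?thesis .
  qed
  have "\<bar>\<psi> (x n) - \<psi> (y n)\<bar> \<le> L * d n" using order_trans[OF \<psi> mult_left_mono[OF d L]] .
  then have "\<bar>lattice_force U \<psi> x n - lattice_force U \<psi> y n\<bar>
      \<le> L * (d (n + 1) + d n) + L * (d n + d (n - 1)) + L * d n"
    using U'[of n] U'[of "n - 1"] by (simp add: lattice_force_def)
  also have "\<dots> = L * (3 * d n + d (n + 1) + d (n - 1))" by (simp add: algebra_simps)
  also have "\<dots> \<le> L * (3 * nbr_sum d n)"
    using d[of "n + 1"] d[of "n - 1"] by (intro mult_left_mono L) (simp add: nbr_sum_def)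
  finally show ?thesis by simp
qed

lemma norm_le_Pair: "\<bar>fst z\<bar> \<le> norm z" "\<bar>snd z\<bar> \<le> norm z" for z :: "real \<times> real"
  using norm_fst_le[of "fst z" "snd z"] norm_snd_le[of "snd z" "fst z"] by simp_all

lemma nbr_lipschitz_lattice_field:
  assumes U: "\<And>a b. \<bar>U a - U b\<bar> \<le> L * \<bar>a - b\<bar>" and \<psi>: "\<And>a b. \<bar>\<psi> a - \<psi> b\<bar> \<le> L * \<bar>a - b\<bar>"
    and L: "0 \<le> L" and \<psi>0: "\<psi> 0 = 0"
  shows "nbr_lipschitz (1 + 3 * L) (lattice_field U \<psi>)"
  unfolding nbr_lipschitz_def
proof (intro conjI allI)
  show "0 \<le> 1 + 3 * L" using L by simp
  show "lattice_field U \<psi> (\<lambda>_. 0) = (\<lambda>_. 0)"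
    by (auto simp: lattice_field_def lattice_force_def \<psi>0 fun_eq_iff zero_prod_def)
  fix u w :: "int \<Rightarrow> real \<times> real" and n
  let ?d = "\<lambda>j. norm (u j - w j)"
  let ?F = "lattice_force U \<psi> (fst \<circ> u) n - lattice_force U \<psi> (fst \<circ> w) n"
  have F: "\<bar>?F\<bar> \<le> 3 * L * nbr_sum ?d n"
    using norm_le_Pair(1)[of "u j - w j" for j] by (intro lattice_force_lipschitz U \<psi> L) simp
  have "lattice_field U \<psi> u n - lattice_field U \<psi> w n
      = (snd (u n - w n), - fst (u n - w n)) + (0, ?F)"
    by (simp add: lattice_field_def)
  then have "norm (lattice_field U \<psi> u n - lattice_field U \<psi> w n)
      \<le> norm (snd (u n - w n), - fst (u n - w n)) + norm ((0, ?F) :: real \<times> real)"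
    by (metis norm_triangle_ineq)
  also have "norm (snd (u n - w n), - fst (u n - w n)) = ?d n"
    by (cases "u n - w n") (simp add: norm_Pair add.commute)
  also have "norm ((0, ?F) :: real \<times> real) = \<bar>?F\<bar>" by (simp add: norm_Pair)
  also have "?d n + \<bar>?F\<bar> \<le> nbr_sum ?d n + 3 * L * nbr_sum ?d n"
    using F by (intro add_mono) (auto simp: nbr_sum_def)
  also have "\<dots> = (1 + 3 * L) * nbr_sum ?d n" by (simp add: algebra_simps)
  finally show "norm (lattice_field U \<psi> u n - lattice_field U \<psi> w n) \<le> (1 + 3 * L) * nbr_sum ?d n" .
qed

lemma lattice_field_clip:
  assumes X: "\<And>n. \<bar>fst (X n)\<bar> \<le> M" and M: "2 * M \<le> \<rho>"
  shows "lattice_field (\<lambda>r. U (clip \<rho> r)) (\<lambda>r. \<psi> (clip \<rho> r)) X = lattice_field U \<psi> X"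
proof -
  have "clip \<rho> (fst (X n)) = fst (X n)" for n
    using X[of n] M by (intro clip_eq) linarith
  moreover have "clip \<rho> (fst (X k) - fst (X n)) = fst (X k) - fst (X n)" for k n
    using X[of n] X[of k] M by (intro clip_eq) linarith
  ultimately show ?thesis by (simp add: fun_eq_iff lattice_field_def lattice_force_def)
qed

lemma clip_comp_lipschitz:
  fixes g g' :: "real \<Rightarrow> real"
  assumes der: "\<And>r. (g has_real_derivative g' r) (at r)" and \<rho>: "0 \<le> \<rho>" and B: "0 \<le> B"
    and bd: "\<And>r. r \<noteq> 0 \<Longrightarrow> \<bar>r\<bar> \<le> \<rho> \<Longrightarrow> \<bar>g' r\<bar> \<le> B"
  shows "\<bar>g (clip \<rho> a) - g (clip \<rho> b)\<bar> \<le> B * \<bar>a - b\<bar>"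
proof -
  have "\<bar>g (clip \<rho> a) - g (clip \<rho> b)\<bar> \<le> B * \<bar>clip \<rho> a - clip \<rho> b\<bar>"
    using der bd by (rule lipschitz_of_derivative_off_zero) (use \<rho> abs_clip_le in auto)
  also have "\<dots> \<le> B * \<bar>a - b\<bar>" by (intro mult_left_mono clip_lipschitz B)
  finally show ?thesis .
qed

lemma C2_derivatives:
  assumes "C2 f"
  shows "(f has_real_derivative deriv f r) (at r)"
    and "(deriv f has_real_derivative deriv (deriv f) r) (at r)"
  using assms by (auto simp: C2_def DERIV_deriv_iff_field_differentiable)

lemma C2_clip_lipschitz:
  assumes f: "C2 f" and \<rho>: "0 \<le> \<rho>"
  obtains L where "0 \<le> L" "\<And>a b. \<bar>deriv f (clip \<rho> a) - deriv f (clip \<rho> b)\<bar> \<le> L * \<bar>a - b\<bar>"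
proof -
  have "continuous_on {- \<rho>..\<rho>} (deriv (deriv f))"
    using f continuous_on_subset by (auto simp: C2_def)
  then have "bounded (deriv (deriv f) ` {- \<rho>..\<rho>})"
    by (intro compact_imp_bounded compact_continuous_image) auto
  then obtain L where "\<forall>y\<in>deriv (deriv f) ` {- \<rho>..\<rho>}. norm y \<le> L" unfolding bounded_iff by blast
  then have L: "\<And>r. \<bar>r\<bar> \<le> \<rho> \<Longrightarrow> \<bar>deriv (deriv f) r\<bar> \<le> L" by (simp add: abs_le_iff)
  have L0: "0 \<le> L" using L[of 0] \<rho> by simp
  have "\<bar>deriv f (clip \<rho> a) - deriv f (clip \<rho> b)\<bar> \<le> L * \<bar>a - b\<bar>" for a b
    using C2_derivatives(2)[OF f] \<rho> L0 L by (rule clip_comp_lipschitz)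
  with L0 show ?thesis by (rule that)
qed

text \<open>
  The field is only locally Lipschitz, but two given solutions are bounded and both solve the equation with forces clipped
  outside their common range.
\<close>

lemma lattice_solution_unique:
  assumes p: "1 \<le> p" and V: "C2 V" and \<phi>: "C2 \<phi>" and \<phi>0: "deriv \<phi> 0 = 0"
    and X: "lp_solution p (lattice_field (deriv V) (deriv \<phi>)) X0 S X"
    and Y: "lp_solution p (lattice_field (deriv V) (deriv \<phi>)) X0 S Y" and t: "t \<in> {0..S}"
  shows "Y t = X t"
proof -
  obtain M where M: "\<And>t n. t \<in> {0..S} \<Longrightarrow> norm (X t n) \<le> M" using lp_solution_bounded[OF p X] by blast
  obtain M' where M': "\<And>t n. t \<in> {0..S} \<Longrightarrow> norm (Y t n) \<le> M'" using lp_solution_bounded[OF p Y] by blast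
  define \<rho> where "\<rho> = 2 * max M M'"
  have "0 \<le> M" using M[OF t, of 0] norm_ge_zero order_trans by blast
  then have \<rho>: "0 \<le> \<rho>" by (simp add: \<rho>_def)
  let ?f = "lattice_field (\<lambda>r. deriv V (clip \<rho> r)) (\<lambda>r. deriv \<phi> (clip \<rho> r))"
  obtain L where L: "0 \<le> L" "\<And>a b. \<bar>deriv V (clip \<rho> a) - deriv V (clip \<rho> b)\<bar> \<le> L * \<bar>a - b\<bar>"
    using C2_clip_lipschitz[OF V \<rho>] by blast
  obtain L' where L': "0 \<le> L'" "\<And>a b. \<bar>deriv \<phi> (clip \<rho> a) - deriv \<phi> (clip \<rho> b)\<bar> \<le> L' * \<bar>a - b\<bar>"
    using C2_clip_lipschitz[OF \<phi> \<rho>] by blast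
  have lip: "nbr_lipschitz (1 + 3 * max L L') ?f"
  proof (rule nbr_lipschitz_lattice_field)
    show "\<bar>deriv V (clip \<rho> a) - deriv V (clip \<rho> b)\<bar> \<le> max L L' * \<bar>a - b\<bar>" for a b
      using L(2)[of a b] mult_right_mono[of L "max L L'" "\<bar>a - b\<bar>"] by simp
    show "\<bar>deriv \<phi> (clip \<rho> a) - deriv \<phi> (clip \<rho> b)\<bar> \<le> max L L' * \<bar>a - b\<bar>" for a b
      using L'(2)[of a b] mult_right_mono[of L' "max L L'" "\<bar>a - b\<bar>"] by simp
    show "deriv \<phi> (clip \<rho> 0) = 0" using \<phi>0 \<rho> by (simp add: clip_eq)
  qed (use L in simp)
  have "lp_solution p ?f X0 S X"
  proof (rule lp_solution_cong[OF X], rule lattice_field_clip[symmetric])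
    show "\<bar>fst (X t n)\<bar> \<le> M" if "t \<in> {0..S}" for t n using M[OF that, of n] norm_le_Pair(1)[of "X t n"] by linarith
  qed (simp add: \<rho>_def)
  moreover have "lp_solution p ?f X0 S Y"
  proof (rule lp_solution_cong[OF Y], rule lattice_field_clip[symmetric])
    show "\<bar>fst (Y t n)\<bar> \<le> M'" if "t \<in> {0..S}" for t n using M'[OF that, of n] norm_le_Pair(1)[of "Y t n"] by linarith
  qed (simp add: \<rho>_def)
  ultimately show ?thesis using lp_solution_unique[OF p lip _ _ t] by metis
qed

section \<open>The breather in the rotating frame\<close>

lemma hom_force_scale:
  assumes "0 < s"
  shows "hom_force \<alpha> k_minus k_plus (s * c * r) = s powr \<alpha> *
    ((k_plus - k_minus) / 2 * \<bar>c\<bar> powr \<alpha> * \<bar>r\<bar> powr \<alpha>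
     + (k_plus + k_minus) / 2 * (c * \<bar>c\<bar> powr (\<alpha> - 1)) * (r * \<bar>r\<bar> powr (\<alpha> - 1)))"
proof -
  have "s * s powr (\<alpha> - 1) = s powr \<alpha>" using assms powr_mult_base[of s "\<alpha> - 1"] by simp
  moreover have "\<bar>s * c * r\<bar> powr a = s powr a * \<bar>c\<bar> powr a * \<bar>r\<bar> powr a" for a
    using assms by (simp add: abs_mult powr_mult)
  moreover have "(s * c * r) * (s powr (\<alpha> - 1) * \<bar>c\<bar> powr (\<alpha> - 1) * \<bar>r\<bar> powr (\<alpha> - 1))
     = (s * s powr (\<alpha> - 1)) * (c * \<bar>c\<bar> powr (\<alpha> - 1)) * (r * \<bar>r\<bar> powr (\<alpha> - 1))"
    by (simp only: mult_ac)
  ultimately show ?thesis unfolding hom_force_def by (simp only: distrib_left mult_ac)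
qed

text \<open>
  By homogeneity, time and space separate up to the splitting into the even and odd part. The spatial factor of the
  odd part is the discrete Laplacian of \<open>v\<close>, that is \<open>-v\<close>.
\<close>

lemma hom_force_breather:
  assumes s: "0 < s" and v: "\<And>n. v n = - discrete_laplacian \<alpha> v n"
  shows "hom_force \<alpha> k_minus k_plus (s * c * (v (n + 1) - v n))
      - hom_force \<alpha> k_minus k_plus (s * c * (v n - v (n - 1)))
    = s powr \<alpha> * ((k_plus - k_minus) / 2 * \<bar>c\<bar> powr \<alpha> * (\<bar>v (n + 1) - v n\<bar> powr \<alpha> - \<bar>v n - v (n - 1)\<bar> powr \<alpha>)
       - (k_plus + k_minus) / 2 * (c * \<bar>c\<bar> powr (\<alpha> - 1)) * v n)"
proof -
  let ?D = "(v (n + 1) - v n) * \<bar>v (n + 1) - v n\<bar> powr (\<alpha> - 1)"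
  let ?D' = "(v n - v (n - 1)) * \<bar>v n - v (n - 1)\<bar> powr (\<alpha> - 1)"
  have alg: "S * (A * p + B * X) - S * (A * q + B * Y) = S * (A * (p - q) - B * z)"
    if "X - Y = - z" for S A B p q X Y z :: real
  proof -
    have "S * (A * p + B * X) - S * (A * q + B * Y) = S * (A * (p - q) + B * (X - Y))"
      by (simp add: algebra_simps)
    then show ?thesis using that by simp
  qed
  have "?D - ?D' = - v n" using v[of n] by (simp add: discrete_laplacian_def)
  then show ?thesis unfolding hom_force_scale[OF s] by (rule alg)
qed

text \<open>
  Here \<open>\<omega>\<^sub>0\<close> is identified: it makes the detuning of the breather balance the first harmonic of the odd part of the force.
\<close>

lemma omega0_scale:
  assumes "0 < \<epsilon>"
  shows "omega0 \<alpha> k_minus k_plus * \<epsilon> powr (\<alpha> - 1) * (sqrt 2 * \<epsilon>)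
    = (sqrt 2 * \<epsilon>) powr \<alpha> * ((k_plus + k_minus) / 2 * cos_mean \<alpha>)"
proof -
  have two: "2 powr ((\<alpha> - 3) / 2) * sqrt 2 = 2 powr (\<alpha> / 2) / 2"
  proof -
    have "2 powr ((\<alpha> - 3) / 2) * sqrt 2 = 2 powr ((\<alpha> - 3) / 2) * 2 powr (1 / 2)"
      by (simp add: powr_half_sqrt)
    also have "\<dots> = 2 powr ((\<alpha> - 3) / 2 + 1 / 2)" by (rule powr_add[symmetric])
    also have "(\<alpha> - 3) / 2 + 1 / 2 = \<alpha> / 2 - 1" by (simp add: field_simps)
    finally show ?thesis by (simp add: powr_diff)
  qed
  have amp: "(sqrt 2 * \<epsilon>) powr \<alpha> = 2 powr (\<alpha> / 2) * \<epsilon> powr \<alpha>"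
  proof -
    have "sqrt 2 powr \<alpha> = (2 powr (1 / 2)) powr \<alpha>" by (simp add: powr_half_sqrt)
    also have "\<dots> = 2 powr (\<alpha> / 2)" by (simp add: powr_powr)
    finally show ?thesis using assms by (simp add: powr_mult)
  qed
  have eps: "\<epsilon> powr (\<alpha> - 1) * \<epsilon> = \<epsilon> powr \<alpha>"
    using assms powr_mult_base[of \<epsilon> "\<alpha> - 1"] by (simp add: mult.commute)
  have "omega0 \<alpha> k_minus k_plus * \<epsilon> powr (\<alpha> - 1) * (sqrt 2 * \<epsilon>)
      = (k_minus + k_plus) * cos_mean \<alpha> * (2 powr ((\<alpha> - 3) / 2) * sqrt 2) * (\<epsilon> powr (\<alpha> - 1) * \<epsilon>)"
    unfolding omega0_def cos_mean_def[symmetric] by (simp only: mult_ac)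
  also have "\<dots> = (sqrt 2 * \<epsilon>) powr \<alpha> * ((k_plus + k_minus) / 2 * cos_mean \<alpha>)"
    unfolding two amp eps by (simp add: field_simps)
  finally show ?thesis .
qed

text \<open>
  \<open>e\<^bsup>-J\<Omega>t\<^esup> X(t) - \<surd>2 \<epsilon> (v, 0)\<close>, the difference to the breather in the frame in which the breather is at rest.
\<close>

definition rotating_error :: "real \<Rightarrow> real \<Rightarrow> (int \<Rightarrow> real) \<Rightarrow> (real \<Rightarrow> int \<Rightarrow> real \<times> real) \<Rightarrow> real \<Rightarrow> int \<Rightarrow> real \<times> real" where
  "rotating_error \<epsilon> \<Omega> v X t n =
     (fst (X t n) * cos (\<Omega> * t) - snd (X t n) * sin (\<Omega> * t) - sqrt 2 * \<epsilon> * v n,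
      fst (X t n) * sin (\<Omega> * t) + snd (X t n) * cos (\<Omega> * t))"

lemma norm_rotating_error:
  "norm (rotating_error \<epsilon> \<Omega> v X t n) = norm (X t n - breather \<epsilon> \<Omega> v t n)"
proof -
  obtain x y where X: "X t n = (x, y)" by (cases "X t n")
  define c s w where "c = cos (\<Omega> * t)" and "s = sin (\<Omega> * t)" and "w = sqrt 2 * \<epsilon> * v n"
  have cs: "c\<^sup>2 + s\<^sup>2 = 1" by (simp add: c_def s_def add.commute)
  have "(x * c - y * s - w)\<^sup>2 + (x * s + y * c)\<^sup>2 = (x\<^sup>2 + y\<^sup>2) * (c\<^sup>2 + s\<^sup>2) - 2 * w * (x * c - y * s) + w\<^sup>2"
    by (simp add: power2_eq_square algebra_simps)
  also have "\<dots> = (x\<^sup>2 + y\<^sup>2) - 2 * w * (x * c - y * s) + w\<^sup>2 * (c\<^sup>2 + s\<^sup>2)" by (simp add: cs)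
  also have "\<dots> = (x - w * c)\<^sup>2 + (y + w * s)\<^sup>2" by (simp add: power2_eq_square algebra_simps)
  finally have "sqrt ((x * c - y * s - w)\<^sup>2 + (x * s + y * c)\<^sup>2) = sqrt ((x - w * c)\<^sup>2 + (y + w * s)\<^sup>2)" by simp
  then show ?thesis
    by (simp add: rotating_error_def breather_def X norm_Pair c_def s_def w_def mult_ac)
qed

lemma rotating_error_derivative:
  assumes X: "((\<lambda>t. X t n) has_vector_derivative (snd (X t n), - fst (X t n) + F)) (at t within I)"
  shows "((\<lambda>t. rotating_error \<epsilon> \<Omega> v X t n) has_vector_derivative
    (- (\<Omega> - 1) * snd (rotating_error \<epsilon> \<Omega> v X t n) - F * sin (\<Omega> * t),
     (\<Omega> - 1) * (fst (rotating_error \<epsilon> \<Omega> v X t n) + sqrt 2 * \<epsilon> * v n) + F * cos (\<Omega> * t))) (at t within I)"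
proof -
  have x: "((\<lambda>t. fst (X t n)) has_real_derivative snd (X t n)) (at t within I)"
    using bounded_linear.has_vector_derivative[OF bounded_linear_fst X]
    by (simp add: has_real_derivative_iff_has_vector_derivative)
  have y: "((\<lambda>t. snd (X t n)) has_real_derivative - fst (X t n) + F) (at t within I)"
    using bounded_linear.has_vector_derivative[OF bounded_linear_snd X]
    by (simp add: has_real_derivative_iff_has_vector_derivative)
  show ?thesis
    unfolding rotating_error_def
  proof (rule has_vector_derivative_Pair)
    show "((\<lambda>t. fst (X t n) * cos (\<Omega> * t) - snd (X t n) * sin (\<Omega> * t) - sqrt 2 * \<epsilon> * v n) has_vector_derivative
        - (\<Omega> - 1) * snd (fst (X t n) * cos (\<Omega> * t) - snd (X t n) * sin (\<Omega> * t) - sqrt 2 * \<epsilon> * v n,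
            fst (X t n) * sin (\<Omega> * t) + snd (X t n) * cos (\<Omega> * t)) - F * sin (\<Omega> * t)) (at t within I)"
      unfolding has_real_derivative_iff_has_vector_derivative[symmetric]
      by (rule derivative_eq_intros x y refl)+ (simp add: algebra_simps)
    show "((\<lambda>t. fst (X t n) * sin (\<Omega> * t) + snd (X t n) * cos (\<Omega> * t)) has_vector_derivative
        (\<Omega> - 1) * (fst (fst (X t n) * cos (\<Omega> * t) - snd (X t n) * sin (\<Omega> * t) - sqrt 2 * \<epsilon> * v n,
            fst (X t n) * sin (\<Omega> * t) + snd (X t n) * cos (\<Omega> * t)) + sqrt 2 * \<epsilon> * v n) + F * cos (\<Omega> * t)) (at t within I)"
      unfolding has_real_derivative_iff_has_vector_derivative[symmetric]
      by (rule derivative_eq_intros x y refl)+ (simp add: algebra_simps)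
  qed
qed

text \<open>
  On the breather, the force differs from the homogeneous one only by the relative error \<open>\<delta>\<close> of the force functions.
\<close>

lemma breather_residual:
  fixes v :: "int \<Rightarrow> real"
  assumes s: "0 < s" and c: "\<bar>c\<bar> \<le> 1" and \<delta>: "0 \<le> \<delta>"
    and vm: "\<And>n. \<bar>v n\<bar> \<le> m" and v: "\<And>n. v n = - discrete_laplacian \<alpha> v n"
    and consU: "\<And>r. \<bar>r\<bar> \<le> 2 * (s * m) \<Longrightarrow> \<bar>U r - hom_force \<alpha> k_minus k_plus r\<bar> \<le> \<delta> * \<bar>r\<bar>"
    and cons\<psi>: "\<And>r. \<bar>r\<bar> \<le> s * m \<Longrightarrow> \<bar>\<psi> r\<bar> \<le> \<delta> * \<bar>r\<bar>"
  shows "\<bar>lattice_force U \<psi> (\<lambda>n. s * c * v n) n - s powr \<alpha> *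
      ((k_plus - k_minus) / 2 * \<bar>c\<bar> powr \<alpha> * (\<bar>v (n + 1) - v n\<bar> powr \<alpha> - \<bar>v n - v (n - 1)\<bar> powr \<alpha>)
       - (k_plus + k_minus) / 2 * (c * \<bar>c\<bar> powr (\<alpha> - 1)) * v n)\<bar>
    \<le> 3 * \<delta> * s * nbr_sum (\<lambda>n. \<bar>v n\<bar>) n"
proof -
  let ?h = "hom_force \<alpha> k_minus k_plus"
  have sc: "\<bar>s * c * r\<bar> \<le> s * \<bar>r\<bar>" for r
    using s c mult_right_mono[of "s * \<bar>c\<bar>" s "\<bar>r\<bar>"] by (simp add: abs_mult mult_left_le)
  have U: "\<bar>U (s * c * (v (k + 1) - v k)) - ?h (s * c * (v (k + 1) - v k))\<bar> \<le> \<delta> * (s * (\<bar>v (k + 1)\<bar> + \<bar>v k\<bar>))" for k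
  proof -
    have r: "\<bar>s * c * (v (k + 1) - v k)\<bar> \<le> s * (\<bar>v (k + 1)\<bar> + \<bar>v k\<bar>)"
      using sc[of "v (k + 1) - v k"] s mult_left_mono[OF abs_triangle_ineq4[of "v (k + 1)" "v k"], of s] by linarith
    also have "\<dots> \<le> s * (m + m)" using vm s by (intro mult_left_mono add_mono) auto
    finally have "\<bar>s * c * (v (k + 1) - v k)\<bar> \<le> 2 * (s * m)" by simp
    from consU[OF this] show ?thesis using mult_left_mono[OF r \<delta>] by linarith
  qed
  have U': "\<bar>U (s * c * (v n - v (n - 1))) - ?h (s * c * (v n - v (n - 1)))\<bar> \<le> \<delta> * (s * (\<bar>v n\<bar> + \<bar>v (n - 1)\<bar>))"
    using U[of "n - 1"] by simp
  have \<psi>: "\<bar>\<psi> (s * c * v n)\<bar> \<le> \<delta> * (s * \<bar>v n\<bar>)"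
  proof -
    have "\<bar>s * c * v n\<bar> \<le> s * m" using sc[of "v n"] mult_left_mono[OF vm[of n], of s] s by linarith
    from cons\<psi>[OF this] show ?thesis using mult_left_mono[OF sc[of "v n"] \<delta>] by linarith
  qed
  have "lattice_force U \<psi> (\<lambda>n. s * c * v n) n - (?h (s * c * (v (n + 1) - v n)) - ?h (s * c * (v n - v (n - 1))))
     = (U (s * c * (v (n + 1) - v n)) - ?h (s * c * (v (n + 1) - v n)))
       - (U (s * c * (v n - v (n - 1))) - ?h (s * c * (v n - v (n - 1)))) - \<psi> (s * c * v n)"
    by (simp add: lattice_force_def right_diff_distrib)
  then have "\<bar>lattice_force U \<psi> (\<lambda>n. s * c * v n) n - (?h (s * c * (v (n + 1) - v n)) - ?h (s * c * (v n - v (n - 1))))\<bar>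
     \<le> \<delta> * (s * (\<bar>v (n + 1)\<bar> + \<bar>v n\<bar>)) + \<delta> * (s * (\<bar>v n\<bar> + \<bar>v (n - 1)\<bar>)) + \<delta> * (s * \<bar>v n\<bar>)"
    using U[of n] U' \<psi> by linarith
  also have "\<dots> = (\<delta> * s) * (\<bar>v (n + 1)\<bar> + 3 * \<bar>v n\<bar> + \<bar>v (n - 1)\<bar>)" by (simp add: algebra_simps)
  also have "\<dots> \<le> (\<delta> * s) * (3 * nbr_sum (\<lambda>n. \<bar>v n\<bar>) n)"
    using s \<delta> by (intro mult_left_mono) (auto simp: nbr_sum_def)
  finally show ?thesis unfolding hom_force_breather[OF s v] by (simp add: mult_ac)
qed

text \<open>
  The corrector \<open>P\<close> is the antiderivative in time of the mean-zero forcing. Since its integrand depends on \<open>\<Omega> t\<close>, it has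
  the size of the forcing divided by \<open>\<Omega> \<ge> 1/2\<close>, uniformly in time. The derivative of
  \<open>E - P\<close> then contains the error itself with the factors \<open>|\<Omega> - 1|\<close> and \<open>3L\<close>, and the residual. The constants
  \<open>K\<close> and \<open>B\<close> measure the corrector in space and in the phase.
\<close>

lemma breather_error_estimate:
  fixes v :: "int \<Rightarrow> real"
  assumes \<alpha>: "1 < \<alpha>" and p: "1 \<le> p" and \<epsilon>: "0 < \<epsilon>" and \<delta>: "0 \<le> \<delta>" and L: "0 \<le> L" and S: "0 \<le> S"
    and vm: "\<And>n. \<bar>v n\<bar> \<le> m" and v: "\<And>n. v n = - discrete_laplacian \<alpha> v n"
    and Nv: "lp_bound p v Nv"
    and U: "\<And>a b. \<bar>U a - U b\<bar> \<le> L * \<bar>a - b\<bar>" and \<psi>: "\<And>a b. \<bar>\<psi> a - \<psi> b\<bar> \<le> L * \<bar>a - b\<bar>"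
    and consU: "\<And>r. \<bar>r\<bar> \<le> 2 * (sqrt 2 * \<epsilon> * m) \<Longrightarrow> \<bar>U r - hom_force \<alpha> k_minus k_plus r\<bar> \<le> \<delta> * \<bar>r\<bar>"
    and cons\<psi>: "\<And>r. \<bar>r\<bar> \<le> sqrt 2 * \<epsilon> * m \<Longrightarrow> \<bar>\<psi> r\<bar> \<le> \<delta> * \<bar>r\<bar>"
    and \<Omega>: "\<Omega> = 1 + omega0 \<alpha> k_minus k_plus * \<epsilon> powr (\<alpha> - 1)" "1 / 2 \<le> \<Omega>"
    and X: "lp_solution p (lattice_field U \<psi>) X0 S X"
    and I0: "lp_bound p (\<lambda>n. X0 n - (sqrt 2 * \<epsilon> * v n, 0)) I0"
    and H1: "\<And>x. (H1 has_real_derivative \<bar>cos x\<bar> powr \<alpha> * sin x) (at x)" "\<And>x. \<bar>H1 x\<bar> \<le> B"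
    and H2: "\<And>x. (H2 has_real_derivative cos x * \<bar>cos x\<bar> powr (\<alpha> - 1) * sin x) (at x)" "\<And>x. \<bar>H2 x\<bar> \<le> B"
    and H3: "\<And>x. (H3 has_real_derivative \<bar>cos x\<bar> powr \<alpha> * cos x) (at x)" "\<And>x. \<bar>H3 x\<bar> \<le> B"
    and H4: "\<And>x. (H4 has_real_derivative \<bar>cos x\<bar> powr (\<alpha> + 1) - cos_mean \<alpha>) (at x)" "\<And>x. \<bar>H4 x\<bar> \<le> B"
    and K: "K = \<bar>(k_plus - k_minus) / 2\<bar> * (2 * (2 * m) powr (\<alpha> - 1)) + \<bar>(k_plus + k_minus) / 2\<bar>"
    and t: "t \<in> {0..S}"
  shows "lp_bound p (\<lambda>n. X t n - breather \<epsilon> \<Omega> v t n)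
    (exp (3 * (\<bar>\<Omega> - 1\<bar> + 3 * L) * S) * (I0 + (8 * (sqrt 2 * \<epsilon>) powr \<alpha> * K * B + S * (3 * \<delta> * (sqrt 2 * \<epsilon>))) * (3 * Nv)))"
proof -
  define s0 where "s0 = sqrt 2 * \<epsilon>"
  define \<sigma>' where "\<sigma>' = s0 powr \<alpha>"
  define ke ko where "ke = (k_plus - k_minus) / 2" and "ko = (k_plus + k_minus) / 2"
  define w where "w = nbr_sum (\<lambda>n. \<bar>v n\<bar>)"
  define q where "q n = \<bar>v (n + 1) - v n\<bar> powr \<alpha> - \<bar>v n - v (n - 1)\<bar> powr \<alpha>" for n
  define E where "E = rotating_error \<epsilon> \<Omega> v X"
  define F where "F t n = lattice_force U \<psi> (fst \<circ> X t) n" for t n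
  define A where "A t n = (let c = cos (\<Omega> * t) in
    \<sigma>' * (ke * \<bar>c\<bar> powr \<alpha> * q n - ko * (c * \<bar>c\<bar> powr (\<alpha> - 1)) * v n))" for t n
  define P where "P t n = (\<sigma>' / \<Omega> * (- (ke * q n) * H1 (\<Omega> * t) + ko * v n * H2 (\<Omega> * t)),
    \<sigma>' / \<Omega> * (ke * q n * H3 (\<Omega> * t) - ko * v n * H4 (\<Omega> * t)))" for t n
  define Z' where "Z' t n = (- (\<Omega> - 1) * snd (E t n) - (F t n - A t n) * sin (\<Omega> * t),
    (\<Omega> - 1) * fst (E t n) + (F t n - A t n) * cos (\<Omega> * t))" for t n
  have s0: "0 < s0" using \<epsilon> by (simp add: s0_def)
  have \<sigma>': "0 \<le> \<sigma>'" by (simp add: \<sigma>'_def)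
  have m: "0 \<le> m" using vm[of 0] by linarith
  have w0: "0 \<le> w n" for n by (simp add: w_def nbr_sum_nonneg)
  have vw: "\<bar>v n\<bar> \<le> w n" for n by (simp add: w_def nbr_sum_def)
  have B: "0 \<le> B" using H1(2)[of 0] by linarith
  have K0: "0 \<le> K" unfolding K by simp
  have \<Omega>0: "\<Omega> \<noteq> 0" using \<Omega>(2) by auto

  have qw: "\<bar>q n\<bar> \<le> 2 * (2 * m) powr (\<alpha> - 1) * w n" for n
  proof -
    have b: "\<bar>v (k + 1) - v k\<bar> powr \<alpha> \<le> (2 * m) powr (\<alpha> - 1) * (\<bar>v (k + 1)\<bar> + \<bar>v k\<bar>)" for k
    proof -
      have "\<bar>v (k + 1) - v k\<bar> powr \<alpha> \<le> (2 * m) powr (\<alpha> - 1) * \<bar>v (k + 1) - v k\<bar>"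
        using vm[of k] vm[of "k + 1"] \<alpha> by (intro abs_powr_le_linear) auto
      also have "\<dots> \<le> (2 * m) powr (\<alpha> - 1) * (\<bar>v (k + 1)\<bar> + \<bar>v k\<bar>)" by (intro mult_left_mono) auto
      finally show ?thesis .
    qed
    have "\<bar>q n\<bar> \<le> \<bar>v (n + 1) - v n\<bar> powr \<alpha> + \<bar>v n - v (n - 1)\<bar> powr \<alpha>"
      unfolding q_def using abs_triangle_ineq4[of "\<bar>v (n + 1) - v n\<bar> powr \<alpha>" "\<bar>v n - v (n - 1)\<bar> powr \<alpha>"] by simp
    also have "\<dots> \<le> (2 * m) powr (\<alpha> - 1) * (\<bar>v (n + 1)\<bar> + \<bar>v n\<bar>) + (2 * m) powr (\<alpha> - 1) * (\<bar>v n\<bar> + \<bar>v (n - 1)\<bar>)"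
      using b[of n] b[of "n - 1"] by simp
    also have "\<dots> = (2 * m) powr (\<alpha> - 1) * (\<bar>v (n + 1)\<bar> + 2 * \<bar>v n\<bar> + \<bar>v (n - 1)\<bar>)"
      by (simp add: algebra_simps)
    also have "\<dots> \<le> (2 * m) powr (\<alpha> - 1) * (2 * w n)" by (intro mult_left_mono) (auto simp: w_def nbr_sum_def)
    finally show ?thesis by simp
  qed
  have comp: "\<bar>\<sigma>' / \<Omega> * (ke * q n * x + ko * v n * y)\<bar> \<le> 2 * \<sigma>' * K * B * w n"
    if "\<bar>x\<bar> \<le> B" "\<bar>y\<bar> \<le> B" for n x y
  proof -
    have "\<bar>ke * q n * x + ko * v n * y\<bar> \<le> \<bar>ke\<bar> * \<bar>q n\<bar> * \<bar>x\<bar> + \<bar>ko\<bar> * \<bar>v n\<bar> * \<bar>y\<bar>"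
      using abs_triangle_ineq[of "ke * q n * x" "ko * v n * y"] by (simp add: abs_mult)
    also have "\<dots> \<le> \<bar>ke\<bar> * (2 * (2 * m) powr (\<alpha> - 1) * w n) * B + \<bar>ko\<bar> * w n * B"
      using that qw[of n] vw[of n] w0[of n] B by (intro add_mono mult_mono) auto
    also have "\<dots> = K * B * w n" by (simp add: K ke_def ko_def algebra_simps)
    finally have "\<bar>\<sigma>' / \<Omega> * (ke * q n * x + ko * v n * y)\<bar> \<le> \<bar>\<sigma>' / \<Omega>\<bar> * (K * B * w n)"
      unfolding abs_mult[of "\<sigma>' / \<Omega>"] by (rule mult_left_mono) simp
    also have "\<bar>\<sigma>' / \<Omega>\<bar> \<le> \<sigma>' / (1 / 2)"
      using \<Omega>(2) \<sigma>' by (simp add: abs_divide) (intro divide_left_mono[of "1/2" \<Omega> \<sigma>', simplified], auto)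
    finally show ?thesis using K0 B w0[of n] by (simp add: mult_right_mono mult_ac)
  qed
  have P_bound: "norm (P t n) \<le> 4 * \<sigma>' * K * B * w n" for t n
  proof -
    have "\<bar>fst (P t n)\<bar> \<le> 2 * \<sigma>' * K * B * w n"
      using comp[of "- H1 (\<Omega> * t)" "H2 (\<Omega> * t)" n] H1(2) H2(2) by (simp add: P_def)
    moreover have "\<bar>snd (P t n)\<bar> \<le> 2 * \<sigma>' * K * B * w n"
      using comp[of "H3 (\<Omega> * t)" "- H4 (\<Omega> * t)" n] H3(2) H4(2) by (simp add: P_def)
    moreover have "norm (P t n) \<le> \<bar>fst (P t n)\<bar> + \<bar>snd (P t n)\<bar>"
      using norm_Pair_le[of "fst (P t n)" "snd (P t n)"] by simp
    ultimately show ?thesis by linarith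
  qed

  have Z_deriv: "((\<lambda>t. E t n - P t n) has_vector_derivative Z' t n) (at t within {0..S})"
    if t: "t \<in> {0..S}" for t n
  proof -
    define c s where "c = cos (\<Omega> * t)" and "s = sin (\<Omega> * t)"
    have "((\<lambda>t. X t n) has_vector_derivative lattice_field U \<psi> (X t) n) (at t within {0..S})"
      by (rule lp_solution_component[OF p X t])
    then have Ed: "((\<lambda>t. E t n) has_vector_derivative
      (- (\<Omega> - 1) * snd (E t n) - F t n * s, (\<Omega> - 1) * (fst (E t n) + s0 * v n) + F t n * c)) (at t within {0..S})"
      unfolding E_def s0_def c_def s_def lattice_field_def F_def by (rule rotating_error_derivative)
    have chain: "((\<lambda>t. H (\<Omega> * t)) has_real_derivative h (\<Omega> * t) * \<Omega>) (at t within {0..S})"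
      if "\<And>x. (H has_real_derivative h x) (at x)" for H h
    proof -
      have "((\<lambda>t. \<Omega> * t) has_real_derivative \<Omega>) (at t within {0..S})"
        using DERIV_cmult_Id by (rule has_field_derivative_at_within)
      from DERIV_chain2[OF that this] show ?thesis .
    qed
    have rescale: "\<sigma>' / \<Omega> * (a * (h * \<Omega>) + b * (k * \<Omega>)) = \<sigma>' * (a * h + b * k)"
      "\<sigma>' / \<Omega> * (a * (h * \<Omega>) - b * (k * \<Omega>)) = \<sigma>' * (a * h - b * k)" for a b h k
      using \<Omega>0 by (simp_all add: field_simps)
    have P1: "((\<lambda>t. \<sigma>' / \<Omega> * (- (ke * q n) * H1 (\<Omega> * t) + ko * v n * H2 (\<Omega> * t))) has_real_derivative
        \<sigma>' * (- (ke * q n) * (\<bar>c\<bar> powr \<alpha> * s) + ko * v n * (c * \<bar>c\<bar> powr (\<alpha> - 1) * s))) (at t within {0..S})"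
      using DERIV_cmult[OF DERIV_add[OF DERIV_cmult[OF chain[OF H1(1)], of "- (ke * q n)"]
            DERIV_cmult[OF chain[OF H2(1)], of "ko * v n"]], of "\<sigma>' / \<Omega>"]
      unfolding rescale c_def s_def .
    have P2: "((\<lambda>t. \<sigma>' / \<Omega> * (ke * q n * H3 (\<Omega> * t) - ko * v n * H4 (\<Omega> * t))) has_real_derivative
        \<sigma>' * (ke * q n * (\<bar>c\<bar> powr \<alpha> * c) - ko * v n * (\<bar>c\<bar> powr (\<alpha> + 1) - cos_mean \<alpha>))) (at t within {0..S})"
      using DERIV_cmult[OF DERIV_diff[OF DERIV_cmult[OF chain[OF H3(1)], of "ke * q n"]
            DERIV_cmult[OF chain[OF H4(1)], of "ko * v n"]], of "\<sigma>' / \<Omega>"]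
      unfolding rescale c_def s_def .
    have Pd: "((\<lambda>t. P t n) has_vector_derivative
       (\<sigma>' * (- (ke * q n) * (\<bar>c\<bar> powr \<alpha> * s) + ko * v n * (c * \<bar>c\<bar> powr (\<alpha> - 1) * s)),
        \<sigma>' * (ke * q n * (\<bar>c\<bar> powr \<alpha> * c) - ko * v n * (\<bar>c\<bar> powr (\<alpha> + 1) - cos_mean \<alpha>)))) (at t within {0..S})"
      unfolding P_def using P1 P2
      by (intro has_vector_derivative_Pair) (simp_all only: has_real_derivative_iff_has_vector_derivative)
    \<comment> \<open>the only place where the value of \<open>\<omega>\<^sub>0\<close> matters: the forcing in the second component has mean zero\<close>
    have om: "(\<Omega> - 1) * s0 = \<sigma>' * (ko * cos_mean \<alpha>)"
      unfolding \<Omega>(1) s0_def \<sigma>'_def ko_def using omega0_scale[OF \<epsilon>] by simp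
    have cc: "\<bar>c\<bar> powr (\<alpha> + 1) = c * (c * \<bar>c\<bar> powr (\<alpha> - 1))"
    proof -
      have "\<bar>c\<bar> powr (\<alpha> + 1) = \<bar>c\<bar> * (\<bar>c\<bar> * \<bar>c\<bar> powr (\<alpha> - 1))"
        using powr_mult_base[of "\<bar>c\<bar>" \<alpha>] powr_mult_base[of "\<bar>c\<bar>" "\<alpha> - 1"] by (simp add: add.commute)
      then show ?thesis by (simp add: mult.assoc[symmetric])
    qed
    have A: "A t n = \<sigma>' * (ke * \<bar>c\<bar> powr \<alpha> * q n - ko * (c * \<bar>c\<bar> powr (\<alpha> - 1)) * v n)"
      by (simp add: A_def c_def Let_def)
    have e1: "(- (\<Omega> - 1) * e2 - f * s) - \<sigma>' * (- (ke * q n) * (\<bar>c\<bar> powr \<alpha> * s) + ko * v n * (c * \<bar>c\<bar> powr (\<alpha> - 1) * s))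
        = - (\<Omega> - 1) * e2 - (f - A t n) * s" for e2 f
      unfolding A by (simp add: algebra_simps)
    have e2: "((\<Omega> - 1) * (e1 + s0 * v n) + f * c)
          - \<sigma>' * (ke * q n * (\<bar>c\<bar> powr \<alpha> * c) - ko * v n * (\<bar>c\<bar> powr (\<alpha> + 1) - cos_mean \<alpha>))
        = (\<Omega> - 1) * e1 + (f - A t n) * c" for e1 f
    proof -
      have "(\<Omega> - 1) * (e1 + s0 * v n) = (\<Omega> - 1) * e1 + \<sigma>' * (ko * cos_mean \<alpha>) * v n"
        unfolding om[symmetric] by (simp add: algebra_simps)
      then show ?thesis unfolding A cc by (simp add: algebra_simps)
    qed
    show ?thesis
      using has_vector_derivative_diff[OF Ed Pd] unfolding Z'_def
      by (simp only: diff_Pair e1 e2 c_def[symmetric] s_def[symmetric])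
  qed

  have Z'_bound: "norm (Z' t n) \<le> (\<bar>\<Omega> - 1\<bar> + 3 * L) * nbr_sum (\<lambda>n. norm (E t n)) n + 3 * \<delta> * s0 * w n"
    for t n
  proof -
    define c s where "c = cos (\<Omega> * t)" and "s = sin (\<Omega> * t)"
    have cs: "c\<^sup>2 + s\<^sup>2 = 1" by (simp add: c_def s_def add.commute)
    define G where "G = F t n - A t n"
    have Z'_eq: "Z' t n = (\<Omega> - 1) *\<^sub>R (- snd (E t n), fst (E t n)) + G *\<^sub>R (- s, c)"
      by (simp add: Z'_def G_def c_def s_def algebra_simps)
    have "norm (Z' t n) \<le> \<bar>\<Omega> - 1\<bar> * norm (- snd (E t n), fst (E t n)) + \<bar>G\<bar> * norm (- s, c)"
      unfolding Z'_eq norm_scaleR[symmetric] by (rule norm_triangle_ineq)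
    moreover have "norm (- snd (E t n), fst (E t n)) = norm (E t n)"
      by (cases "E t n") (simp add: norm_Pair add.commute)
    moreover have "norm (- s, c) = 1" using cs by (simp add: norm_Pair add.commute)
    moreover have "\<bar>G\<bar> \<le> 3 * L * nbr_sum (\<lambda>n. norm (E t n)) n + 3 * \<delta> * s0 * w n"
    proof -
      have "\<bar>F t n - lattice_force U \<psi> (\<lambda>n. s0 * c * v n) n\<bar> \<le> 3 * L * nbr_sum (\<lambda>n. norm (E t n)) n"
        unfolding F_def
      proof (rule lattice_force_lipschitz[OF U \<psi> L])
        fix k
        have "\<bar>(fst \<circ> X t) k - s0 * c * v k\<bar> = \<bar>fst (X t k - breather \<epsilon> \<Omega> v t k)\<bar>"
          by (simp add: breather_def s0_def c_def mult_ac)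
        also have "\<dots> \<le> norm (E t k)" unfolding E_def norm_rotating_error by (rule norm_le_Pair)
        finally show "\<bar>(fst \<circ> X t) k - s0 * c * v k\<bar> \<le> norm (E t k)" .
      qed
      moreover have "\<bar>lattice_force U \<psi> (\<lambda>n. s0 * c * v n) n - A t n\<bar> \<le> 3 * \<delta> * s0 * w n"
        unfolding A_def Let_def c_def[symmetric] \<sigma>'_def ke_def ko_def q_def w_def
      proof (rule breather_residual[OF s0 _ \<delta> vm v])
        show "\<bar>c\<bar> \<le> 1" by (simp add: c_def)
        show "\<bar>U r - hom_force \<alpha> k_minus k_plus r\<bar> \<le> \<delta> * \<bar>r\<bar>" if "\<bar>r\<bar> \<le> 2 * (s0 * m)" for r
          using consU that by (simp add: s0_def)
        show "\<bar>\<psi> r\<bar> \<le> \<delta> * \<bar>r\<bar>" if "\<bar>r\<bar> \<le> s0 * m" for r using cons\<psi> that by (simp add: s0_def)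
      qed
      ultimately show ?thesis unfolding G_def by linarith
    qed
    moreover have "\<bar>\<Omega> - 1\<bar> * norm (E t n) \<le> \<bar>\<Omega> - 1\<bar> * nbr_sum (\<lambda>n. norm (E t n)) n"
      by (intro mult_left_mono) (auto simp: nbr_sum_def)
    ultimately show ?thesis by (simp add: distrib_right)
  qed

  define a where "a n = norm (X0 n - (sqrt 2 * \<epsilon> * v n, 0)) + 8 * \<sigma>' * K * B * w n" for n
  have E0: "E 0 n = X0 n - (sqrt 2 * \<epsilon> * v n, 0)" for n
    using X by (simp add: E_def rotating_error_def lp_solution_def prod_eq_iff)
  have E_le: "norm (E t n) \<le> a n + norm ((E t n - P t n) - (E 0 n - P 0 n))" for t n
  proof -
    define d where "d = (E t n - P t n) - (E 0 n - P 0 n)"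
    have "E t n = d + (P t n + (E 0 n - P 0 n))" by (simp add: d_def)
    then have "norm (E t n) \<le> norm d + norm (P t n + (E 0 n - P 0 n))" using norm_triangle_ineq by metis
    moreover have "norm (P t n + (E 0 n - P 0 n)) \<le> norm (P t n) + norm (E 0 n - P 0 n)"
      by (rule norm_triangle_ineq)
    moreover have "norm (E 0 n - P 0 n) \<le> norm (E 0 n) + norm (P 0 n)" by (rule norm_triangle_ineq4)
    moreover have "a n = norm (E 0 n) + 8 * \<sigma>' * K * B * w n" by (simp add: a_def E0)
    ultimately show ?thesis
      using P_bound[of t n] P_bound[of 0 n] unfolding d_def[symmetric] by linarith
  qed
  obtain M where M: "\<And>t n. t \<in> {0..S} \<Longrightarrow> norm (X t n) \<le> M" using lp_solution_bounded[OF p X] by blast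
  have E_bounded: "norm (E t n) \<le> M + s0 * (m + m)" if "t \<in> {0..S}" for t n
  proof -
    have "norm (breather \<epsilon> \<Omega> v t n) = s0 * norm (v n * cos (\<Omega> * t), - (v n * sin (\<Omega> * t)))"
      using \<epsilon> unfolding breather_def norm_scaleR s0_def by (simp only: abs_of_pos mult_pos_pos real_sqrt_gt_zero zero_less_numeral)
    also have "\<dots> \<le> s0 * (m + m)"
    proof (intro mult_left_mono order_trans[OF norm_Pair_le] add_mono)
      show "norm (v n * cos (\<Omega> * t)) \<le> m"
        using mult_mono[OF vm[of n] abs_cos_le_one[of "\<Omega> * t"]] m by (simp add: abs_mult)
      show "norm (- (v n * sin (\<Omega> * t))) \<le> m"
        using mult_mono[OF vm[of n] abs_sin_le_one[of "\<Omega> * t"]] m by (simp add: abs_mult)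
    qed (use s0 in simp)
    finally show ?thesis
      using M[OF that, of n] norm_triangle_ineq4[of "X t n" "breather \<epsilon> \<Omega> v t n"]
      unfolding E_def norm_rotating_error by linarith
  qed
  have Na: "lp_bound p (\<lambda>n. a n + S * (3 * \<delta> * s0 * w n)) (I0 + (8 * \<sigma>' * K * B + S * (3 * \<delta> * s0)) * (3 * Nv))"
  proof -
    let ?C = "8 * \<sigma>' * K * B + S * (3 * \<delta> * s0)"
    have C: "0 \<le> ?C" using \<sigma>' K0 B S \<delta> s0 by simp
    have "lp_bound p (\<lambda>n. \<bar>v n\<bar>) Nv" by (rule lp_bound_mono[OF p Nv]) simp
    from lp_bound_scaleR[OF p lp_bound_nbr_sum[OF p this], of ?C]
    have "lp_bound p (\<lambda>n. ?C *\<^sub>R w n) (?C * (3 * Nv))" using C by (simp add: w_def abs_of_nonneg)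
    moreover have "lp_bound p (\<lambda>n. norm (X0 n - (sqrt 2 * \<epsilon> * v n, 0))) I0"
      by (rule lp_bound_mono[OF p I0]) simp
    ultimately have "lp_bound p (\<lambda>n. norm (X0 n - (sqrt 2 * \<epsilon> * v n, 0)) + ?C *\<^sub>R w n) (I0 + ?C * (3 * Nv))"
      by (intro lp_bound_add[OF p])
    moreover have "(\<lambda>n. norm (X0 n - (sqrt 2 * \<epsilon> * v n, 0)) + ?C *\<^sub>R w n) = (\<lambda>n. a n + S * (3 * \<delta> * s0 * w n))"
      by (simp add: a_def fun_eq_iff algebra_simps)
    ultimately show ?thesis by simp
  qed
  obtain D where D: "lp_bound p D (exp (3 * (\<bar>\<Omega> - 1\<bar> + 3 * L) * S) * (I0 + (8 * \<sigma>' * K * B + S * (3 * \<delta> * s0)) * (3 * Nv)))"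
    and ED: "\<And>t n. t \<in> {0..S} \<Longrightarrow> norm (E t n) \<le> D n"
  proof (rule lattice_gronwall[OF p Z_deriv Z'_bound E_le E_bounded _ _ _ S Na])
    show "0 \<le> \<bar>\<Omega> - 1\<bar> + 3 * L" using L by simp
    show "0 \<le> a n" for n using \<sigma>' K0 B w0 by (simp add: a_def)
    show "0 \<le> 3 * \<delta> * s0 * w n" for n using \<delta> s0 w0 by simp
  qed auto
  show ?thesis
    unfolding s0_def[symmetric] \<sigma>'_def[symmetric]
  proof (rule lp_bound_mono[OF p D])
    show "norm (X t n - breather \<epsilon> \<Omega> v t n) \<le> norm (D n)" for n
      using ED[OF t, of n] unfolding E_def norm_rotating_error by simp
  qed
qed

section \<open>Long-time approximation by the breather\<close>

theorem theorem2p22: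
  fixes \<alpha> \<beta> \<gamma> \<eta> k_minus k_plus C_i T :: real
    and p :: ennreal
    and V W \<phi> :: "real \<Rightarrow> real"
    and v :: "int \<Rightarrow> real"
  assumes "\<alpha> > 1" and "\<beta> > 0" and "\<gamma> > 0"
    and "(k_minus, k_plus) \<noteq> (0, 0)"
    and "C2 V" and "\<And>r. V r = V_hom \<alpha> k_minus k_plus r + W r"
    and "deriv W 0 = 0"
    and "deriv (deriv W) \<in> O[at 0](\<lambda>r. \<bar>r\<bar> powr (\<alpha> - 1 + \<beta>))"
    and "C2 \<phi>" and "deriv \<phi> 0 = 0"
    and "deriv (deriv \<phi>) \<in> O[at 0](\<lambda>x. \<bar>x\<bar> powr (\<alpha> - 1 + \<gamma>))"
    and "1 \<le> p"
    and "\<eta> = min (\<alpha> - 1) (min \<beta> \<gamma>)"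
    and "C_i > 0" and "T > 0"
    and "localized_stationary \<alpha> v"
  shows "\<exists>\<epsilon>\<^sub>T>0. \<exists>C\<^sub>T>0. \<forall>\<epsilon>\<in>{0<..\<epsilon>\<^sub>T}. \<forall>X0\<in>lp p.
    lp_norm p (\<lambda>n. X0 n - (sqrt 2 * \<epsilon> * v n, 0)) \<le> C_i * \<epsilon> powr (1 + \<eta>) \<longrightarrow>
    (let f = (\<lambda>X n. lattice_J X n + lattice_G V \<phi> X n);
         t_max = T * \<epsilon> powr (1 - \<alpha>);
         \<Omega> = 1 + omega0 \<alpha> k_minus k_plus * \<epsilon> powr (\<alpha> - 1)
     in \<exists>X. lp_solution p f X0 t_max X \<and>
          (\<forall>S\<in>{0..t_max}. \<forall>Y. lp_solution p f X0 S Y \<longrightarrow> (\<forall>t\<in>{0..S}. Y t = X t)) \<and>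
          (\<forall>t\<in>{0..t_max}.
             lp_norm p (\<lambda>n. X t n - breather \<epsilon> \<Omega> v t n) \<le> C\<^sub>T * \<epsilon> powr (1 + \<eta>)))"
proof -
  note \<alpha> = assms(1) and \<beta> = assms(2) and \<gamma> = assms(3) and V = assms(5) and \<phi> = assms(9)
    and \<phi>0 = assms(10) and p = assms(12) and \<eta> = assms(13) and Ci = assms(14) and T = assms(15)
  let ?h = "hom_force \<alpha> k_minus k_plus" and ?\<omega> = "omega0 \<alpha> k_minus k_plus"
  define h' where "h' r = ((k_plus - k_minus) / 2 * (\<alpha> * sgn r) + (k_plus + k_minus) / 2 * \<alpha>) * \<bar>r\<bar> powr (\<alpha> - 1)" for r

  have W_eq: "W = (\<lambda>r. V r - V_hom \<alpha> k_minus k_plus r)" using assms(6) by (simp add: fun_eq_iff)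
  have "(W has_real_derivative deriv V r - ?h r) (at r)" for r
    unfolding W_eq using C2_derivatives(1)[OF V] V_hom_has_derivative \<alpha> by (intro DERIV_diff) auto
  then have W': "deriv W = (\<lambda>r. deriv V r - ?h r)" using DERIV_imp_deriv by blast
  have W'_der: "(deriv W has_real_derivative deriv (deriv V) r - h' r) (at r)" for r
    unfolding W' h'_def using C2_derivatives(2)[OF V] hom_force_has_derivative[OF \<alpha>] by (intro DERIV_diff)
  then have W'': "deriv (deriv W) = (\<lambda>r. deriv (deriv V) r - h' r)" using DERIV_imp_deriv by blast
  have W_der: "(deriv W has_real_derivative deriv (deriv W) r) (at r)" for r using W'_der W'' by simp
  obtain C1 \<rho>1 where C1: "0 < C1" and \<rho>1: "0 < \<rho>1" "\<rho>1 \<le> 1"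
    and W2: "\<And>r. r \<noteq> 0 \<Longrightarrow> \<bar>r\<bar> \<le> \<rho>1 \<Longrightarrow> \<bar>deriv (deriv W) r\<bar> \<le> C1 * \<bar>r\<bar> powr (\<alpha> - 1 + \<beta>)"
    and W1: "\<And>r. \<bar>r\<bar> \<le> \<rho>1 \<Longrightarrow> \<bar>deriv W r\<bar> \<le> C1 * \<bar>r\<bar> powr (\<alpha> - 1 + \<beta> + 1)"
    by (rule bigo_derivative_bounds[OF W_der assms(7,8)]) (use \<alpha> \<beta> in auto)
  obtain C\<phi> \<rho>2 where C\<phi>: "0 < C\<phi>" and \<rho>2: "0 < \<rho>2" "\<rho>2 \<le> 1"
    and \<phi>2: "\<And>r. r \<noteq> 0 \<Longrightarrow> \<bar>r\<bar> \<le> \<rho>2 \<Longrightarrow> \<bar>deriv (deriv \<phi>) r\<bar> \<le> C\<phi> * \<bar>r\<bar> powr (\<alpha> - 1 + \<gamma>)"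
    and \<phi>1: "\<And>r. \<bar>r\<bar> \<le> \<rho>2 \<Longrightarrow> \<bar>deriv \<phi> r\<bar> \<le> C\<phi> * \<bar>r\<bar> powr (\<alpha> - 1 + \<gamma> + 1)"
    by (rule bigo_derivative_bounds[OF C2_derivatives(2)[OF \<phi>] \<phi>0 assms(11)]) (use \<alpha> \<gamma> in auto)

  have v_eq: "\<And>n. v n = - discrete_laplacian \<alpha> v n"
    using assms(16) unfolding localized_stationary_def by blast
  have "v \<in> lp p"
    using localized_stationary_abs_summable[OF \<alpha> assms(16)] by (intro abs_summable_imp_lp[OF p]) simp
  define m where "m = lp_norm p v"
  have Nv: "lp_bound p v m" unfolding m_def by (rule lp_bound_norm) fact
  have vm: "\<bar>v n\<bar> \<le> m" for n using lp_bound_pointwise[OF p Nv] by simp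
  have m: "0 \<le> m" by (rule lp_bound_nonneg[OF Nv])
  obtain H1 H2 H3 H4 B where
    H1: "\<And>x. (H1 has_real_derivative \<bar>cos x\<bar> powr \<alpha> * sin x) (at x)" and
    H2: "\<And>x. (H2 has_real_derivative cos x * \<bar>cos x\<bar> powr (\<alpha> - 1) * sin x) (at x)" and
    H3: "\<And>x. (H3 has_real_derivative \<bar>cos x\<bar> powr \<alpha> * cos x) (at x)" and
    H4: "\<And>x. (H4 has_real_derivative \<bar>cos x\<bar> powr (\<alpha> + 1) - cos_mean \<alpha>) (at x)" and
    HB: "\<And>x. \<bar>H1 x\<bar> \<le> B" "\<And>x. \<bar>H2 x\<bar> \<le> B" "\<And>x. \<bar>H3 x\<bar> \<le> B" "\<And>x. \<bar>H4 x\<bar> \<le> B"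
    using correctors_exist[OF \<alpha>] by blast
  have B: "0 \<le> B" using HB(1)[of 0] by linarith

  define \<mu> where "\<mu> = min \<beta> \<gamma>"
  have \<mu>: "0 < \<mu>" "\<mu> \<le> \<beta>" "\<mu> \<le> \<gamma>" "\<eta> \<le> \<mu>" and \<eta>': "0 < \<eta>" "1 + \<eta> \<le> \<alpha>"
    using \<alpha> \<beta> \<gamma> by (auto simp: \<mu>_def \<eta>)
  \<comment> \<open>clipping radius in units of \<open>\<epsilon>\<close>: twice the sum of a bound for the breather and an error of size \<open>\<epsilon>\<close>, since the forces act on differences of neighbours\<close>
  define R where "R = 2 * sqrt 2 * m + 2"
  have R: "0 < R" using m by (simp add: R_def add_nonneg_pos)
  define C3 where "C3 = \<alpha> * (\<bar>k_plus - k_minus\<bar> + \<bar>k_plus + k_minus\<bar>) + C1 + C\<phi>"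
  have C3: "0 < C3" using C1 C\<phi> \<alpha> by (auto simp: C3_def intro!: add_nonneg_pos)
  define K where "K = \<bar>(k_plus - k_minus) / 2\<bar> * (2 * (2 * m) powr (\<alpha> - 1)) + \<bar>(k_plus + k_minus) / 2\<bar>"
  have K: "0 \<le> K" by (simp add: K_def)
  define Q where "Q = 8 * sqrt 2 powr \<alpha> * K * B + 3 * sqrt 2 * T * (C1 + C\<phi>) * R powr (\<alpha> - 1 + \<mu>)"
  have Q: "0 \<le> Q" using K B T C1 C\<phi> by (simp add: Q_def)
  define C_T where "C_T = exp (3 * (\<bar>?\<omega>\<bar> + 3 * (C3 * R powr (\<alpha> - 1))) * T) * (C_i + Q * (3 * m))"
  have C_T: "0 < C_T" using Ci Q m by (simp add: C_T_def add_pos_nonneg)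
  \<comment> \<open>the four conditions: \<open>\<epsilon> \<le> 1\<close>, validity of the bounds near \<open>0\<close>, \<open>\<Omega> \<ge> 1/2\<close>, and an error of at most \<open>\<epsilon>\<close>\<close>
  define \<epsilon>T where "\<epsilon>T = min (min 1 (min \<rho>1 \<rho>2 / R))
      (min ((1 / (2 * \<bar>?\<omega>\<bar> + 2)) powr (1 / (\<alpha> - 1))) ((1 / C_T) powr (1 / \<eta>)))"
  have \<epsilon>T: "0 < \<epsilon>T" using \<rho>1 \<rho>2 R C_T by (simp add: \<epsilon>T_def)

  have main: "\<exists>X. lp_solution p (lattice_field (deriv V) (deriv \<phi>)) X0 (T * \<epsilon> powr (1 - \<alpha>)) X \<and>
      (\<forall>t\<in>{0..T * \<epsilon> powr (1 - \<alpha>)}.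
         lp_norm p (\<lambda>n. X t n - breather \<epsilon> (1 + ?\<omega> * \<epsilon> powr (\<alpha> - 1)) v t n) \<le> C_T * \<epsilon> powr (1 + \<eta>))"
    if \<epsilon>: "\<epsilon> \<in> {0<..\<epsilon>T}" and X0: "X0 \<in> lp p"
      and init: "lp_norm p (\<lambda>n. X0 n - (sqrt 2 * \<epsilon> * v n, 0)) \<le> C_i * \<epsilon> powr (1 + \<eta>)" for \<epsilon> X0
  proof -
    define S where "S = T * \<epsilon> powr (1 - \<alpha>)"
    define \<Omega> where "\<Omega> = 1 + ?\<omega> * \<epsilon> powr (\<alpha> - 1)"
    define \<rho> where "\<rho> = R * \<epsilon>"
    define L where "L = C3 * \<rho> powr (\<alpha> - 1)"
    define \<delta> where "\<delta> = (C1 + C\<phi>) * \<rho> powr (\<alpha> - 1 + \<mu>)"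
    let ?U = "\<lambda>r. deriv V (clip \<rho> r)" and ?\<psi> = "\<lambda>r. deriv \<phi> (clip \<rho> r)"
    have \<epsilon>0: "0 < \<epsilon>" and \<epsilon>1: "\<epsilon> \<le> 1" and \<epsilon>2: "\<epsilon> \<le> min \<rho>1 \<rho>2 / R"
      and \<epsilon>3: "\<epsilon> \<le> (1 / (2 * \<bar>?\<omega>\<bar> + 2)) powr (1 / (\<alpha> - 1))" and \<epsilon>4: "\<epsilon> \<le> (1 / C_T) powr (1 / \<eta>)"
      using \<epsilon> by (auto simp: \<epsilon>T_def)
    have \<rho>: "0 < \<rho>" "\<rho> \<le> \<rho>1" "\<rho> \<le> \<rho>2" "\<rho> \<le> 1"
      using \<epsilon>0 \<epsilon>2 R \<rho>1 by (auto simp: \<rho>_def pos_le_divide_eq mult.commute)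
    have S: "0 \<le> S" using T by (simp add: S_def)
    have L: "0 \<le> L" using C3 by (simp add: L_def)
    have \<delta>: "0 \<le> \<delta>" using C1 C\<phi> by (simp add: \<delta>_def)
    have small_powr: "\<bar>r\<bar> powr b \<le> \<bar>r\<bar> powr a" if "a \<le> b" "\<bar>r\<bar> \<le> 1" for a b r :: real
      using that by (intro powr_mono') auto

    have U_lip: "\<bar>?U a - ?U b\<bar> \<le> L * \<bar>a - b\<bar>" for a b
    proof (rule clip_comp_lipschitz[OF C2_derivatives(2)[OF V]])
      fix r assume r: "r \<noteq> 0" "\<bar>r\<bar> \<le> \<rho>"
      have "\<bar>(k_plus - k_minus) / 2 * (\<alpha> * sgn r) + (k_plus + k_minus) / 2 * \<alpha>\<bar>
          \<le> \<bar>k_plus - k_minus\<bar> / 2 * \<alpha> + \<bar>k_plus + k_minus\<bar> / 2 * \<alpha>"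
        using \<alpha> r abs_triangle_ineq[of "(k_plus - k_minus) / 2 * (\<alpha> * sgn r)" "(k_plus + k_minus) / 2 * \<alpha>"]
        by (simp add: abs_mult abs_sgn_eq)
      also have "\<dots> \<le> \<alpha> * (\<bar>k_plus - k_minus\<bar> + \<bar>k_plus + k_minus\<bar>)"
      proof -
        have "0 \<le> \<alpha> * \<bar>k_plus - k_minus\<bar>" "0 \<le> \<alpha> * \<bar>k_plus + k_minus\<bar>" using \<alpha> by simp_all
        then show ?thesis by (simp add: algebra_simps)
      qed
      finally have "\<bar>h' r\<bar> \<le> \<alpha> * (\<bar>k_plus - k_minus\<bar> + \<bar>k_plus + k_minus\<bar>) * \<bar>r\<bar> powr (\<alpha> - 1)"
        unfolding h'_def abs_mult[of _ "\<bar>r\<bar> powr (\<alpha> - 1)"] by (simp add: mult_right_mono)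
      moreover have "\<bar>deriv (deriv W) r\<bar> \<le> C1 * \<bar>r\<bar> powr (\<alpha> - 1)"
      proof (rule order_trans[OF W2 mult_left_mono[OF small_powr]])
      qed (use r \<rho> \<beta> C1 in auto)
      moreover have "deriv (deriv V) r = h' r + deriv (deriv W) r" by (simp add: W'')
      moreover have "0 \<le> C\<phi> * \<bar>r\<bar> powr (\<alpha> - 1)" using C\<phi> by simp
      ultimately have "\<bar>deriv (deriv V) r\<bar> \<le> C3 * \<bar>r\<bar> powr (\<alpha> - 1)"
        unfolding C3_def distrib_right by linarith
      also have "\<dots> \<le> L" unfolding L_def using C3 r \<alpha> by (intro mult_left_mono powr_mono2) auto
      finally show "\<bar>deriv (deriv V) r\<bar> \<le> L" .
    qed (use \<rho> L in auto)
    have \<psi>_lip: "\<bar>?\<psi> a - ?\<psi> b\<bar> \<le> L * \<bar>a - b\<bar>" for a b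
    proof (rule clip_comp_lipschitz[OF C2_derivatives(2)[OF \<phi>]])
      fix r assume r: "r \<noteq> 0" "\<bar>r\<bar> \<le> \<rho>"
      have "\<bar>deriv (deriv \<phi>) r\<bar> \<le> C\<phi> * \<bar>r\<bar> powr (\<alpha> - 1)"
      proof (rule order_trans[OF \<phi>2 mult_left_mono[OF small_powr]])
      qed (use r \<rho> \<gamma> C\<phi> in auto)
      also have "\<dots> \<le> C3 * \<rho> powr (\<alpha> - 1)"
        using C1 C\<phi> r \<alpha> by (intro mult_mono powr_mono2) (auto simp: C3_def)
      finally show "\<bar>deriv (deriv \<phi>) r\<bar> \<le> L" by (simp add: L_def)
    qed (use \<rho> L in auto)

    have R\<epsilon>: "2 * (sqrt 2 * \<epsilon> * m) \<le> \<rho>" "0 \<le> sqrt 2 * \<epsilon> * m"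
      using \<epsilon>0 m by (auto simp: \<rho>_def R_def algebra_simps)
    have rate: "C * \<bar>r\<bar> powr (\<alpha> - 1 + b + 1) \<le> \<delta> * \<bar>r\<bar>"
      if "\<bar>r\<bar> \<le> \<rho>" "\<mu> \<le> b" "0 < C" "C \<le> C1 + C\<phi>" for C r b
    proof -
      have "\<bar>r\<bar> powr (\<alpha> - 1 + b + 1) \<le> \<rho> powr (\<alpha> - 1 + b + 1 - 1) * \<bar>r\<bar>"
        by (rule abs_powr_le_linear[OF that(1)]) (use that \<alpha> \<mu> in auto)
      also have "\<alpha> - 1 + b + 1 - 1 = \<alpha> - 1 + b" by simp
      also have "\<rho> powr (\<alpha> - 1 + b) * \<bar>r\<bar> \<le> \<rho> powr (\<alpha> - 1 + \<mu>) * \<bar>r\<bar>"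
        using \<rho> that by (intro mult_right_mono powr_mono') auto
      finally have "C * \<bar>r\<bar> powr (\<alpha> - 1 + b + 1) \<le> (C1 + C\<phi>) * (\<rho> powr (\<alpha> - 1 + \<mu>) * \<bar>r\<bar>)"
        using that by (intro mult_mono) auto
      then show ?thesis by (simp add: \<delta>_def mult.assoc)
    qed
    have consU: "\<bar>?U r - ?h r\<bar> \<le> \<delta> * \<bar>r\<bar>" if "\<bar>r\<bar> \<le> 2 * (sqrt 2 * \<epsilon> * m)" for r
    proof -
      have r: "\<bar>r\<bar> \<le> \<rho>" using that R\<epsilon> by linarith
      have "\<bar>?U r - ?h r\<bar> = \<bar>deriv W r\<bar>" by (simp add: W' clip_eq r)
      also have "\<dots> \<le> C1 * \<bar>r\<bar> powr (\<alpha> - 1 + \<beta> + 1)" using r \<rho> by (intro W1) auto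
      also have "\<dots> \<le> \<delta> * \<bar>r\<bar>" using r \<mu> C1 C\<phi> by (intro rate) auto
      finally show ?thesis .
    qed
    have cons\<psi>: "\<bar>?\<psi> r\<bar> \<le> \<delta> * \<bar>r\<bar>" if "\<bar>r\<bar> \<le> sqrt 2 * \<epsilon> * m" for r
    proof -
      have r: "\<bar>r\<bar> \<le> \<rho>" using that R\<epsilon> by linarith
      have "\<bar>?\<psi> r\<bar> = \<bar>deriv \<phi> r\<bar>" by (simp add: clip_eq r)
      also have "\<dots> \<le> C\<phi> * \<bar>r\<bar> powr (\<alpha> - 1 + \<gamma> + 1)" using r \<rho> by (intro \<phi>1) auto
      also have "\<dots> \<le> \<delta> * \<bar>r\<bar>" using r \<mu> C1 C\<phi> by (intro rate) auto
      finally show ?thesis .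
    qed

    have \<omega>_small: "\<bar>?\<omega>\<bar> * \<epsilon> powr (\<alpha> - 1) \<le> 1 / 2"
    proof -
      have "\<epsilon> powr (\<alpha> - 1) \<le> 1 / (2 * \<bar>?\<omega>\<bar> + 2)"
        using \<epsilon>0 \<epsilon>3 \<alpha> by (intro powr_le_of_le_root) auto
      then have "\<bar>?\<omega>\<bar> * \<epsilon> powr (\<alpha> - 1) \<le> \<bar>?\<omega>\<bar> * (1 / (2 * \<bar>?\<omega>\<bar> + 2))" by (intro mult_left_mono) auto
      also have "\<dots> \<le> 1 / 2" by (simp add: divide_simps)
      finally show ?thesis .
    qed
    have \<Omega>_half: "1 / 2 \<le> \<Omega>"
      using \<omega>_small abs_ge_minus_self[of "?\<omega> * \<epsilon> powr (\<alpha> - 1)"] by (simp add: \<Omega>_def abs_mult)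

    have I0: "lp_bound p (\<lambda>n. X0 n - (sqrt 2 * \<epsilon> * v n, 0)) (C_i * \<epsilon> powr (1 + \<eta>))"
    proof -
      have "lp_bound p (\<lambda>n. (v n, 0 :: real)) m" by (rule lp_bound_mono[OF p Nv]) (simp add: norm_Pair)
      from lp_bound_add[OF p lp_bound_norm[OF X0] lp_bound_scaleR[OF p this, of "- (sqrt 2 * \<epsilon>)"]]
      have "(\<lambda>n. X0 n - (sqrt 2 * \<epsilon> * v n, 0)) \<in> lp p" by (simp add: lp_bound_def prod_eq_iff minus_prod_def plus_prod_def)
      then show ?thesis using init by (simp add: lp_bound_def)
    qed
    have "nbr_lipschitz (1 + 3 * L) (lattice_field ?U ?\<psi>)"
      using U_lip \<psi>_lip L by (rule nbr_lipschitz_lattice_field) (use \<phi>0 \<rho> in \<open>simp add: clip_eq\<close>)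
    then obtain X where X: "lp_solution p (lattice_field ?U ?\<psi>) X0 S X"
      using lp_solution_exists[OF p _ X0 S] by blast

    have error: "lp_bound p (\<lambda>n. X t n - breather \<epsilon> \<Omega> v t n) (C_T * \<epsilon> powr (1 + \<eta>))" if t: "t \<in> {0..S}" for t
    proof (rule lp_bound_weaken)
      show "lp_bound p (\<lambda>n. X t n - breather \<epsilon> \<Omega> v t n)
        (exp (3 * (\<bar>\<Omega> - 1\<bar> + 3 * L) * S) * (C_i * \<epsilon> powr (1 + \<eta>) +
          (8 * (sqrt 2 * \<epsilon>) powr \<alpha> * K * B + S * (3 * \<delta> * (sqrt 2 * \<epsilon>))) * (3 * m)))"
        by (rule breather_error_estimate[OF \<alpha> p \<epsilon>0 \<delta> L S vm v_eq Nv U_lip \<psi>_lip consU cons\<psi> \<Omega>_def \<Omega>_half X I0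
            H1 HB(1) H2 HB(2) H3 HB(3) H4 HB(4) K_def t])
      \<comment> \<open>the time span is exactly long enough to turn the rate \<open>\<epsilon>\<^bsup>\<alpha>-1\<^esup>\<close> into a constant\<close>
      have long_time: "\<epsilon> powr (\<alpha> - 1) * S = T"
        using \<epsilon>0 by (simp add: S_def mult.left_commute powr_add[symmetric])
      have rate_time: "(\<bar>\<Omega> - 1\<bar> + 3 * L) * S = (\<bar>?\<omega>\<bar> + 3 * (C3 * R powr (\<alpha> - 1))) * (\<epsilon> powr (\<alpha> - 1) * S)"
        using \<epsilon>0 R by (simp add: \<Omega>_def L_def \<rho>_def powr_mult abs_mult algebra_simps)
      have ex: "3 * (\<bar>\<Omega> - 1\<bar> + 3 * L) * S = 3 * (\<bar>?\<omega>\<bar> + 3 * (C3 * R powr (\<alpha> - 1))) * T"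
        using arg_cong[OF rate_time, of "\<lambda>x. 3 * x"] unfolding long_time by (simp only: mult.assoc)
      have "(sqrt 2 * \<epsilon>) powr \<alpha> \<le> sqrt 2 powr \<alpha> * \<epsilon> powr (1 + \<eta>)"
        using \<epsilon>0 \<epsilon>1 \<eta>' by (simp add: powr_mult powr_mono')
      then have corrector_size: "8 * (sqrt 2 * \<epsilon>) powr \<alpha> * K * B \<le> 8 * (sqrt 2 powr \<alpha> * \<epsilon> powr (1 + \<eta>)) * K * B"
        using K B by (intro mult_right_mono mult_left_mono) auto
      have remainder_size: "S * (3 * \<delta> * (sqrt 2 * \<epsilon>)) \<le> 3 * sqrt 2 * T * (C1 + C\<phi>) * R powr (\<alpha> - 1 + \<mu>) * \<epsilon> powr (1 + \<eta>)"
      proof -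
        have "\<rho> powr (\<alpha> - 1 + \<mu>) = R powr (\<alpha> - 1 + \<mu>) * (\<epsilon> powr (\<alpha> - 1) * \<epsilon> powr \<mu>)"
          using \<epsilon>0 R by (simp add: \<rho>_def powr_mult powr_add)
        then have "S * (3 * \<delta> * (sqrt 2 * \<epsilon>))
            = 3 * sqrt 2 * (\<epsilon> powr (\<alpha> - 1) * S) * (C1 + C\<phi>) * R powr (\<alpha> - 1 + \<mu>) * (\<epsilon> * \<epsilon> powr \<mu>)"
          unfolding \<delta>_def by (simp only: mult_ac)
        also have "\<epsilon> * \<epsilon> powr \<mu> = \<epsilon> powr (1 + \<mu>)" using \<epsilon>0 by (simp add: powr_add)
        finally show ?thesis
          unfolding long_time using \<epsilon>0 \<epsilon>1 \<mu> T C1 C\<phi> by (auto intro!: mult_left_mono powr_mono')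
      qed
      have "8 * (sqrt 2 * \<epsilon>) powr \<alpha> * K * B + S * (3 * \<delta> * (sqrt 2 * \<epsilon>)) \<le> Q * \<epsilon> powr (1 + \<eta>)"
        using add_mono[OF corrector_size remainder_size] unfolding Q_def distrib_right by (simp only: mult_ac)
      then have "C_i * \<epsilon> powr (1 + \<eta>) + (8 * (sqrt 2 * \<epsilon>) powr \<alpha> * K * B + S * (3 * \<delta> * (sqrt 2 * \<epsilon>))) * (3 * m)
          \<le> C_i * \<epsilon> powr (1 + \<eta>) + (Q * \<epsilon> powr (1 + \<eta>)) * (3 * m)"
        using m by (intro add_left_mono mult_right_mono) auto
      also have "\<dots> = (C_i + Q * (3 * m)) * \<epsilon> powr (1 + \<eta>)" by (simp add: algebra_simps)
      finally show "exp (3 * (\<bar>\<Omega> - 1\<bar> + 3 * L) * S) * (C_i * \<epsilon> powr (1 + \<eta>) +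
          (8 * (sqrt 2 * \<epsilon>) powr \<alpha> * K * B + S * (3 * \<delta> * (sqrt 2 * \<epsilon>))) * (3 * m)) \<le> C_T * \<epsilon> powr (1 + \<eta>)"
        unfolding ex C_T_def mult.assoc[of "exp _"] by (intro mult_left_mono) auto
    qed

    \<comment> \<open>the error estimate keeps the solution where clipping has no effect\<close>
    have stay: "\<bar>fst (X t n)\<bar> \<le> (sqrt 2 * m + 1) * \<epsilon>" if t: "t \<in> {0..S}" for t n
    proof -
      have "C_T * \<epsilon> powr (1 + \<eta>) \<le> \<epsilon>"
      proof -
        have "\<epsilon> powr \<eta> \<le> 1 / C_T" using \<epsilon>0 \<epsilon>4 \<eta>' C_T by (intro powr_le_of_le_root) auto
        then have "C_T * \<epsilon> powr \<eta> \<le> 1" using C_T by (simp add: pos_le_divide_eq mult.commute)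
        then have "\<epsilon> * (C_T * \<epsilon> powr \<eta>) \<le> \<epsilon> * 1" using \<epsilon>0 by (intro mult_left_mono) auto
        then show ?thesis using \<epsilon>0 by (simp add: powr_add mult_ac)
      qed
      moreover have "norm (X t n - breather \<epsilon> \<Omega> v t n) \<le> C_T * \<epsilon> powr (1 + \<eta>)"
        by (rule lp_bound_pointwise[OF p error[OF t]])
      moreover have "\<bar>fst (X t n) - sqrt 2 * \<epsilon> * (v n * cos (\<Omega> * t))\<bar> \<le> norm (X t n - breather \<epsilon> \<Omega> v t n)"
        using norm_le_Pair(1)[of "X t n - breather \<epsilon> \<Omega> v t n"] by (simp add: breather_def)
      moreover have "\<bar>sqrt 2 * \<epsilon> * (v n * cos (\<Omega> * t))\<bar> \<le> sqrt 2 * \<epsilon> * m"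
      proof -
        have "\<bar>v n * cos (\<Omega> * t)\<bar> \<le> m"
          using mult_mono[OF vm[of n] abs_cos_le_one[of "\<Omega> * t"]] m by (simp add: abs_mult)
        then show ?thesis using \<epsilon>0 by (simp add: abs_mult)
      qed
      moreover have "(sqrt 2 * m + 1) * \<epsilon> = sqrt 2 * \<epsilon> * m + \<epsilon>" by (simp add: algebra_simps)
      ultimately show ?thesis by linarith
    qed
    have "lp_solution p (lattice_field (deriv V) (deriv \<phi>)) X0 S X"
    proof (rule lp_solution_cong[OF X], rule lattice_field_clip[OF stay])
      show "2 * ((sqrt 2 * m + 1) * \<epsilon>) \<le> \<rho>" by (simp add: \<rho>_def R_def algebra_simps)
    qed
    then show ?thesis using error by (auto simp: S_def \<Omega>_def lp_bound_def)
  qed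

  show ?thesis
  proof (rule exI[of _ \<epsilon>T], intro conjI \<epsilon>T, rule exI[of _ C_T], intro conjI C_T ballI impI)
    fix \<epsilon> and X0 :: "int \<Rightarrow> real \<times> real"
    assume *: "\<epsilon> \<in> {0<..\<epsilon>T}" "X0 \<in> lp p"
      "lp_norm p (\<lambda>n. X0 n - (sqrt 2 * \<epsilon> * v n, 0)) \<le> C_i * \<epsilon> powr (1 + \<eta>)"
    let ?S = "T * \<epsilon> powr (1 - \<alpha>)"
    obtain X where X: "lp_solution p (lattice_field (deriv V) (deriv \<phi>)) X0 ?S X"
      and error: "\<forall>t\<in>{0..?S}. lp_norm p (\<lambda>n. X t n - breather \<epsilon> (1 + ?\<omega> * \<epsilon> powr (\<alpha> - 1)) v t n)
         \<le> C_T * \<epsilon> powr (1 + \<eta>)"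
      using main[OF *] by blast
    have "\<forall>S\<in>{0..?S}. \<forall>Y. lp_solution p (lattice_field (deriv V) (deriv \<phi>)) X0 S Y \<longrightarrow> (\<forall>t\<in>{0..S}. Y t = X t)"
      using lattice_solution_unique[OF p V \<phi> \<phi>0 lp_solution_restrict[OF X]] by auto
    then show "let f = (\<lambda>X n. lattice_J X n + lattice_G V \<phi> X n); t_max = T * \<epsilon> powr (1 - \<alpha>);
         \<Omega> = 1 + omega0 \<alpha> k_minus k_plus * \<epsilon> powr (\<alpha> - 1)
     in \<exists>X. lp_solution p f X0 t_max X \<and>
          (\<forall>S\<in>{0..t_max}. \<forall>Y. lp_solution p f X0 S Y \<longrightarrow> (\<forall>t\<in>{0..S}. Y t = X t)) \<and>
          (\<forall>t\<in>{0..t_max}. lp_norm p (\<lambda>n. X t n - breather \<epsilon> \<Omega> v t n) \<le> C_T * \<epsilon> powr (1 + \<eta>))"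
      unfolding Let_def lattice_field_eq using X error by blast
  qed
qed

end
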